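(* There exist (complete) hyperbolic surfaces $S_1, S_2$ and, for $i=1,2$, rays $\alpha_i,\alpha_i'$ on $S_i$ such that: (i) $d_\infty(\alpha_1,\alpha_1')<\infty$ but $B_{\alpha_1}\neq B_{\alpha_1'}$; (ii) $B_{\alpha_2}=B_{\alpha_2'}$ but $d_\infty(\alpha_2,\alpha_2')=+\infty$.
   Context: Let $X$ be a complete Riemannian manifold with distance $d$. A ray is a half-geodesic $\alpha:[0,+\infty)\to X$ parametrized by arc-length with $d(\alpha(t),\alpha(s))=|t-s|$ for all $s,t\ge 0$. For rays $\alpha,\beta$ (possibly with different origins), one writes $d_\infty(\alpha,\beta)<\infty$ if $\sup_{t\ge 0} d(\alpha(t),\beta(t))<\infty$, and $d_\infty(\alpha,\beta)=+\infty$ otherwise. The Busemann function of a ray $\alpha$ is the function of two variables $B_\alpha(x,y)=\lim_{t\to+\infty}\big(d(x,\alpha(t))-d(\alpha(t),y)\big)$, $x,y\in X$. A hyperbolic surface is a complete Riemannian surface of constant curvature $-1$. *)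

theory Defs
  imports "HOL-Analysis.Analysis"
begin

section \<open>Smooth maps between open subsets of Euclidean spaces\<close>

primrec Ck_on ::
  "nat \<Rightarrow> ('e::euclidean_space \<Rightarrow> 'f::real_normed_vector) \<Rightarrow> 'e set \<Rightarrow> bool" where
  "Ck_on 0 f W \<longleftrightarrow> continuous_on W f"
| "Ck_on (Suc k) f W \<longleftrightarrow>
     (\<forall>x\<in>W. f differentiable (at x)) \<and>
     (\<forall>v. Ck_on k (\<lambda>x. frechet_derivative f (at x) v) W)"

definition Cinfinity_on ::
  "('e::euclidean_space \<Rightarrow> 'f::real_normed_vector) \<Rightarrow> 'e set \<Rightarrow> bool" where
  "Cinfinity_on f W \<longleftrightarrow> (\<forall>k. Ck_on k f W)"


section \<open>Riemannian manifolds\<close>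

text \<open>
  A manifold modelled on the Euclidean space \<open>'e\<close> has a topology on a set of points and a
  (not necessarily maximal) smooth atlas. A chart is a pair of an open domain and a coordinate
  map; values of the coordinate map outside the domain are irrelevant. The metric tensor is
  recorded by its coordinate expression in each chart: a bilinear form at each point of the
  image of the chart.
\<close>

type_synonym ('a, 'e) chart = "'a set \<times> ('a \<Rightarrow> 'e)"

record ('a, 'e) riemannian =
  rtop :: "'a topology"
  atlas :: "('a, 'e) chart set"
  tensor :: "('a, 'e) chart \<Rightarrow> 'e \<Rightarrow> 'e \<Rightarrow> 'e \<Rightarrow> real"

abbreviation points :: "('a, 'e) riemannian \<Rightarrow> 'a set" where
  "points M \<equiv> topspace (rtop M)"

abbreviation chart_dom :: "('a, 'e) chart \<Rightarrow> 'a set" where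
  "chart_dom c \<equiv> fst c"

abbreviation coord :: "('a, 'e) chart \<Rightarrow> 'a \<Rightarrow> 'e" where
  "coord c \<equiv> snd c"

definition transition :: "('a, 'e) chart \<Rightarrow> ('a, 'e) chart \<Rightarrow> 'e \<Rightarrow> 'e" where
  "transition c c' = coord c' \<circ> inv_into (chart_dom c) (coord c)"

definition smooth_manifold :: "('a, 'e::euclidean_space) riemannian \<Rightarrow> bool" where
  "smooth_manifold M \<longleftrightarrow>
     Hausdorff_space (rtop M) \<and> second_countable (rtop M) \<and>
     (\<Union>c\<in>atlas M. chart_dom c) = points M \<and>
     (\<forall>c\<in>atlas M.
        openin (rtop M) (chart_dom c) \<and>
        open (coord c ` chart_dom c) \<and>
        homeomorphic_map (subtopology (rtop M) (chart_dom c))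
          (top_of_set (coord c ` chart_dom c)) (coord c)) \<and>
     (\<forall>c\<in>atlas M. \<forall>c'\<in>atlas M.
        Cinfinity_on (transition c c') (coord c ` (chart_dom c \<inter> chart_dom c')))"

definition riemannian_metric :: "('a, 'e::euclidean_space) riemannian \<Rightarrow> bool" where
  "riemannian_metric M \<longleftrightarrow>
     (\<forall>c\<in>atlas M.
        (\<forall>u v. Cinfinity_on (\<lambda>x. tensor M c x u v) (coord c ` chart_dom c)) \<and>
        (\<forall>x\<in>coord c ` chart_dom c.
           bilinear (tensor M c x) \<and>
           (\<forall>u v. tensor M c x u v = tensor M c x v u) \<and>
           (\<forall>u. u \<noteq> 0 \<longrightarrow> tensor M c x u u > 0))) \<and>
     (\<forall>c\<in>atlas M. \<forall>c'\<in>atlas M. \<forall>x\<in>coord c ` (chart_dom c \<inter> chart_dom c'). \<forall>u v.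
        tensor M c x u v =
        tensor M c' (transition c c' x)
          (frechet_derivative (transition c c') (at x) u)
          (frechet_derivative (transition c c') (at x) v))"

definition riemannian_manifold :: "('a, 'e::euclidean_space) riemannian \<Rightarrow> bool" where
  "riemannian_manifold M \<longleftrightarrow>
     smooth_manifold M \<and> riemannian_metric M \<and> connected_space (rtop M)"


section \<open>Riemannian distance\<close>

definition piecewise_C1_curve ::
  "('a, 'e::euclidean_space) riemannian \<Rightarrow> (real \<Rightarrow> 'a) \<Rightarrow> bool" where
  "piecewise_C1_curve M \<gamma> \<longleftrightarrow>
     pathin (rtop M) \<gamma> \<and>
     (\<forall>c\<in>atlas M. \<forall>a b. 0 \<le> a \<and> a < b \<and> b \<le> 1 \<and> \<gamma> ` {a..b} \<subseteq> chart_dom c \<longrightarrow>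
        (coord c \<circ> \<gamma>) piecewise_C1_differentiable_on {a..b})"

text \<open>The choice of chart does not affect the speed at parameters where the curve is
  differentiable, that is, at all but finitely many parameters.\<close>

definition speed ::
  "('a, 'e::euclidean_space) riemannian \<Rightarrow> (real \<Rightarrow> 'a) \<Rightarrow> real \<Rightarrow> real" where
  "speed M \<gamma> t =
     (let c = (SOME c. c \<in> atlas M \<and> \<gamma> t \<in> chart_dom c);
          v = vector_derivative (coord c \<circ> \<gamma>) (at t)
      in sqrt (tensor M c (coord c (\<gamma> t)) v v))"

text \<open>The library's piecewise \<open>C\<^sup>1\<close> curves may have unbounded derivative at the finitely many
  exceptional parameters. With an integral in \<^typ>\<open>ennreal\<close> such curves have their true, possibly
  infinite, length, so that they do not change the infimum defining the distance.\<close>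

definition curve_length ::
  "('a, 'e::euclidean_space) riemannian \<Rightarrow> (real \<Rightarrow> 'a) \<Rightarrow> ennreal" where
  "curve_length M \<gamma> = (\<integral>\<^sup>+t\<in>{0..1}. ennreal (speed M \<gamma> t) \<partial>lborel)"

text \<open>On a connected manifold the infimum is finite.\<close>

definition rdist :: "('a, 'e::euclidean_space) riemannian \<Rightarrow> 'a \<Rightarrow> 'a \<Rightarrow> real" where
  "rdist M p q =
     enn2real (INF \<gamma>\<in>{\<gamma>. piecewise_C1_curve M \<gamma> \<and> \<gamma> 0 = p \<and> \<gamma> 1 = q}. curve_length M \<gamma>)"

definition complete_riemannian :: "('a, 'e::euclidean_space) riemannian \<Rightarrow> bool" where
  "complete_riemannian M \<longleftrightarrow>
     riemannian_manifold M \<and> Metric_space.mcomplete (points M) (rdist M)"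


section \<open>Levi-Civita connection and curvature\<close>

text \<open>
  Everything is expressed in one chart, for a coordinate metric tensor \<open>g\<close>; vectors stand for
  coordinate vector fields with constant coefficients. Such fields commute, so the Koszul formula
  for the covariant derivative of \<open>v\<close> in direction \<open>u\<close> has only the three derivative terms below.
\<close>

definition christoffel ::
  "('e::euclidean_space \<Rightarrow> 'e \<Rightarrow> 'e \<Rightarrow> real) \<Rightarrow> 'e \<Rightarrow> 'e \<Rightarrow> 'e \<Rightarrow> 'e" where
  "christoffel g x u v =
     (THE w. \<forall>z. 2 * g x w z =
        frechet_derivative (\<lambda>y. g y v z) (at x) u
        + frechet_derivative (\<lambda>y. g y u z) (at x) v
        - frechet_derivative (\<lambda>y. g y u v) (at x) z)"

definition curvature_tensor ::
  "('e::euclidean_space \<Rightarrow> 'e \<Rightarrow> 'e \<Rightarrow> real) \<Rightarrow> 'e \<Rightarrow> 'e \<Rightarrow> 'e \<Rightarrow> 'e \<Rightarrow> 'e" where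
  "curvature_tensor g x u v w =
     frechet_derivative (\<lambda>y. christoffel g y v w) (at x) u
     - frechet_derivative (\<lambda>y. christoffel g y u w) (at x) v
     + christoffel g x u (christoffel g x v w)
     - christoffel g x v (christoffel g x u w)"

definition sectional_curvature ::
  "('e::euclidean_space \<Rightarrow> 'e \<Rightarrow> 'e \<Rightarrow> real) \<Rightarrow> 'e \<Rightarrow> 'e \<Rightarrow> 'e \<Rightarrow> real" where
  "sectional_curvature g x u v =
     g x (curvature_tensor g x u v v) u / (g x u u * g x v v - (g x u v)\<^sup>2)"

definition constant_curvature :: "real \<Rightarrow> ('a, 'e::euclidean_space) riemannian \<Rightarrow> bool" where
  "constant_curvature \<kappa> M \<longleftrightarrow>
     (\<forall>c\<in>atlas M. \<forall>x\<in>coord c ` chart_dom c. \<forall>u v. u \<noteq> v \<longrightarrow> independent {u, v} \<longrightarrow>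
        sectional_curvature (tensor M c) x u v = \<kappa>)"

definition hyperbolic_surface :: "('a, 'e::euclidean_space) riemannian \<Rightarrow> bool" where
  "hyperbolic_surface M \<longleftrightarrow>
     DIM('e) = 2 \<and> complete_riemannian M \<and> constant_curvature (-1) M"


section \<open>Rays and Busemann functions\<close>

text \<open>In every chart, a geodesic solves \<open>c'' + \<Gamma>(c', c') = 0\<close>; \<open>v\<close> is the coordinate velocity
  \<open>c'\<close>.\<close>

definition geodesic_on ::
  "('a, 'e::euclidean_space) riemannian \<Rightarrow> real set \<Rightarrow> (real \<Rightarrow> 'a) \<Rightarrow> bool" where
  "geodesic_on M I \<alpha> \<longleftrightarrow>
     continuous_map (top_of_set I) (rtop M) \<alpha> \<and>
     (\<forall>c\<in>atlas M. \<exists>v. \<forall>t\<in>I. \<alpha> t \<in> chart_dom c \<longrightarrow>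
        ((coord c \<circ> \<alpha>) has_vector_derivative v t) (at t within I) \<and>
        (v has_vector_derivative - christoffel (tensor M c) (coord c (\<alpha> t)) (v t) (v t))
          (at t within I))"

text \<open>Rays are functions on all of \<^typ>\<open>real\<close>, of which only the restriction to \<open>{0..}\<close> matters.\<close>

definition ray :: "('a, 'e::euclidean_space) riemannian \<Rightarrow> (real \<Rightarrow> 'a) \<Rightarrow> bool" where
  "ray M \<alpha> \<longleftrightarrow>
     geodesic_on M {0..} \<alpha> \<and> (\<forall>t\<ge>0. \<forall>s\<ge>0. rdist M (\<alpha> t) (\<alpha> s) = \<bar>t - s\<bar>)"

definition dist_infinity ::
  "('a, 'e::euclidean_space) riemannian \<Rightarrow> (real \<Rightarrow> 'a) \<Rightarrow> (real \<Rightarrow> 'a) \<Rightarrow> ereal" where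
  "dist_infinity M \<alpha> \<beta> = (SUP t\<in>{0..}. ereal (rdist M (\<alpha> t) (\<beta> t)))"

text \<open>Restricting to points of \<open>M\<close> makes equality of Busemann functions equality in HOL.\<close>

definition busemann ::
  "('a, 'e::euclidean_space) riemannian \<Rightarrow> (real \<Rightarrow> 'a) \<Rightarrow> 'a \<times> 'a \<Rightarrow> real" where
  "busemann M \<alpha> =
     (\<lambda>(x, y)\<in>points M \<times> points M. Lim at_top (\<lambda>t. rdist M x (\<alpha> t) - rdist M (\<alpha> t) y))"

end

(*
  Remove from the upper half-plane the open half-discs over infinitely many disjoint intervals
  (p n, q n) of the positive half-axis, and double the remaining region along its boundary geodesics.
  The two copies of the imaginary half-axis are rays. A curve from one to the other must cross a
  boundary arc, and its length is bounded below by the variation of functions on the half-plane that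
  are nonexpansive for the hyperbolic metric.

  Every point z of the arc over (p n, q n) satisfies Im z <= sin(theta) |z|, where theta < pi/2 is the
  angle between the real axis and the tangent from 0 to the arc. If q n / p n is constant and the gaps
  are spaced geometrically, then the two rays stay at bounded distance, but changing sheets costs a
  fixed extra length 2 ln (1 / sin(theta)), so that the Busemann functions differ. If q n / p n tends
  to infinity, then the rays come arbitrarily close to each other near the tangent points, so that the
  Busemann functions agree; if p (n+1) / q n tends to infinity as well, then the rays are far apart
  between consecutive gaps.
*)

theory Submission
  imports Defs "HOL-Complex_Analysis.Complex_Analysis"
begin

section \<open>Smoothness\<close>

text \<open>The double is modelled on the \<open>w\<close>-plane without the real points outside the
  gaps, which settles its topology and leaves the geometry to the charts. Chart \<open>n\<close>
  unfolds the double across arc \<open>n\<close> alone: it keeps the upper sheet and reflects the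
  lower one in that arc. Two different charts then meet only in the open sheets, where the
  transition is the identity or a product of two reflections, a holomorphic isometry.

  Lower bounds use the folding map \<open>proj\<close>: composed with a nonexpansive function, it
  varies along a curve by at most the length, on either sheet. The cost of changing sheets comes
  from two different functions: the Busemann function at 0 before the crossing point z, and ln Im
  (up to sign the one at infinity) after it. Their variations add up to at least t + 2 ln (|z| / Im
  z), and |z| / Im z is smallest at a tangent point. Upper bounds come from horizontal segments
  ending at the tangent points, of length 2 sqrt (p q) / (q - p) on each sheet. Since d(x, \<alpha>
  t) - t is monotone, the limits defining Busemann functions exist, and one sequence of parameters
  suffices to compare them.\<close>

lemma Ck_on_cong:
  assumes "open W" "\<And>x. x \<in> W \<Longrightarrow> f x = g x"
  shows "Ck_on k f W \<longleftrightarrow> Ck_on k g W"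
  using assms(2)
proof (induction k arbitrary: f g)
  case 0
  then show ?case by (simp cong: continuous_on_cong)
next
  case (Suc k)
  have hd: "(f has_derivative D) (at x) \<longleftrightarrow> (g has_derivative D) (at x)" if "x \<in> W" for x D
    using has_derivative_transform_within_open[OF _ assms(1) that, of f D UNIV g]
      has_derivative_transform_within_open[OF _ assms(1) that, of g D UNIV f] Suc.prems by auto
  then have "frechet_derivative f (at x) = frechet_derivative g (at x)" if "x \<in> W" for x
    unfolding frechet_derivative_def using that by simp
  moreover have "f differentiable (at x) \<longleftrightarrow> g differentiable (at x)" if "x \<in> W" for x
    unfolding differentiable_def using hd that by simp
  moreover have "Ck_on k (\<lambda>x. frechet_derivative f (at x) v) W \<longleftrightarrow>
      Ck_on k (\<lambda>x. frechet_derivative g (at x) v) W" for v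
    by (rule Suc.IH) (use calculation(1) in simp)
  ultimately show ?case
    by simp
qed

lemma frechet_derivative_holomorphic:
  assumes "f holomorphic_on W" "open W" "x \<in> W"
  shows "f differentiable (at x)" "frechet_derivative f (at x) v = deriv f x * v"
proof -
  have "(f has_derivative (*) (deriv f x)) (at x)"
    using holomorphic_derivI[OF assms(1,2,3)] by (simp add: has_field_derivative_def)
  then show "f differentiable (at x)" "frechet_derivative f (at x) v = deriv f x * v"
    using frechet_derivative_at[of f "(*) (deriv f x)" x] by (auto simp: differentiable_def)
qed

text \<open>The derivative in a fixed direction \<open>v\<close> is \<open>deriv f\<close> times
  \<open>v\<close>, again holomorphic, so the induction runs over all holomorphic functions at once.
  It serves the transition maps.\<close>

lemma holomorphic_Cinfinity_on:
  assumes "f holomorphic_on W" "open W"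
  shows "Cinfinity_on f W"
proof -
  have "Ck_on k f W" for k
    using assms(1)
  proof (induction k arbitrary: f)
    case 0
    then show ?case by (simp add: holomorphic_on_imp_continuous_on)
  next
    case (Suc k)
    have "Ck_on k (\<lambda>x. frechet_derivative f (at x) v) W" for v
    proof -
      have "Ck_on k (\<lambda>x. deriv f x * v) W"
        by (intro Suc.IH holomorphic_intros holomorphic_deriv Suc.prems assms(2))
      then show ?thesis
        using Ck_on_cong[OF assms(2), of "\<lambda>x. frechet_derivative f (at x) v" "\<lambda>x. deriv f x * v"]
          frechet_derivative_holomorphic[OF Suc.prems assms(2)] by simp
    qed
    then show ?case
      using frechet_derivative_holomorphic[OF Suc.prems assms(2)] by simp
  qed
  then show ?thesis by (simp add: Cinfinity_on_def)
qed

lemma has_derivative_Im_power: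
  assumes "Im z \<noteq> 0"
  shows "((\<lambda>z. c / Im z ^ n) has_derivative (\<lambda>v. - (real n * c * Im v / Im z ^ Suc n))) (at z)"
proof -
  have "((\<lambda>y. c / y ^ n) has_real_derivative - (real n * c / Im z ^ Suc n)) (at (Im z))"
  proof (cases n)
    case (Suc m)
    have "((\<lambda>y. c / y ^ n) has_real_derivative - (c * (real n * Im z ^ m)) / (Im z ^ n * Im z ^ n)) (at (Im z))"
      using assms Suc by (auto intro!: derivative_eq_intros simp del: power_Suc)
    moreover have "Im z ^ n * Im z ^ n = Im z ^ Suc n * Im z ^ m"
      by (simp add: Suc)
    ultimately show ?thesis
      using assms by (simp add: mult_ac)
  qed simp
  from has_derivative_compose[OF has_derivative_Im[OF has_derivative_ident] this[unfolded has_field_derivative_def]]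
  show ?thesis by (simp add: mult_ac)
qed

text \<open>Directional derivatives stay within the family \<open>c / Im z ^ n\<close>, so the
  induction varies both \<open>c\<close> and \<open>n\<close>. The case \<open>n = 2\<close> gives
  the metric coefficients.\<close>

lemma Cinfinity_on_Im_power:
  assumes "open W" "\<And>z. z \<in> W \<Longrightarrow> Im z \<noteq> 0"
  shows "Cinfinity_on (\<lambda>z. c / Im z ^ n) W"
proof -
  have "Ck_on k (\<lambda>z. c / Im z ^ n) W" for k
  proof (induction k arbitrary: c n)
    case 0
    then show ?case using assms(2) by (auto intro!: continuous_intros)
  next
    case (Suc k)
    have fd: "frechet_derivative (\<lambda>z. c / Im z ^ n) (at z) v = - (real n * c * Im v) / Im z ^ Suc n"
      if "z \<in> W" for z v
      using frechet_derivative_at[OF has_derivative_Im_power[OF assms(2)[OF that], of c n], symmetric]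
      by simp
    have "Ck_on k (\<lambda>z. frechet_derivative (\<lambda>z. c / Im z ^ n) (at z) v) W" for v
    proof -
      have "Ck_on k (\<lambda>z. - (real n * c * Im v) / Im z ^ Suc n) W"
        by (rule Suc.IH)
      then show ?thesis
        using Ck_on_cong[of W "\<lambda>z. frechet_derivative (\<lambda>z. c / Im z ^ n) (at z) v"
            "\<lambda>z. - (real n * c * Im v) / Im z ^ Suc n" k] assms(1) fd by blast
    qed
    moreover have "(\<lambda>z. c / Im z ^ n) differentiable (at z)" if "z \<in> W" for z
      using has_derivative_Im_power[OF assms(2)[OF that]] differentiable_def by blast
    ultimately show ?case by simp
  qed
  then show ?thesis by (simp add: Cinfinity_on_def)
qed

lemma Cinfinity_onD:
  assumes "Cinfinity_on f W"
  shows "\<And>x. x \<in> W \<Longrightarrow> f differentiable (at x)"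
    and "\<And>v. continuous_on W (\<lambda>x. frechet_derivative f (at x) v)"
    and "continuous_on W f"
proof -
  have *: "Ck_on (Suc 0) f W" "Ck_on 0 f W"
    using assms unfolding Cinfinity_on_def by blast+
  then show "\<And>x. x \<in> W \<Longrightarrow> f differentiable (at x)"
    and "\<And>v. continuous_on W (\<lambda>x. frechet_derivative f (at x) v)" "continuous_on W f"
    by simp_all
qed

section \<open>A fundamental theorem with nonnegative integrals\<close>

text \<open>The derivative may be unbounded near the exceptional points, so its Lebesgue
  integrability is not known beforehand. The gauge integral provides the fundamental theorem all the
  same; if the absolute value has infinite integral the bound is trivial, and otherwise both
  integrals agree.\<close>

lemma abs_diff_le_nn_integral_derivative:
  fixes f :: "real \<Rightarrow> real"
  assumes "a \<le> b" "finite S" "continuous_on {a..b} f"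
    and d: "\<And>t. t \<in> {a<..<b} - S \<Longrightarrow> (f has_vector_derivative f' t) (at t)"
    and s: "\<And>t. t \<in> {a<..<b} - S \<Longrightarrow> \<bar>f' t\<bar> \<le> s t"
  shows "ennreal \<bar>f b - f a\<bar> \<le> (\<integral>\<^sup>+t\<in>{a..b}. ennreal (s t) \<partial>lborel)"
proof -
  \<comment> \<open>Zero at the exceptional points, so that the bound by \<open>s\<close> holds
    there whatever the value of \<open>s\<close>.\<close>
  define g where "g t = (if t \<in> {a<..<b} - S then f' t else 0)" for t
  have gi: "(g has_integral f b - f a) {a..b}"
    by (rule fundamental_theorem_of_calculus_interior_strong[OF assms(2,1)])
      (use d assms(3) in \<open>auto simp: g_def\<close>)
  have gs: "ennreal \<bar>g t\<bar> * indicator {a..b} t \<le> ennreal (s t) * indicator {a..b} t" for t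
    using s[of t] by (auto simp: g_def indicator_def intro!: ennreal_leI)
  have "ennreal \<bar>f b - f a\<bar> \<le> (\<integral>\<^sup>+t. ennreal \<bar>g t\<bar> * indicator {a..b} t \<partial>lborel)"
  proof (cases "(\<integral>\<^sup>+t. ennreal \<bar>g t\<bar> * indicator {a..b} t \<partial>lborel) < \<infinity>")
    case True
    define G where "G t = indicator {a..b} t *\<^sub>R g t" for t
    have Gm: "G \<in> borel_measurable lebesgue"
      unfolding G_def by (rule has_integral_implies_lebesgue_measurable[OF gi])
    have eq: "(\<integral>\<^sup>+t. ennreal \<bar>G t\<bar> \<partial>lebesgue) = (\<integral>\<^sup>+t. ennreal \<bar>g t\<bar> * indicator {a..b} t \<partial>lborel)"
      unfolding nn_integral_completion by (intro nn_integral_cong) (auto simp: G_def indicator_def)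
    have Gint: "integrable lebesgue G"
      using Gm True eq by (intro integrableI_bounded) auto
    \<comment> \<open>Being Lebesgue integrable, \<open>G\<close> has its Lebesgue integral as gauge
      integral, and the latter is already known to be \<open>f b - f a\<close>.\<close>
    have "(G has_integral integral\<^sup>L lebesgue G) UNIV"
      using has_integral_integral_lebesgue[OF Gint] .
    moreover have "(G has_integral f b - f a) UNIV"
    proof -
      have "G = (\<lambda>t. if t \<in> {a..b} then g t else 0)"
        by (auto simp: G_def indicator_def)
      then show ?thesis
        using gi has_integral_restrict_UNIV[of "{a..b}" g "f b - f a"] by simp
    qed
    ultimately have "f b - f a = integral\<^sup>L lebesgue G" by (rule has_integral_unique[rotated])
    then have "\<bar>f b - f a\<bar> \<le> integral\<^sup>L lebesgue (\<lambda>t. \<bar>G t\<bar>)"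
      using integral_abs_bound[of lebesgue G] by simp
    then have "ennreal \<bar>f b - f a\<bar> \<le> ennreal (integral\<^sup>L lebesgue (\<lambda>t. \<bar>G t\<bar>))"
      by (rule ennreal_leI)
    also have "\<dots> = (\<integral>\<^sup>+t. ennreal \<bar>G t\<bar> \<partial>lebesgue)"
      using Gint by (intro nn_integral_eq_integral[symmetric]) auto
    finally show ?thesis using eq by simp
  qed (simp add: top.not_eq_extremum[symmetric])
  also have "\<dots> \<le> (\<integral>\<^sup>+t\<in>{a..b}. ennreal (s t) \<partial>lborel)"
    by (intro nn_integral_mono gs)
  finally show ?thesis .
qed

section \<open>Curves in a Riemannian manifold\<close>

lemma pathin_near:
  assumes "pathin X g" "openin X U" "t \<in> {0..1}" "g t \<in> U"
  obtains d where "d > 0" "\<And>s. s \<in> {0..1} \<Longrightarrow> \<bar>s - t\<bar> < d \<Longrightarrow> g s \<in> U"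
proof -
  have "openin (top_of_set {0..1}) {s \<in> {0..1}. g s \<in> U}"
    using assms(1,2) unfolding pathin_def continuous_map by fastforce
  then obtain d where "d > 0" "\<And>s. s \<in> {0..1} \<Longrightarrow> dist s t < d \<Longrightarrow> g s \<in> U"
    using assms(3,4) unfolding openin_euclidean_subtopology_iff by blast
  then show ?thesis using that by (auto simp: dist_real_def)
qed

text \<open>Smoothness of a metric is given for fixed vectors only; the expansion turns it into
  continuity along varying vectors.\<close>

lemma bilinear_Basis_expansion:
  fixes B :: "'e::euclidean_space \<Rightarrow> 'e \<Rightarrow> real"
  assumes "bilinear B"
  shows "B v w = (\<Sum>(i, j)\<in>Basis \<times> Basis. (w \<bullet> j) * ((v \<bullet> i) * B i j))"
proof -
  have "B v w = B (\<Sum>i\<in>Basis. (v \<bullet> i) *\<^sub>R i) (\<Sum>j\<in>Basis. (w \<bullet> j) *\<^sub>R j)"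
    by (simp add: euclidean_representation)
  then show ?thesis
    by (simp add: bilinear_sum[OF assms] bilinear_lmul[OF assms] bilinear_rmul[OF assms])
qed

lemma linear_Basis_expansion:
  assumes "linear (f :: 'e::euclidean_space \<Rightarrow> 'f::real_normed_vector)"
  shows "f v = (\<Sum>i\<in>Basis. (v \<bullet> i) *\<^sub>R f i)"
proof -
  have "f v = f (\<Sum>i\<in>Basis. (v \<bullet> i) *\<^sub>R i)"
    by (simp add: euclidean_representation)
  then show ?thesis
    by (simp add: linear_sum[OF assms] linear_scale[OF assms])
qed

text \<open>The infimum before the passage to reals. Symmetry and the triangle inequality are proved
  at this level, where an infinite value does no harm; \<open>enn2real\<close> would turn it into
  0.\<close>

definition curve_dist :: "('a, 'e::euclidean_space) riemannian \<Rightarrow> 'a \<Rightarrow> 'a \<Rightarrow> ennreal" where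
  "curve_dist M p q = (INF \<gamma>\<in>{\<gamma>. piecewise_C1_curve M \<gamma> \<and> \<gamma> 0 = p \<and> \<gamma> 1 = q}. curve_length M \<gamma>)"

lemma rdist_eq_curve_dist: "rdist M p q = enn2real (curve_dist M p q)"
  by (simp add: rdist_def curve_dist_def)

section \<open>Charts, coordinate changes and the speed of curves\<close>

locale riemann =
  fixes M :: "('a, 'e::euclidean_space) riemannian"
  assumes manifold: "riemannian_manifold M"
begin

lemma chart_dom_open: "c \<in> atlas M \<Longrightarrow> openin (rtop M) (chart_dom c)"
  and coord_image_open: "c \<in> atlas M \<Longrightarrow> open (coord c ` chart_dom c)"
  and chart_homeomorphic: "c \<in> atlas M \<Longrightarrow>
    homeomorphic_map (subtopology (rtop M) (chart_dom c)) (top_of_set (coord c ` chart_dom c)) (coord c)"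
  and charts_cover: "(\<Union>c\<in>atlas M. chart_dom c) = points M"
  and transition_smooth: "\<lbrakk>c \<in> atlas M; c' \<in> atlas M\<rbrakk> \<Longrightarrow>
    Cinfinity_on (transition c c') (coord c ` (chart_dom c \<inter> chart_dom c'))"
  and tensor_smooth: "c \<in> atlas M \<Longrightarrow> Cinfinity_on (\<lambda>x. tensor M c x u v) (coord c ` chart_dom c)"
  and tensor_bilinear: "\<lbrakk>c \<in> atlas M; x \<in> coord c ` chart_dom c\<rbrakk> \<Longrightarrow> bilinear (tensor M c x)"
  and tensor_transition: "\<lbrakk>c \<in> atlas M; c' \<in> atlas M; x \<in> coord c ` (chart_dom c \<inter> chart_dom c')\<rbrakk> \<Longrightarrow>
    tensor M c x u v = tensor M c' (transition c c' x)
      (frechet_derivative (transition c c') (at x) u)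
      (frechet_derivative (transition c c') (at x) v)"
  and connected: "connected_space (rtop M)"
  using manifold unfolding riemannian_manifold_def smooth_manifold_def riemannian_metric_def
  by blast+

lemma chart_dom_subset: "c \<in> atlas M \<Longrightarrow> chart_dom c \<subseteq> points M"
  using charts_cover by blast

lemma topspace_chart: "c \<in> atlas M \<Longrightarrow> topspace (subtopology (rtop M) (chart_dom c)) = chart_dom c"
  using chart_dom_subset[of c] by (simp add: inf_absorb2)

lemma coord_inj: "c \<in> atlas M \<Longrightarrow> inj_on (coord c) (chart_dom c)"
  using homeomorphic_imp_injective_map[OF chart_homeomorphic] topspace_chart by metis

lemma transition_coord:
  "\<lbrakk>c \<in> atlas M; x \<in> chart_dom c\<rbrakk> \<Longrightarrow> transition c c' (coord c x) = coord c' x"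
  by (simp add: transition_def coord_inj)

lemma continuous_inverse_chart:
  assumes "c \<in> atlas M"
  shows "continuous_map (top_of_set (coord c ` chart_dom c)) (rtop M) (inv_into (chart_dom c) (coord c))"
proof -
  obtain g where g: "homeomorphic_maps (subtopology (rtop M) (chart_dom c))
      (top_of_set (coord c ` chart_dom c)) (coord c) g"
    using chart_homeomorphic[OF assms] homeomorphic_map_maps by blast
  have eq: "g z = inv_into (chart_dom c) (coord c) z" if "z \<in> coord c ` chart_dom c" for z
    using that g coord_inj[OF assms] topspace_chart[OF assms]
    unfolding homeomorphic_maps_def by auto
  have "continuous_map (top_of_set (coord c ` chart_dom c)) (subtopology (rtop M) (chart_dom c)) g"
    using g unfolding homeomorphic_maps_def by blast
  then have "continuous_map (top_of_set (coord c ` chart_dom c)) (rtop M) g"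
    by (simp add: continuous_map_in_subtopology)
  then show ?thesis
    by (rule continuous_map_eq) (use eq in auto)
qed

lemma has_derivative_transition:
  assumes "c \<in> atlas M" "c' \<in> atlas M" "x \<in> coord c ` (chart_dom c \<inter> chart_dom c')"
  shows "(transition c c' has_derivative frechet_derivative (transition c c') (at x)) (at x)"
  using Cinfinity_onD(1)[OF transition_smooth[OF assms(1,2)] assms(3)]
  by (simp add: frechet_derivative_works)

lemma coord_change_derivative:
  assumes "pathin (rtop M) \<gamma>" "0 < t" "t < 1" "c \<in> atlas M" "c' \<in> atlas M"
    and "\<gamma> t \<in> chart_dom c" "\<gamma> t \<in> chart_dom c'"
    and v: "((coord c \<circ> \<gamma>) has_vector_derivative v) (at t)"
  shows "((coord c' \<circ> \<gamma>) has_vector_derivative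
    frechet_derivative (transition c c') (at (coord c (\<gamma> t))) v) (at t)"
proof -
  let ?D = "frechet_derivative (transition c c') (at (coord c (\<gamma> t)))"
  have D: "(transition c c' has_derivative ?D) (at (coord c (\<gamma> t)))"
    by (rule has_derivative_transition) (use assms in auto)
  have "((transition c c' \<circ> (coord c \<circ> \<gamma>)) has_derivative ?D \<circ> (\<lambda>h. h *\<^sub>R v)) (at t)"
    by (rule diff_chain_at) (use v D in \<open>auto simp: has_vector_derivative_def\<close>)
  moreover have "?D \<circ> (\<lambda>h. h *\<^sub>R v) = (\<lambda>h. h *\<^sub>R ?D v)"
    using linear_scale[OF has_derivative_linear[OF D]] by auto
  ultimately have *: "((transition c c' \<circ> (coord c \<circ> \<gamma>)) has_vector_derivative ?D v) (at t)"
    by (simp add: has_vector_derivative_def)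
  obtain d where d: "d > 0" "\<And>s. s \<in> {0..1} \<Longrightarrow> \<bar>s - t\<bar> < d \<Longrightarrow> \<gamma> s \<in> chart_dom c"
    using pathin_near[OF assms(1) chart_dom_open[OF assms(4)], of t] assms by auto
  show ?thesis
  proof (rule has_vector_derivative_transform_within[OF *])
    show "0 < min d (min t (1 - t))" using d assms by auto
    fix s assume "dist s t < min d (min t (1 - t))"
    then have "\<bar>s - t\<bar> < d" "\<bar>s - t\<bar> < t" "\<bar>s - t\<bar> < 1 - t"
      by (auto simp: dist_real_def)
    then have "\<gamma> s \<in> chart_dom c"
      using d(2)[of s] by (auto simp: abs_less_iff)
    then show "(transition c c' \<circ> (coord c \<circ> \<gamma>)) s = (coord c' \<circ> \<gamma>) s"
      using transition_coord[OF assms(4)] by simp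
  qed auto
qed

text \<open>\<open>speed\<close> selects an arbitrary chart; since transitions preserve the tensor,
  every other chart gives the same value.\<close>

lemma speed_eq:
  assumes "pathin (rtop M) \<gamma>" "0 < t" "t < 1" "c \<in> atlas M" "\<gamma> t \<in> chart_dom c"
    and v: "((coord c \<circ> \<gamma>) has_vector_derivative v) (at t)"
  shows "speed M \<gamma> t = sqrt (tensor M c (coord c (\<gamma> t)) v v)"
proof -
  define c' where "c' = (SOME c. c \<in> atlas M \<and> \<gamma> t \<in> chart_dom c)"
  have c': "c' \<in> atlas M \<and> \<gamma> t \<in> chart_dom c'"
    unfolding c'_def by (rule someI[of _ c]) (use assms in blast)
  have "vector_derivative (coord c' \<circ> \<gamma>) (at t)
      = frechet_derivative (transition c c') (at (coord c (\<gamma> t))) v"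
    using coord_change_derivative[OF assms(1-4) _ assms(5) _ v] c' vector_derivative_at by blast
  then show ?thesis
    using tensor_transition[OF assms(4), of c' "coord c (\<gamma> t)" v v]
      transition_coord[OF assms(4,5)] c' assms(5)
    unfolding speed_def c'_def[symmetric] by (simp add: Let_def)
qed

text \<open>Bisection by \<open>Bolzano\<close>: for a property of parameter intervals that is
  stable under concatenation, it suffices to treat intervals short enough to stay in one
  chart.\<close>

lemma chart_interval_induct:
  assumes "pathin (rtop M) \<gamma>" "0 \<le> l" "l \<le> h" "h \<le> 1"
    and trans: "\<And>a b c. \<lbrakk>0 \<le> a; a \<le> b; b \<le> c; c \<le> 1; P a b; P b c\<rbrakk> \<Longrightarrow> P a c"
    and local: "\<And>a b c. \<lbrakk>c \<in> atlas M; 0 \<le> a; a \<le> b; b \<le> 1; \<gamma> ` {a..b} \<subseteq> chart_dom c\<rbrakk> \<Longrightarrow> P a b"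
  shows "P l (h::real)"
proof -
  have "0 \<le> l \<and> h \<le> 1 \<longrightarrow> P l h"
  proof (rule Bolzano[where P = "\<lambda>a b. 0 \<le> a \<and> b \<le> 1 \<longrightarrow> P a b"])
    fix x :: real assume "l \<le> x" "x \<le> h"
    then have x: "0 \<le> x" "x \<le> 1" using assms(2,4) by auto
    then have "\<gamma> x \<in> points M"
      using assms(1) by (auto simp: pathin_def continuous_map_def)
    then obtain c where c: "c \<in> atlas M" "\<gamma> x \<in> chart_dom c"
      using charts_cover by blast
    obtain d where d: "d > 0" "\<And>s. s \<in> {0..1} \<Longrightarrow> \<bar>s - x\<bar> < d \<Longrightarrow> \<gamma> s \<in> chart_dom c"
      using pathin_near[OF assms(1) chart_dom_open[OF c(1)], of x] x c by auto
    show "\<exists>d>0. \<forall>a b. a \<le> x \<and> x \<le> b \<and> b - a < d \<longrightarrow> 0 \<le> a \<and> b \<le> 1 \<longrightarrow> P a b"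
      using d by (intro exI[of _ d]) (auto intro!: local[OF c(1)])
  next
    show "l \<le> h" by (rule assms(3))
  next
    fix a b c assume "0 \<le> a \<and> b \<le> 1 \<longrightarrow> P a b" "0 \<le> b \<and> c \<le> 1 \<longrightarrow> P b c" "a \<le> b" "b \<le> c"
    then show "0 \<le> a \<and> c \<le> 1 \<longrightarrow> P a c" using trans[of a b c] by auto
  qed
  then show ?thesis using assms(2,4) by simp
qed

text \<open>\<open>piecewise_C1_curve\<close> provides an exceptional set only for each interval
  that stays in one chart. Cutting into finitely many such intervals gives one finite set, and the
  change of coordinates makes it valid for all charts simultaneously.\<close>

lemma curve_differentiable_off_finite:
  assumes "piecewise_C1_curve M \<gamma>"
  obtains S where "finite S" "0 \<in> S" "1 \<in> S"
    "\<And>t c. \<lbrakk>t \<in> {0..1} - S; c \<in> atlas M; \<gamma> t \<in> chart_dom c\<rbrakk> \<Longrightarrow>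
       ((coord c \<circ> \<gamma>) has_vector_derivative vector_derivative (coord c \<circ> \<gamma>) (at t)) (at t)"
proof -
  have p: "pathin (rtop M) \<gamma>" using assms by (simp add: piecewise_C1_curve_def)
  have "\<exists>S. finite S \<and> (\<forall>t\<in>{0..1} - S. 0 < t \<and> t < 1 \<longrightarrow> (\<forall>c\<in>atlas M. \<gamma> t \<in> chart_dom c \<longrightarrow>
      ((coord c \<circ> \<gamma>) has_vector_derivative vector_derivative (coord c \<circ> \<gamma>) (at t)) (at t)))"
  proof (rule chart_interval_induct[OF p order_refl zero_le_one order_refl, where P = "\<lambda>a b. \<exists>S. finite S \<and>
      (\<forall>t\<in>{a..b} - S. 0 < t \<and> t < 1 \<longrightarrow> (\<forall>c\<in>atlas M. \<gamma> t \<in> chart_dom c \<longrightarrow>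
      ((coord c \<circ> \<gamma>) has_vector_derivative vector_derivative (coord c \<circ> \<gamma>) (at t)) (at t)))"], goal_cases)
    case (1 a b c)
    then obtain S T where ST: "finite S" "finite T"
      "\<forall>t\<in>{a..b} - S. 0 < t \<and> t < 1 \<longrightarrow> (\<forall>c\<in>atlas M. \<gamma> t \<in> chart_dom c \<longrightarrow>
      ((coord c \<circ> \<gamma>) has_vector_derivative vector_derivative (coord c \<circ> \<gamma>) (at t)) (at t))"
      "\<forall>t\<in>{b..c} - T. 0 < t \<and> t < 1 \<longrightarrow> (\<forall>c\<in>atlas M. \<gamma> t \<in> chart_dom c \<longrightarrow>
      ((coord c \<circ> \<gamma>) has_vector_derivative vector_derivative (coord c \<circ> \<gamma>) (at t)) (at t))"
      by blast
    show ?case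
    proof (intro exI[of _ "S \<union> T"] conjI ballI)
      fix t assume "t \<in> {a..c} - (S \<union> T)"
      then have "t \<in> {a..b} - S \<or> t \<in> {b..c} - T" by auto
      then show "0 < t \<and> t < 1 \<longrightarrow> (\<forall>c\<in>atlas M. \<gamma> t \<in> chart_dom c \<longrightarrow>
          ((coord c \<circ> \<gamma>) has_vector_derivative vector_derivative (coord c \<circ> \<gamma>) (at t)) (at t))"
        using ST(3,4) by blast
    qed (use ST(1,2) in simp)
  next
    case (2 a b c)
    show ?case
    proof (cases "a < b")
      case True
      then have "(coord c \<circ> \<gamma>) piecewise_C1_differentiable_on {a..b}"
        using assms 2 by (auto simp: piecewise_C1_curve_def)
      then obtain S where S: "finite S" "\<And>t. t \<in> {a..b} - S \<Longrightarrow> (coord c \<circ> \<gamma>) differentiable at t"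
        unfolding piecewise_C1_differentiable_on_def C1_differentiable_on_eq by blast
      show ?thesis
      proof (intro exI[of _ S] conjI ballI impI)
        fix t c' assume t: "t \<in> {a..b} - S" "0 < t \<and> t < 1" "c' \<in> atlas M" "\<gamma> t \<in> chart_dom c'"
        obtain v where v: "((coord c \<circ> \<gamma>) has_vector_derivative v) (at t)"
          using S(2)[OF t(1)] vector_derivative_works by blast
        have "\<gamma> t \<in> chart_dom c" using 2 t by blast
        from coord_change_derivative[OF p _ _ 2(1) t(3) this t(4) v] t
        show "((coord c' \<circ> \<gamma>) has_vector_derivative vector_derivative (coord c' \<circ> \<gamma>) (at t)) (at t)"
          using vector_derivative_works differentiableI_vector by blast
      qed (rule S)
    next
      case False
      then show ?thesis by (intro exI[of _ "{a}"]) auto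
    qed
  qed
  then obtain S where S: "finite S" "(\<forall>t\<in>{0..1} - S. 0 < t \<and> t < 1 \<longrightarrow> (\<forall>c\<in>atlas M. \<gamma> t \<in> chart_dom c \<longrightarrow>
      ((coord c \<circ> \<gamma>) has_vector_derivative vector_derivative (coord c \<circ> \<gamma>) (at t)) (at t)))"
    by blast
  show ?thesis
  \<comment> \<open>The change of coordinates works with a two-sided neighbourhood of
    \<open>t\<close> in the unit interval, so both ends are declared exceptional.\<close>
  proof (rule that[of "insert 0 (insert 1 S)"])
    fix t c assume t: "t \<in> {0..1} - insert 0 (insert 1 S)" "c \<in> atlas M" "\<gamma> t \<in> chart_dom c"
    then have "0 < t \<and> t < 1" "t \<in> {0..1} - S" by auto
    then show "((coord c \<circ> \<gamma>) has_vector_derivative vector_derivative (coord c \<circ> \<gamma>) (at t)) (at t)"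
      using S(2) t(2,3) by blast
  qed (use S in auto)
qed

lemma continuous_on_tensor_along:
  assumes "c \<in> atlas M" "continuous_on T \<zeta>" "continuous_on T v" "\<zeta> ` T \<subseteq> coord c ` chart_dom c"
  shows "continuous_on T (\<lambda>t. tensor M c (\<zeta> t) (v t) (v t))"
proof -
  have "continuous_on T (\<lambda>t. tensor M c (\<zeta> t) i j)" for i j
    by (rule continuous_on_compose2[OF Cinfinity_onD(3)[OF tensor_smooth[OF assms(1)]] assms(2,4)])
  then have "continuous_on T (\<lambda>t. \<Sum>(i, j)\<in>Basis \<times> Basis. (v t \<bullet> j) * ((v t \<bullet> i) * tensor M c (\<zeta> t) i j))"
    unfolding split_beta by (intro continuous_intros assms) auto
  then show ?thesis
  proof (rule continuous_on_eq)
    fix t assume "t \<in> T"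
    then have "bilinear (tensor M c (\<zeta> t))"
      using tensor_bilinear[OF assms(1)] assms(4) by blast
    then show "(\<Sum>(i, j)\<in>Basis \<times> Basis. (v t \<bullet> j) * ((v t \<bullet> i) * tensor M c (\<zeta> t) i j)) =
        tensor M c (\<zeta> t) (v t) (v t)"
      by (rule bilinear_Basis_expansion[symmetric])
  qed
qed

text \<open>On an interval within one chart the speed agrees off a finite set with a continuous
  function, and the pieces are pasted. Additivity and affine substitution for the length integral
  rest on this.\<close>

lemma speed_measurable:
  assumes "piecewise_C1_curve M \<gamma>"
  shows "(\<lambda>t. ennreal (speed M \<gamma> t) * indicator {0..1} t) \<in> borel_measurable borel"
proof -
  have p: "pathin (rtop M) \<gamma>" using assms by (simp add: piecewise_C1_curve_def)
  show ?thesis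
  proof (rule chart_interval_induct[OF p order_refl zero_le_one order_refl, where P = "\<lambda>a b.
      (\<lambda>t. ennreal (speed M \<gamma> t) * indicator {a..b} t) \<in> borel_measurable borel"], goal_cases)
    case (1 a b c)
    have "(\<lambda>t. ennreal (speed M \<gamma> t) * indicator {a..c} t) =
      (\<lambda>t. if t \<le> b then ennreal (speed M \<gamma> t) * indicator {a..b} t
        else ennreal (speed M \<gamma> t) * indicator {b..c} t)"
      using 1 by (auto simp: indicator_def)
    then show ?case using 1(5,6) by simp
  next
    case (2 a b c)
    show ?case
    proof (cases "a < b")
      case True
      then have "(coord c \<circ> \<gamma>) piecewise_C1_differentiable_on {a..b}"
        using assms 2 by (auto simp: piecewise_C1_curve_def)
      then obtain S where S: "finite S" "continuous_on {a..b} (coord c \<circ> \<gamma>)"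
        "\<And>t. t \<in> {a..b} - S \<Longrightarrow> (coord c \<circ> \<gamma>) differentiable at t"
        "continuous_on ({a..b} - S) (\<lambda>t. vector_derivative (coord c \<circ> \<gamma>) (at t))"
        unfolding piecewise_C1_differentiable_on_def C1_differentiable_on_eq by blast
      define T where "T = {a<..<b} - S"
      \<comment> \<open>The speed read in the fixed chart \<open>c\<close>, in place of the chart
        that \<open>speed\<close> chooses at each parameter.\<close>
      define f where "f t = sqrt (tensor M c ((coord c \<circ> \<gamma>) t)
        (vector_derivative (coord c \<circ> \<gamma>) (at t)) (vector_derivative (coord c \<circ> \<gamma>) (at t)))" for t
      have sp: "speed M \<gamma> t = f t" if "t \<in> T" for t
      proof -
        have v: "((coord c \<circ> \<gamma>) has_vector_derivative vector_derivative (coord c \<circ> \<gamma>) (at t)) (at t)"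
          using S(3)[of t] that vector_derivative_works by (auto simp: T_def)
        have t: "0 < t" "t < 1" "\<gamma> t \<in> chart_dom c"
          using that 2 by (auto simp: T_def)
        show ?thesis
          using speed_eq[OF p t(1,2) 2(1) t(3) v] by (simp add: f_def)
      qed
      have "continuous_on T f"
        unfolding f_def
        by (intro continuous_on_real_sqrt continuous_on_tensor_along[OF 2(1)]
            continuous_on_subset[OF S(2)] continuous_on_subset[OF S(4)])
          (use 2 in \<open>auto simp: T_def image_subset_iff\<close>)
      then have "(\<lambda>t. indicator T t *\<^sub>R f t) \<in> borel_measurable borel"
        by (rule borel_measurable_continuous_on_indicator[rotated])
          (simp add: T_def sets.Diff borel_closed finite_imp_closed[OF S(1)])
      then have "(\<lambda>t. ennreal (indicator T t *\<^sub>R f t)) \<in> borel_measurable borel"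
        by simp
      then show ?thesis
        by (rule measurable_discrete_difference[where X = "insert a (insert b S)"])
          (use S(1) sp in \<open>auto simp: countable_finite T_def indicator_def\<close>)
    next
      case False
      have "(\<lambda>t. 0 :: ennreal) \<in> borel_measurable borel" by simp
      then show ?thesis
        by (rule measurable_discrete_difference[where X = "{a}"])
          (use False in \<open>auto simp: indicator_def\<close>)
    qed
  qed
qed

section \<open>Reversing and joining curves\<close>

lemma curve_length_reverse:
  assumes "piecewise_C1_curve M \<gamma>"
  shows "piecewise_C1_curve M (\<lambda>t. \<gamma> (1 - t))" "curve_length M (\<lambda>t. \<gamma> (1 - t)) = curve_length M \<gamma>"
proof -
  have p: "pathin (rtop M) \<gamma>" using assms by (simp add: piecewise_C1_curve_def)
  have cm: "continuous_map (top_of_set {0..1::real}) (top_of_set {0..1}) (\<lambda>t. 1 - t)"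
    by (auto intro!: continuous_intros)
  have p': "pathin (rtop M) (\<lambda>t. \<gamma> (1 - t))"
    using continuous_map_compose[OF cm p[unfolded pathin_def]] by (simp add: pathin_def o_def)
  show "piecewise_C1_curve M (\<lambda>t. \<gamma> (1 - t))"
    unfolding piecewise_C1_curve_def
  proof (intro conjI ballI allI impI p')
    fix c a b assume *: "c \<in> atlas M" "0 \<le> a \<and> a < b \<and> b \<le> 1 \<and> (\<lambda>t. \<gamma> (1 - t)) ` {a..b} \<subseteq> chart_dom c"
    have im: "(\<lambda>x. -1 * x + 1) ` {a..b} = {1 - b..1 - (a::real)}"
      by (auto simp: image_iff intro!: bexI[of _ "1 - _"])
    have "\<gamma> ` {1 - b..1 - a} \<subseteq> chart_dom c"
    proof
      fix x assume "x \<in> \<gamma> ` {1 - b..1 - a}"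
      then obtain s where "s \<in> {1 - b..1 - a}" "x = \<gamma> s" by blast
      then have "x = \<gamma> (1 - (1 - s))" "1 - s \<in> {a..b}" by auto
      then show "x \<in> chart_dom c" using * by blast
    qed
    then have "(coord c \<circ> \<gamma>) piecewise_C1_differentiable_on (\<lambda>x. -1 * x + 1) ` {a..b}"
      unfolding im using assms * by (auto simp: piecewise_C1_curve_def)
    from piecewise_C1_differentiable_affine[OF this]
    show "(coord c \<circ> (\<lambda>t. \<gamma> (1 - t))) piecewise_C1_differentiable_on {a..b}"
      by (simp add: o_def)
  qed
  obtain S where S: "finite S" "0 \<in> S" "1 \<in> S"
    "\<And>t c. \<lbrakk>t \<in> {0..1} - S; c \<in> atlas M; \<gamma> t \<in> chart_dom c\<rbrakk> \<Longrightarrow>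
       ((coord c \<circ> \<gamma>) has_vector_derivative vector_derivative (coord c \<circ> \<gamma>) (at t)) (at t)"
    by (rule curve_differentiable_off_finite[OF assms]) blast
  have sp: "speed M (\<lambda>t. \<gamma> (1 - t)) t = speed M \<gamma> (1 - t)" if t: "t \<in> {0..1}" "1 - t \<notin> S" for t
  proof -
    have t01: "0 < t" "t < 1" using t S(2,3) by (cases "t = 0"; cases "t = 1"; force)+
    have "\<gamma> (1 - t) \<in> points M"
      using p t by (auto simp: pathin_def continuous_map_def)
    then obtain c where c: "c \<in> atlas M" "\<gamma> (1 - t) \<in> chart_dom c"
      using charts_cover by blast
    define v where "v = vector_derivative (coord c \<circ> \<gamma>) (at (1 - t))"
    have v: "((coord c \<circ> \<gamma>) has_vector_derivative v) (at (1 - t))"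
      unfolding v_def using S(4)[OF _ c] t by auto
    have "((coord c \<circ> \<gamma>) \<circ> (\<lambda>t. 1 - t) has_vector_derivative (-1) *\<^sub>R v) (at t)"
      by (rule vector_diff_chain_at) (use v in \<open>auto intro!: derivative_eq_intros\<close>)
    then have v': "((coord c \<circ> (\<lambda>t. \<gamma> (1 - t))) has_vector_derivative (- v)) (at t)"
      by (simp add: o_def)
    have "tensor M c (coord c (\<gamma> (1 - t))) (- v) (- v) = tensor M c (coord c (\<gamma> (1 - t))) v v"
      using tensor_bilinear[OF c(1)] c(2) by (simp add: bilinear_lneg bilinear_rneg)
    then show ?thesis
      using speed_eq[OF p' t01 c v'] speed_eq[OF p _ _ c v] t01 by simp
  qed
  have "AE t in lborel. t \<notin> (\<lambda>s. 1 - s) ` S"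
    by (rule AE_not_in) (use S(1) in \<open>auto intro: finite_imp_null_set_lborel\<close>)
  then have "AE t in lborel. ennreal (speed M (\<lambda>t. \<gamma> (1 - t)) t) * indicator {0..1} t =
      ennreal (speed M \<gamma> (1 - t)) * indicator {0..1} (1 - t)"
  proof eventually_elim
    case (elim t)
    have "1 - t \<notin> S"
    proof
      assume "1 - t \<in> S"
      then have "1 - (1 - t) \<in> (\<lambda>s. 1 - s) ` S" by blast
      then show False using elim by simp
    qed
    then show ?case using sp by (auto simp: indicator_def)
  qed
  then have "curve_length M (\<lambda>t. \<gamma> (1 - t)) =
      (\<integral>\<^sup>+t. ennreal (speed M \<gamma> (1 - t)) * indicator {0..1} (1 - t) \<partial>lborel)"
    unfolding curve_length_def by (rule nn_integral_cong_AE)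
  also have "\<dots> = curve_length M \<gamma>"
    unfolding curve_length_def
    using nn_integral_real_affine[OF speed_measurable[OF assms], of "-1" 1] by simp
  finally show "curve_length M (\<lambda>t. \<gamma> (1 - t)) = curve_length M \<gamma>" .
qed

end

text \<open>Agreement on a closed interval does not control two-sided derivatives at its ends, so
  \<open>a\<close> and \<open>b\<close> join the exceptional set.\<close>

lemma piecewise_C1_differentiable_cong:
  fixes f g :: "real \<Rightarrow> 'b::real_normed_vector"
  assumes "f piecewise_C1_differentiable_on {a..b}" "\<And>x. x \<in> {a..b} \<Longrightarrow> f x = g x"
  shows "g piecewise_C1_differentiable_on {a..b}"
proof -
  obtain S D where S: "continuous_on {a..b} f" "finite S"
    "\<And>x. x \<in> {a..b} - S \<Longrightarrow> (f has_vector_derivative D x) (at x)" "continuous_on ({a..b} - S) D"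
    using assms(1) unfolding piecewise_C1_differentiable_on_def C1_differentiable_on_def by blast
  have "(g has_vector_derivative D x) (at x)" if "x \<in> {a..b} - (S \<union> {a, b})" for x
    by (rule has_vector_derivative_transform_within_open[OF S(3), where S = "{a<..<b}"])
      (use that assms(2) in auto)
  moreover have "continuous_on ({a..b} - (S \<union> {a, b})) D"
    by (rule continuous_on_subset[OF S(4)]) auto
  moreover have "continuous_on {a..b} g"
    using S(1) assms(2) by (rule continuous_on_eq)
  ultimately show ?thesis
    unfolding piecewise_C1_differentiable_on_def C1_differentiable_on_def
    using S(2) by (intro conjI exI[of _ "S \<union> {a, b}"] exI[of _ D]) simp_all
qed

context riemann
begin

lemma tensor_scale:
  assumes "c \<in> atlas M" "x \<in> coord c ` chart_dom c"
  shows "tensor M c x (k *\<^sub>R v) (k *\<^sub>R v) = k\<^sup>2 * tensor M c x v v"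
  using tensor_bilinear[OF assms] by (simp add: bilinear_lmul bilinear_rmul power2_eq_square)

text \<open>Agreement with the reparametrised curve is demanded near \<open>t\<close> only, because
  a joined curve follows each of its halves just on one side of 1/2.\<close>

lemma speed_reparametrise:
  assumes "pathin (rtop M) \<delta>" "pathin (rtop M) \<gamma>" "0 < t" "t < 1" "0 < m * t + k" "m * t + k < 1"
    and "0 \<le> m" "d > 0" "\<And>s. \<bar>s - t\<bar> < d \<Longrightarrow> \<delta> s = \<gamma> (m * s + k)"
    and diff: "\<And>c. \<lbrakk>c \<in> atlas M; \<gamma> (m * t + k) \<in> chart_dom c\<rbrakk> \<Longrightarrow>
      ((coord c \<circ> \<gamma>) has_vector_derivative vector_derivative (coord c \<circ> \<gamma>) (at (m * t + k))) (at (m * t + k))"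
  shows "speed M \<delta> t = m * speed M \<gamma> (m * t + k)"
proof -
  have "\<gamma> (m * t + k) \<in> points M"
    using assms(2,5,6) by (auto simp: pathin_def continuous_map_def)
  then obtain c where c: "c \<in> atlas M" "\<gamma> (m * t + k) \<in> chart_dom c"
    using charts_cover by blast
  define v where "v = vector_derivative (coord c \<circ> \<gamma>) (at (m * t + k))"
  have v: "((coord c \<circ> \<gamma>) has_vector_derivative v) (at (m * t + k))"
    unfolding v_def using diff[OF c] .
  have "((coord c \<circ> \<gamma>) \<circ> (\<lambda>t. m * t + k) has_vector_derivative m *\<^sub>R v) (at t)"
    by (rule vector_diff_chain_at) (use v in \<open>auto intro!: derivative_eq_intros\<close>)
  then have v': "((coord c \<circ> \<delta>) has_vector_derivative m *\<^sub>R v) (at t)"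
    by (rule has_vector_derivative_transform_within[where d = d])
      (use assms(8,9) in \<open>auto simp: dist_real_def\<close>)
  have \<delta>: "\<delta> t = \<gamma> (m * t + k)" using assms(8) assms(9)[of t] by simp
  have "tensor M c (coord c (\<gamma> (m * t + k))) (m *\<^sub>R v) (m *\<^sub>R v)
      = m\<^sup>2 * tensor M c (coord c (\<gamma> (m * t + k))) v v"
    by (rule tensor_scale) (use c in auto)
  then show ?thesis
    using speed_eq[OF assms(1,3,4) c(1) _ v'] speed_eq[OF assms(2,5,6) c v] c assms(7)
    by (simp add: \<delta> real_sqrt_mult)
qed

lemma curve_length_join:
  assumes g: "piecewise_C1_curve M g" and h: "piecewise_C1_curve M h" and gh: "g 1 = h 0"
  defines "\<delta> \<equiv> \<lambda>t. if t \<le> 1/2 then g (2 * t) else h (2 * t - 1)"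
  shows "piecewise_C1_curve M \<delta>" "curve_length M \<delta> = curve_length M g + curve_length M h"
proof -
  have pg: "pathin (rtop M) g" and ph: "pathin (rtop M) h"
    using g h by (auto simp: piecewise_C1_curve_def)
  have cg: "continuous_map (top_of_set {0..1/2::real}) (rtop M) (\<lambda>t. g (2 * t))"
    using continuous_map_compose[of "top_of_set {0..1/2::real}" "top_of_set {0..1::real}" "\<lambda>t. 2 * t" "rtop M" g]
      pg by (auto simp: pathin_def o_def intro!: continuous_intros)
  have "continuous_on {1/2..1::real} (\<lambda>t. 2 * t - 1)"
    by (intro continuous_intros)
  then have ch: "continuous_map (top_of_set {1/2..1::real}) (rtop M) (\<lambda>t. h (2 * t - 1))"
    using continuous_map_compose[of "top_of_set {1/2..1::real}" "top_of_set {0..1::real}" "\<lambda>t. 2 * t - 1" "rtop M" h]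
      ph by (auto simp: pathin_def o_def)
  have p: "pathin (rtop M) \<delta>"
    unfolding pathin_def \<delta>_def
  proof (rule continuous_map_cases_le)
    have "{x \<in> topspace (top_of_set {0..1::real}). x \<le> 1/2} = {0..1/2}" by auto
    then show "continuous_map (subtopology (top_of_set {0..1}) {x \<in> topspace (top_of_set {0..1::real}). x \<le> 1/2}) (rtop M) (\<lambda>x. g (2 * x))"
      using cg by (simp add: subtopology_subtopology Int_absorb1)
    have "{x \<in> topspace (top_of_set {0..1::real}). 1/2 \<le> x} = {1/2..1}" by auto
    then show "continuous_map (subtopology (top_of_set {0..1}) {x \<in> topspace (top_of_set {0..1::real}). 1/2 \<le> x}) (rtop M) (\<lambda>x. h (2 * x - 1))"
      using ch by (simp add: subtopology_subtopology Int_absorb1)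
    show "g (2 * t) = h (2 * t - 1)" if "t = 1/2" for t
      unfolding that using gh by simp
  qed auto
  have left: "(coord c \<circ> \<delta>) piecewise_C1_differentiable_on {a..b}"
    if "c \<in> atlas M" "0 \<le> a" "a < b" "b \<le> 1/2" "\<delta> ` {a..b} \<subseteq> chart_dom c" for a b c
  proof -
    have im: "(\<lambda>x. 2 * x + 0) ` {a..b} = {2 * a..2 * b}"
      by (auto simp: image_iff intro!: bexI[of _ "_ / 2"])
    have "g ` {2 * a..2 * b} \<subseteq> chart_dom c"
    proof
      fix x assume "x \<in> g ` {2 * a..2 * b}"
      then obtain s where "s \<in> {2 * a..2 * b}" "x = g s" by blast
      then have "x = \<delta> (s / 2)" "s / 2 \<in> {a..b}" using that by (auto simp: \<delta>_def)
      then show "x \<in> chart_dom c" using that by blast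
    qed
    then have "(coord c \<circ> g) piecewise_C1_differentiable_on (\<lambda>x. 2 * x + 0) ` {a..b}"
      unfolding im using g that by (auto simp: piecewise_C1_curve_def)
    from piecewise_C1_differentiable_affine[OF this]
    have "(\<lambda>x. coord c (g (2 * x))) piecewise_C1_differentiable_on {a..b}"
      by (simp add: o_def)
    then show ?thesis
      by (rule piecewise_C1_differentiable_cong) (use that in \<open>auto simp: \<delta>_def\<close>)
  qed
  have right: "(coord c \<circ> \<delta>) piecewise_C1_differentiable_on {a..b}"
    if "c \<in> atlas M" "1/2 \<le> a" "a < b" "b \<le> 1" "\<delta> ` {a..b} \<subseteq> chart_dom c" for a b c
  proof -
    \<comment> \<open>The definition takes the branch \<open>g\<close> at 1/2; the gluing condition
      makes the formula for \<open>h\<close> valid there as well.\<close>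
    have \<delta>r: "\<delta> t = h (2 * t - 1)" if "1/2 \<le> t" for t
    proof (cases "t = 1/2")
      case True
      show ?thesis unfolding True \<delta>_def using gh by simp
    qed (use that in \<open>auto simp: \<delta>_def\<close>)
    have im: "(\<lambda>x. 2 * x + (-1)) ` {a..b} = {2 * a - 1..2 * b - 1}"
      using that unfolding image_affinity_atLeastAtMost by simp
    have "h ` {2 * a - 1..2 * b - 1} \<subseteq> chart_dom c"
    proof
      fix x assume "x \<in> h ` {2 * a - 1..2 * b - 1}"
      then obtain s where s: "s \<in> {2 * a - 1..2 * b - 1}" "x = h s" by blast
      define u where "u = (s + 1) / 2"
      have "s = 2 * u - 1" by (simp add: u_def field_simps)
      then have "x = \<delta> u" "u \<in> {a..b}" using s that \<delta>r[of u] by auto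
      then show "x \<in> chart_dom c" using that by blast
    qed
    then have "(coord c \<circ> h) piecewise_C1_differentiable_on (\<lambda>x. 2 * x + (-1)) ` {a..b}"
      unfolding im using h that by (auto simp: piecewise_C1_curve_def)
    from piecewise_C1_differentiable_affine[OF this]
    have "(\<lambda>x. coord c (h (2 * x - 1))) piecewise_C1_differentiable_on {a..b}"
      by (simp add: o_def)
    then show ?thesis
      by (rule piecewise_C1_differentiable_cong) (use that \<delta>r in auto)
  qed
  show "piecewise_C1_curve M \<delta>"
    unfolding piecewise_C1_curve_def
  proof (intro conjI ballI allI impI p)
    fix c a b assume *: "c \<in> atlas M" "0 \<le> a \<and> a < b \<and> b \<le> 1 \<and> \<delta> ` {a..b} \<subseteq> chart_dom c"
    consider "b \<le> 1/2" | "1/2 \<le> a" | "a < 1/2" "1/2 < b" by linarith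
    then show "(coord c \<circ> \<delta>) piecewise_C1_differentiable_on {a..b}"
    proof cases
      case 3
      have "(coord c \<circ> \<delta>) piecewise_C1_differentiable_on {a..1/2}"
        by (rule left) (use * 3 in auto)
      moreover have "(coord c \<circ> \<delta>) piecewise_C1_differentiable_on {1/2..b}"
        by (rule right) (use * 3 in auto)
      ultimately have "(\<lambda>x. if x \<le> 1/2 then (coord c \<circ> \<delta>) x else (coord c \<circ> \<delta>) x)
          piecewise_C1_differentiable_on {a..b}"
        by (rule piecewise_C1_differentiable_cases) (use 3 in auto)
      then show ?thesis by (simp add: o_def)
    qed (use * left right in auto)
  qed
  obtain S where S: "finite S" "0 \<in> S" "1 \<in> S"
    "\<And>t c. \<lbrakk>t \<in> {0..1} - S; c \<in> atlas M; g t \<in> chart_dom c\<rbrakk> \<Longrightarrow>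
       ((coord c \<circ> g) has_vector_derivative vector_derivative (coord c \<circ> g) (at t)) (at t)"
    by (rule curve_differentiable_off_finite[OF g]) blast
  obtain T where T: "finite T" "0 \<in> T" "1 \<in> T"
    "\<And>t c. \<lbrakk>t \<in> {0..1} - T; c \<in> atlas M; h t \<in> chart_dom c\<rbrakk> \<Longrightarrow>
       ((coord c \<circ> h) has_vector_derivative vector_derivative (coord c \<circ> h) (at t)) (at t)"
    by (rule curve_differentiable_off_finite[OF h]) blast
  define sg where "sg t = ennreal (speed M g t) * indicator {0..1} t" for t
  define sh where "sh t = ennreal (speed M h t) * indicator {0..1} t" for t
  have [measurable]: "sg \<in> borel_measurable borel" "sh \<in> borel_measurable borel"
    unfolding sg_def sh_def using speed_measurable[OF g] speed_measurable[OF h] .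
  \<comment> \<open>Each half runs at twice its speed; the factor 2 is absorbed by the substitutions
    \<open>2 * t\<close> and \<open>2 * t - 1\<close>. As 0 and 1 lie in \<open>S\<close> and
    \<open>T\<close>, the parameters 0, 1/2 and 1 are excluded.\<close>
  have "ennreal (speed M \<delta> t) * indicator {0..1} t = 2 * sg (0 + 2 * t) + 2 * sh (-1 + 2 * t)"
    if t: "2 * t \<notin> S" "2 * t - 1 \<notin> T" for t
  proof -
    have ne: "2 * t \<noteq> 0" "2 * t \<noteq> 1" "2 * t - 1 \<noteq> 1" "2 * t - 1 \<noteq> 0" using S(2,3) T(2,3) t by metis+
    consider "t < 0 \<or> t > 1" | "0 < t" "t < 1/2" | "1/2 < t" "t < 1"
      using ne by force
    then show ?thesis
    proof cases
      case 2
      have "speed M \<delta> t = 2 * speed M g (2 * t + 0)"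
        by (rule speed_reparametrise[OF p pg, where d = "1/2 - t"])
          (use 2 t S(4) in \<open>auto simp: \<delta>_def abs_less_iff\<close>)
      then show ?thesis
        using 2 by (simp add: sg_def sh_def ennreal_mult')
    next
      case 3
      have "speed M \<delta> t = 2 * speed M h (2 * t + (-1))"
        by (rule speed_reparametrise[OF p ph, where d = "t - 1/2"])
          (use 3 t T(4) in \<open>auto simp: \<delta>_def abs_less_iff\<close>)
      then show ?thesis
        using 3 by (simp add: sg_def sh_def ennreal_mult')
    qed (auto simp: sg_def sh_def)
  qed
  moreover have "AE t in lborel. 2 * t \<notin> S \<and> 2 * t - 1 \<notin> T"
  proof -
    have "AE t in lborel. t \<notin> (\<lambda>s. s / 2) ` S \<union> (\<lambda>s. (s + 1) / 2) ` T"
      by (rule AE_not_in) (use S(1) T(1) in \<open>auto intro!: finite_imp_null_set_lborel\<close>)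
    then show ?thesis
    proof eventually_elim
      case (elim t)
      have "t = (2 * t) / 2" "t = ((2 * t - 1) + 1) / 2" by simp_all
      then show ?case using elim by (metis UnCI image_eqI)
    qed
  qed
  ultimately have "AE t in lborel. ennreal (speed M \<delta> t) * indicator {0..1} t =
      2 * sg (0 + 2 * t) + 2 * sh (-1 + 2 * t)"
    by auto
  then have "curve_length M \<delta> = (\<integral>\<^sup>+t. 2 * sg (0 + 2 * t) + 2 * sh (-1 + 2 * t) \<partial>lborel)"
    unfolding curve_length_def by (rule nn_integral_cong_AE)
  also have "\<dots> = 2 * (\<integral>\<^sup>+t. sg (0 + 2 * t) \<partial>lborel) + 2 * (\<integral>\<^sup>+t. sh (-1 + 2 * t) \<partial>lborel)"
    by (simp add: nn_integral_add nn_integral_cmult)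
  also have "\<dots> = (\<integral>\<^sup>+t. sg t \<partial>lborel) + (\<integral>\<^sup>+t. sh t \<partial>lborel)"
    using nn_integral_real_affine[of sg 2 0] nn_integral_real_affine[of sh 2 "-1"] by simp
  finally show "curve_length M \<delta> = curve_length M g + curve_length M h"
    by (simp add: curve_length_def sg_def sh_def)
qed

text \<open>Upper bounds for distances come from explicit coordinate curves. A curve pulled back by
  one chart must be shown piecewise C1 in every chart it passes through, which takes continuity of
  the derivatives of the transition maps.\<close>

lemma chart_curve:
  assumes c: "c \<in> atlas M" and \<zeta>: "\<And>t. (\<zeta> has_vector_derivative \<zeta>' t) (at t)" "continuous_on UNIV \<zeta>'"
    and im: "\<zeta> ` {0..1} \<subseteq> coord c ` chart_dom c"
    and K: "0 \<le> K" "\<And>t. 0 \<le> t \<Longrightarrow> t \<le> 1 \<Longrightarrow> tensor M c (\<zeta> t) (\<zeta>' t) (\<zeta>' t) \<le> K\<^sup>2"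
    and xy: "x \<in> chart_dom c" "coord c x = \<zeta> 0" "y \<in> chart_dom c" "coord c y = \<zeta> 1"
  shows "curve_dist M x y \<le> ennreal K"
proof -
  define \<gamma> where "\<gamma> t = inv_into (chart_dom c) (coord c) (\<zeta> t)" for t
  have \<zeta>c: "continuous_on T \<zeta>" for T
    by (meson \<zeta>(1) continuous_at_imp_continuous_on has_vector_derivative_continuous)
  have \<gamma>: "\<gamma> t \<in> chart_dom c" "coord c (\<gamma> t) = \<zeta> t" if "t \<in> {0..1}" for t
    using im that by (auto simp: \<gamma>_def inv_into_into f_inv_into_f image_subset_iff)
  have p: "pathin (rtop M) \<gamma>"
    using continuous_map_compose[OF _ continuous_inverse_chart[OF c], of "top_of_set {0..1}" \<zeta>] im \<zeta>c
    by (auto simp: pathin_def \<gamma>_def[abs_def] o_def image_subset_iff_funcset)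
  have "piecewise_C1_curve M \<gamma>"
    unfolding piecewise_C1_curve_def
  proof (intro conjI ballI allI impI p)
    fix c' a b assume *: "c' \<in> atlas M" "0 \<le> a \<and> a < b \<and> b \<le> 1 \<and> \<gamma> ` {a..b} \<subseteq> chart_dom c'"
    let ?D = "\<lambda>t. frechet_derivative (transition c c') (at (\<zeta> t))"
    have \<zeta>im: "\<zeta> t \<in> coord c ` (chart_dom c \<inter> chart_dom c')" if "t \<in> {a..b}" for t
    proof -
      have "\<gamma> t \<in> chart_dom c'" using that *(2) by blast
      then show ?thesis using \<gamma>[of t] that *(2) by (metis IntI atLeastAtMost_iff image_eqI order_trans)
    qed
    have D: "(transition c c' has_derivative ?D t) (at (\<zeta> t))" if "t \<in> {a..b}" for t
      by (rule has_derivative_transition[OF c *(1) \<zeta>im[OF that]])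
    have 1: "((transition c c' \<circ> \<zeta>) has_vector_derivative ?D t (\<zeta>' t)) (at t)" if "t \<in> {a..b}" for t
    proof -
      have "((transition c c' \<circ> \<zeta>) has_derivative ?D t \<circ> (\<lambda>h. h *\<^sub>R \<zeta>' t)) (at t)"
        by (rule diff_chain_at) (use \<zeta>(1) D[OF that] in \<open>auto simp: has_vector_derivative_def\<close>)
      moreover have "?D t \<circ> (\<lambda>h. h *\<^sub>R \<zeta>' t) = (\<lambda>h. h *\<^sub>R ?D t (\<zeta>' t))"
        using linear_scale[OF has_derivative_linear[OF D[OF that]]] by auto
      ultimately show ?thesis by (simp add: has_vector_derivative_def)
    qed
    \<comment> \<open>Continuity of the derivative is known for constant directions, whereas the
      direction \<open>\<zeta>' t\<close> varies; hence the expansion in the basis.\<close>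
    have "continuous_on {a..b} (\<lambda>t. ?D t i)" for i
      by (rule continuous_on_compose2[OF Cinfinity_onD(2)[OF transition_smooth[OF c *(1)]] \<zeta>c])
        (use \<zeta>im in auto)
    then have "continuous_on {a..b} (\<lambda>t. \<Sum>i\<in>Basis. (\<zeta>' t \<bullet> i) *\<^sub>R ?D t i)"
      by (intro continuous_intros continuous_on_subset[OF \<zeta>(2)]) auto
    then have "continuous_on {a..b} (\<lambda>t. ?D t (\<zeta>' t))"
      by (rule continuous_on_eq)
        (rule linear_Basis_expansion[OF has_derivative_linear[OF D], symmetric])
    then have "(transition c c' \<circ> \<zeta>) C1_differentiable_on {a..b}"
      unfolding C1_differentiable_on_def
      using 1 by (intro exI[of _ "\<lambda>t. ?D t (\<zeta>' t)"] conjI ballI)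
    moreover have "coord c' \<circ> \<gamma> = transition c c' \<circ> \<zeta>"
      by (auto simp: \<gamma>_def transition_def)
    ultimately show "(coord c' \<circ> \<gamma>) piecewise_C1_differentiable_on {a..b}"
      by (simp add: C1_differentiable_imp_piecewise)
  qed
  moreover have "\<gamma> 0 = x" "\<gamma> 1 = y"
    using inv_into_f_f[OF coord_inj[OF c] xy(1)] inv_into_f_f[OF coord_inj[OF c] xy(3)]
    unfolding \<gamma>_def xy(2,4) by auto
  moreover have "curve_length M \<gamma> \<le> ennreal K"
  proof -
    have sp: "speed M \<gamma> t \<le> K" if "0 < t" "t < 1" for t
    proof -
      have "((coord c \<circ> \<gamma>) has_vector_derivative \<zeta>' t) (at t)"
        by (rule has_vector_derivative_transform_within[OF \<zeta>(1), where d = "min t (1 - t)"])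
          (use \<gamma>(2) that in \<open>auto simp: dist_real_def abs_if split: if_splits\<close>)
      then have "speed M \<gamma> t = sqrt (tensor M c (coord c (\<gamma> t)) (\<zeta>' t) (\<zeta>' t))"
        by (rule speed_eq[OF p that c, rotated]) (use \<gamma>(1) that in auto)
      also have "\<dots> \<le> sqrt (K\<^sup>2)"
        using K(2)[of t] \<gamma>(2)[of t] that by (intro real_sqrt_le_mono) simp
      finally show ?thesis using K(1) by simp
    qed
    have "AE t in lborel. t \<notin> {0, 1::real}"
      by (rule AE_not_in) (auto intro!: finite_imp_null_set_lborel)
    then have "AE t in lborel. ennreal (speed M \<gamma> t) * indicator {0..1} t \<le> ennreal K * indicator {0..1} t"
      by eventually_elim (use sp in \<open>auto simp: indicator_def intro!: ennreal_leI\<close>)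
    then have "curve_length M \<gamma> \<le> (\<integral>\<^sup>+t. ennreal K * indicator {0..1::real} t \<partial>lborel)"
      unfolding curve_length_def by (rule nn_integral_mono_AE)
    then show ?thesis by (simp add: nn_integral_cmult_indicator)
  qed
  ultimately show ?thesis
    unfolding curve_dist_def by (intro INF_lower2[of \<gamma>]) auto
qed

lemma speed_integral_split:
  assumes "piecewise_C1_curve M \<gamma>" "0 \<le> a" "a \<le> b" "b \<le> c" "c \<le> 1"
  shows "(\<integral>\<^sup>+t\<in>{a..b}. ennreal (speed M \<gamma> t) \<partial>lborel) + (\<integral>\<^sup>+t\<in>{b..c}. ennreal (speed M \<gamma> t) \<partial>lborel)
    = (\<integral>\<^sup>+t\<in>{a..c}. ennreal (speed M \<gamma> t) \<partial>lborel)"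
proof -
  \<comment> \<open>Measurability is available for the speed cut off to \<open>{0..1}\<close>, so
    all integrals are rewritten through it; the two pieces overlap in the null set
    \<open>{b}\<close>.\<close>
  define s where "s t = ennreal (speed M \<gamma> t) * indicator {0..1} t" for t
  have [measurable]: "s \<in> borel_measurable borel"
    unfolding s_def using speed_measurable[OF assms(1)] .
  have eq: "ennreal (speed M \<gamma> t) * indicator {x..y} t = s t * indicator {x..y} t" if "0 \<le> x" "y \<le> 1" for x y t
    using that by (auto simp: s_def indicator_def)
  have "AE t in lborel. t \<notin> {b}"
    by (rule AE_not_in) (auto intro!: finite_imp_null_set_lborel)
  then have ae: "AE t in lborel. s t * indicator {a..b} t + s t * indicator {b..c} t = s t * indicator {a..c} t"
    by eventually_elim (use assms in \<open>auto simp: indicator_def\<close>)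
  show ?thesis
    using assms by (simp add: eq nn_integral_add[symmetric] nn_integral_cong_AE[OF ae])
qed

section \<open>The Riemannian distance as a finite pseudometric\<close>

lemma curve_dist_commute: "curve_dist M x y = curve_dist M y x"
proof -
  have "curve_dist M x y \<le> curve_dist M y x" for x y
    unfolding curve_dist_def[of M y x]
  proof (rule INF_greatest)
    fix \<gamma> assume "\<gamma> \<in> {\<gamma>. piecewise_C1_curve M \<gamma> \<and> \<gamma> 0 = y \<and> \<gamma> 1 = x}"
    then have 1: "(\<lambda>t. \<gamma> (1 - t)) \<in> {\<gamma>. piecewise_C1_curve M \<gamma> \<and> \<gamma> 0 = x \<and> \<gamma> 1 = y}"
      and 2: "curve_length M (\<lambda>t. \<gamma> (1 - t)) = curve_length M \<gamma>"
      using curve_length_reverse by auto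
    show "curve_dist M x y \<le> curve_length M \<gamma>"
      unfolding curve_dist_def 2[symmetric] using 1 by (rule INF_lower)
  qed
  then show ?thesis by (simp add: antisym)
qed

lemma curve_dist_triangle: "curve_dist M x z \<le> curve_dist M x y + curve_dist M y z"
proof -
  let ?C = "\<lambda>x y. {\<gamma>. piecewise_C1_curve M \<gamma> \<and> \<gamma> 0 = x \<and> \<gamma> 1 = y}"
  have *: "curve_dist M x z \<le> curve_length M g + curve_length M h" if "g \<in> ?C x y" "h \<in> ?C y z" for g h
  proof -
    let ?j = "\<lambda>t. if t \<le> 1/2 then g (2 * t) else h (2 * t - 1)"
    have 1: "?j \<in> ?C x z" and 2: "curve_length M ?j = curve_length M g + curve_length M h"
      using curve_length_join[of g h] that by auto
    show ?thesis
      unfolding curve_dist_def 2[symmetric] using 1 by (rule INF_lower)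
  qed
  show ?thesis
  proof (rule ennreal_le_epsilon)
    fix e :: real assume fin: "curve_dist M x y + curve_dist M y z < top" and "0 < e"
    have "\<exists>g\<in>?C x y. curve_length M g < curve_dist M x y + ennreal (e / 2)"
    proof -
      have "(INF g\<in>?C x y. curve_length M g) < curve_dist M x y + ennreal (e / 2)"
        using fin \<open>0 < e\<close> unfolding curve_dist_def[symmetric]
        by (metis add.right_neutral ennreal_add_eq_top ennreal_add_left_cancel_less ennreal_less_zero_iff half_gt_zero infinity_ennreal_def less_top)
      then show ?thesis by (simp add: INF_less_iff)
    qed
    then obtain g where g: "g \<in> ?C x y" "curve_length M g < curve_dist M x y + ennreal (e / 2)" by blast
    have "\<exists>h\<in>?C y z. curve_length M h < curve_dist M y z + ennreal (e / 2)"
    proof -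
      have "(INF h\<in>?C y z. curve_length M h) < curve_dist M y z + ennreal (e / 2)"
        using fin \<open>0 < e\<close> unfolding curve_dist_def[symmetric]
        by (metis add.right_neutral ennreal_add_eq_top ennreal_add_left_cancel_less ennreal_less_zero_iff half_gt_zero infinity_ennreal_def less_top)
      then show ?thesis by (simp add: INF_less_iff)
    qed
    then obtain h where h: "h \<in> ?C y z" "curve_length M h < curve_dist M y z + ennreal (e / 2)" by blast
    have "curve_dist M x z \<le> (curve_dist M x y + ennreal (e / 2)) + (curve_dist M y z + ennreal (e / 2))"
      using *[OF g(1) h(1)] g(2) h(2) by (meson add_mono less_imp_le order_trans)
    also have "\<dots> = curve_dist M x y + curve_dist M y z + (ennreal (e / 2) + ennreal (e / 2))"
      by (simp add: ac_simps)
    also have "ennreal (e / 2) + ennreal (e / 2) = ennreal e"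
      using \<open>0 < e\<close> by (simp flip: ennreal_plus)
    finally show "curve_dist M x z \<le> curve_dist M x y + curve_dist M y z + ennreal e" .
  qed
qed

text \<open>A straight segment in coordinates is a short curve: the sum \<open>S\<close> of the
  absolute metric coefficients bounds the quadratic form by \<open>S z\<close> times the squared
  norm, and continuity bounds \<open>S\<close> by \<open>K\<close> near \<open>x\<close>.\<close>

lemma curve_dist_near:
  assumes "x \<in> points M" "e > 0"
  obtains N where "openin (rtop M) N" "x \<in> N" "\<And>y. y \<in> N \<Longrightarrow> curve_dist M x y \<le> ennreal e"
proof -
  obtain c where c: "c \<in> atlas M" "x \<in> chart_dom c" using assms charts_cover by blast
  define S where "S z = (\<Sum>(i, j)\<in>Basis \<times> Basis. \<bar>tensor M c z i j\<bar>)" for z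
  have "continuous_on (coord c ` chart_dom c) S"
    unfolding S_def split_beta
    by (intro continuous_intros Cinfinity_onD(3)[OF tensor_smooth[OF c(1)]])
  then have "isCont S (coord c x)"
    using continuous_on_eq_continuous_at[OF coord_image_open[OF c(1)]] c(2) by blast
  then obtain r1 where r1: "r1 > 0" "\<And>z. dist z (coord c x) < r1 \<Longrightarrow> dist (S z) (S (coord c x)) < 1"
    unfolding continuous_at_eps_delta by (metis zero_less_one)
  obtain r2 where r2: "r2 > 0" "ball (coord c x) r2 \<subseteq> coord c ` chart_dom c"
    using coord_image_open[OF c(1)] c(2) open_contains_ball by blast
  define K where "K = S (coord c x) + 1"
  have S0: "S z \<ge> 0" for z unfolding S_def by (intro sum_nonneg) auto
  have K: "K > 0" unfolding K_def using S0 by (simp add: add_nonneg_pos)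
  \<comment> \<open>Within \<open>r1\<close> the coefficients stay under \<open>K\<close>, within
    \<open>r2\<close> the segment stays in the chart, and the last term makes its length at most
    \<open>e\<close>.\<close>
  define r where "r = min (min r1 r2) (e / sqrt K)"
  have r: "r > 0" using r1 r2 K assms by (simp add: r_def)
  define N where "N = {y \<in> chart_dom c. coord c y \<in> ball (coord c x) r}"
  have cont: "continuous_map (subtopology (rtop M) (chart_dom c)) euclidean (coord c)"
    using homeomorphic_imp_continuous_map[OF chart_homeomorphic[OF c(1)]]
      continuous_map_into_fulltopology by blast
  have "openin (subtopology (rtop M) (chart_dom c)) {y \<in> topspace (subtopology (rtop M) (chart_dom c)). coord c y \<in> ball (coord c x) r}"
    by (rule openin_continuous_map_preimage[OF cont]) simp
  then have "openin (rtop M) N"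
    unfolding N_def topspace_chart[OF c(1)]
    using openin_trans_full[OF _ chart_dom_open[OF c(1)]] by blast
  moreover have "x \<in> N" using c r by (simp add: N_def)
  moreover have "curve_dist M x y \<le> ennreal e" if "y \<in> N" for y
  proof (rule chart_curve[OF c(1), where \<zeta> = "\<lambda>t. coord c x + t *\<^sub>R (coord c y - coord c x)"])
    let ?v = "coord c y - coord c x"
    have nv: "norm ?v < r" using that by (simp add: N_def dist_norm norm_minus_commute)
    have inb: "coord c x + t *\<^sub>R ?v \<in> ball (coord c x) r" if "0 \<le> t" "t \<le> 1" for t
    proof -
      have "\<bar>t\<bar> * norm ?v \<le> 1 * norm ?v" by (rule mult_right_mono) (use that in auto)
      then show ?thesis using nv by (simp add: dist_norm)
    qed
    have rr: "r \<le> r1" "r \<le> r2" "r \<le> e / sqrt K" by (auto simp: r_def)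
    show "((\<lambda>t. coord c x + t *\<^sub>R ?v) has_vector_derivative ?v) (at t)" for t
      by (auto intro!: derivative_eq_intros)
    show "(\<lambda>t. coord c x + t *\<^sub>R ?v) ` {0..1} \<subseteq> coord c ` chart_dom c"
      using inb r2(2) rr by (force simp: subset_eq)
    show "tensor M c (coord c x + t *\<^sub>R ?v) ?v ?v \<le> e\<^sup>2" if "0 \<le> t" "t \<le> 1" for t
    proof -
      let ?z = "coord c x + t *\<^sub>R ?v"
      have z: "?z \<in> coord c ` chart_dom c" using inb[OF that] r2(2) rr by (auto simp: subset_eq)
      have "tensor M c ?z ?v ?v = (\<Sum>(i, j)\<in>Basis \<times> Basis. (?v \<bullet> j) * ((?v \<bullet> i) * tensor M c ?z i j))"
        by (rule bilinear_Basis_expansion[OF tensor_bilinear[OF c(1) z]])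
      also have "\<dots> \<le> (\<Sum>(i, j)\<in>Basis \<times> Basis. norm ?v * (norm ?v * \<bar>tensor M c ?z i j\<bar>))"
      proof (rule sum_mono, clarify)
        fix i j :: 'e assume "i \<in> Basis" "j \<in> Basis"
        then have "\<bar>(?v \<bullet> j) * ((?v \<bullet> i) * tensor M c ?z i j)\<bar> \<le> norm ?v * (norm ?v * \<bar>tensor M c ?z i j\<bar>)"
          unfolding abs_mult by (intro mult_mono Basis_le_norm) auto
        then show "(?v \<bullet> j) * ((?v \<bullet> i) * tensor M c ?z i j) \<le> norm ?v * (norm ?v * \<bar>tensor M c ?z i j\<bar>)"
          by linarith
      qed
      also have "\<dots> = (norm ?v)\<^sup>2 * S ?z"
        by (simp add: S_def sum_distrib_left split_beta power2_eq_square mult.assoc)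
      also have "\<dots> \<le> (e / sqrt K)\<^sup>2 * K"
      proof (rule mult_mono)
        show "(norm ?v)\<^sup>2 \<le> (e / sqrt K)\<^sup>2" using nv rr by (intro power_mono) auto
        have "dist (S ?z) (S (coord c x)) < 1"
          by (rule r1(2)) (use inb[OF that] rr in \<open>auto simp: dist_commute\<close>)
        then show "S ?z \<le> K" by (simp add: K_def dist_real_def)
      qed (use S0 in auto)
      also have "\<dots> = e\<^sup>2" using K by (simp add: power_divide)
      finally show ?thesis .
    qed
  qed (use that c assms in \<open>auto simp: N_def\<close>)
  ultimately show ?thesis by (rule that)
qed

text \<open>The points at finite distance from \<open>x\<close> form an open set with open
  complement, so connectedness applies. Thereby \<open>rdist\<close> inherits the triangle
  inequality from \<open>curve_dist\<close>.\<close>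

lemma curve_dist_finite:
  assumes "x \<in> points M" "y \<in> points M"
  shows "curve_dist M x y < top"
proof -
  define R where "R = {y \<in> points M. curve_dist M x y < top}"
  have near: "\<exists>N. openin (rtop M) N \<and> z \<in> N \<and> (\<forall>y\<in>N. curve_dist M z y < top)" if z: "z \<in> points M" for z
  proof -
    obtain N where "openin (rtop M) N" "z \<in> N" "\<And>y. y \<in> N \<Longrightarrow> curve_dist M z y \<le> ennreal 1"
      by (rule curve_dist_near[OF z, of 1]) auto
    then show ?thesis by (metis ennreal_less_top le_less_trans)
  qed
  have tri: "curve_dist M x z < top" if "curve_dist M x y < top" "curve_dist M y z < top" for y z
    using curve_dist_triangle[of x z y] that by (metis ennreal_add_less_top le_less_trans)
  have "openin (rtop M) R"
    unfolding openin_subopen[of _ R]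
  proof
    fix z assume z: "z \<in> R"
    then obtain N where N: "openin (rtop M) N" "z \<in> N" "\<forall>y\<in>N. curve_dist M z y < top"
      using near[of z] by (auto simp: R_def)
    moreover have "N \<subseteq> R"
      using N z tri openin_subset[OF N(1)] by (auto simp: R_def)
    ultimately show "\<exists>T. openin (rtop M) T \<and> z \<in> T \<and> T \<subseteq> R" by blast
  qed
  moreover have "openin (rtop M) (points M - R)"
    unfolding openin_subopen[of _ "points M - R"]
  proof
    fix z assume z: "z \<in> points M - R"
    then obtain N where N: "openin (rtop M) N" "z \<in> N" "\<forall>y\<in>N. curve_dist M z y < top"
      using near[of z] by auto
    moreover have "N \<subseteq> points M - R"
    proof
      fix y assume y: "y \<in> N"
      then have "curve_dist M y z < top" using N(3) by (simp add: curve_dist_commute)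
      then show "y \<in> points M - R"
        using tri[of y z] z y openin_subset[OF N(1)] by (auto simp: R_def)
    qed
    ultimately show "\<exists>T. openin (rtop M) T \<and> z \<in> T \<and> T \<subseteq> points M - R" by blast
  qed
  moreover have "x \<in> R"
    using near[OF assms(1)] assms(1) by (auto simp: R_def)
  moreover have "R \<subseteq> points M" by (auto simp: R_def)
  ultimately have "R = points M"
    using connected unfolding connected_space_clopen_in closedin_def by blast
  then show ?thesis using assms(2) by (auto simp: R_def)
qed

lemma rdist_commute: "rdist M x y = rdist M y x"
  by (simp add: rdist_eq_curve_dist curve_dist_commute)

lemma rdist_nonneg: "0 \<le> rdist M x y"
  by (simp add: rdist_eq_curve_dist)

lemma rdist_triangle:
  assumes "x \<in> points M" "y \<in> points M" "z \<in> points M"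
  shows "rdist M x z \<le> rdist M x y + rdist M y z"
proof -
  have "rdist M x z \<le> enn2real (curve_dist M x y + curve_dist M y z)"
    unfolding rdist_eq_curve_dist using assms
    by (intro enn2real_mono curve_dist_triangle) (simp add: curve_dist_finite)
  also have "\<dots> = rdist M x y + rdist M y z"
    unfolding rdist_eq_curve_dist using assms by (intro enn2real_plus curve_dist_finite)
  finally show ?thesis .
qed

lemma rdist_leI:
  assumes "curve_dist M x y \<le> ennreal K" "0 \<le> K"
  shows "rdist M x y \<le> K"
  unfolding rdist_eq_curve_dist using enn2real_mono[OF assms(1)] assms(2) by simp

lemma rdist_near:
  assumes "x \<in> points M" "e > 0"
  obtains N where "openin (rtop M) N" "x \<in> N" "\<And>y. y \<in> N \<Longrightarrow> rdist M x y \<le> e"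
  using curve_dist_near[OF assms] rdist_leI assms(2) by (metis less_imp_le)

lemma rdist_self:
  assumes "x \<in> points M"
  shows "rdist M x x = 0"
proof -
  have "rdist M x x \<le> e" if "e > 0" for e
    by (rule rdist_near[OF assms that]) auto
  then have "rdist M x x \<le> 0" by (rule dense_ge)
  then show ?thesis using rdist_nonneg[of x x] by linarith
qed

text \<open>Finiteness matters here: an infinite infimum would be sent to 0 by
  \<open>enn2real\<close>. A negative \<open>L\<close> is truncated to 0 by \<open>ennreal\<close>,
  hence the final case split.\<close>

lemma rdist_geI:
  assumes "x \<in> points M" "y \<in> points M"
    and "\<And>\<gamma>. \<lbrakk>piecewise_C1_curve M \<gamma>; \<gamma> 0 = x; \<gamma> 1 = y\<rbrakk> \<Longrightarrow> ennreal L \<le> curve_length M \<gamma>"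
  shows "L \<le> rdist M x y"
proof -
  have "ennreal L \<le> curve_dist M x y"
    unfolding curve_dist_def using assms(3) by (intro INF_greatest) auto
  then have "enn2real (ennreal L) \<le> rdist M x y"
    unfolding rdist_eq_curve_dist using curve_dist_finite[OF assms(1,2)] by (intro enn2real_mono)
  then show ?thesis
    by (cases "0 \<le> L") (use rdist_nonneg[of x y] in auto)
qed

lemma short_curve:
  assumes "x \<in> points M" "y \<in> points M" "rdist M x y < e"
  obtains \<gamma> where "piecewise_C1_curve M \<gamma>" "\<gamma> 0 = x" "\<gamma> 1 = y" "curve_length M \<gamma> < ennreal e"
proof -
  have "0 < e" using rdist_nonneg[of x y] assms(3) by linarith
  then have "curve_dist M x y < ennreal e"
    using assms(3) curve_dist_finite[OF assms(1,2)] unfolding rdist_eq_curve_dist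
    by (metis enn2real_less_iff less_imp_le ennreal_enn2real ennreal_lessI)
  then show ?thesis
    unfolding curve_dist_def INF_less_iff using that by blast
qed

end

section \<open>The hyperbolic metric of the upper half-plane\<close>

definition hyp_metric :: "complex \<Rightarrow> complex \<Rightarrow> complex \<Rightarrow> real" where
  "hyp_metric z u v = (u \<bullet> v) / (Im z)\<^sup>2"

lemma bilinear_hyp_metric: "bilinear (hyp_metric z)"
  unfolding bilinear_def hyp_metric_def
  by (auto intro!: linearI simp: inner_add_left inner_add_right add_divide_distrib)

lemma frechet_derivative_hyp_metric:
  assumes "Im z > 0"
  shows "frechet_derivative (\<lambda>y. hyp_metric y u v) (at z) h = - (2 * (u \<bullet> v) * Im h / Im z ^ 3)"
  using frechet_derivative_at[OF has_derivative_Im_power[of z "u \<bullet> v" 2], symmetric] assms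
  by (simp add: hyp_metric_def numeral_3_eq_3 power2_eq_square mult_ac)

text \<open>For this conformal metric the Koszul formula collapses to a complex bilinear expression,
  which reduces curvature and the geodesic equation to complex algebra.\<close>

lemma christoffel_hyp_metric:
  assumes "Im z > 0"
  shows "christoffel hyp_metric z u v = \<i> * u * v / of_real (Im z)"
  unfolding christoffel_def
proof (rule the_equality)
  let ?R = "\<lambda>w. frechet_derivative (\<lambda>y. hyp_metric y v w) (at z) u +
      frechet_derivative (\<lambda>y. hyp_metric y u w) (at z) v -
      frechet_derivative (\<lambda>y. hyp_metric y u v) (at z) w"
  show 1: "\<forall>w. 2 * hyp_metric z (\<i> * u * v / of_real (Im z)) w = ?R w"
    unfolding frechet_derivative_hyp_metric[OF assms]
    using assms by (simp add: hyp_metric_def inner_complex_def field_simps power2_eq_square power3_eq_cube)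
  fix x assume x: "\<forall>w. 2 * hyp_metric z x w = ?R w"
  have "hyp_metric z x w = hyp_metric z (\<i> * u * v / of_real (Im z)) w" for w
    using 1 x by (metis mult_cancel_left zero_neq_numeral)
  then have "x \<bullet> w = (\<i> * u * v / of_real (Im z)) \<bullet> w" for w
    using assms by (simp add: hyp_metric_def)
  then show "x = \<i> * u * v / of_real (Im z)"
    using vector_eq_rdot by blast
qed

lemma frechet_derivative_christoffel_hyp_metric:
  assumes "Im z > 0"
  shows "frechet_derivative (\<lambda>y. christoffel hyp_metric y u v) (at z) h
    = - of_real (Im h / (Im z)\<^sup>2) * (\<i> * u * v)"
proof -
  have "((\<lambda>y. (1 / Im y ^ 1) *\<^sub>R (\<i> * u * v)) has_derivative
      (\<lambda>h. - (real 1 * 1 * Im h / Im z ^ Suc 1) *\<^sub>R (\<i> * u * v))) (at z)"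
    by (rule has_derivative_scaleR_left, rule has_derivative_Im_power) (use assms in auto)
  then have "((\<lambda>y. christoffel hyp_metric y u v) has_derivative
      (\<lambda>h. - (real 1 * 1 * Im h / Im z ^ Suc 1) *\<^sub>R (\<i> * u * v))) (at z)"
    by (rule has_derivative_transform_within_open[where s = "{z. 0 < Im z}"])
      (use assms in \<open>auto simp: christoffel_hyp_metric open_halfspace_Im_gt scaleR_conv_of_real\<close>)
  from frechet_derivative_at[OF this, symmetric] show ?thesis
    by (simp add: scaleR_conv_of_real power2_eq_square)
qed

lemma sectional_curvature_hyp_metric:
  assumes "Im z > 0" "u \<noteq> v" "independent {u, v}"
  shows "sectional_curvature hyp_metric z u v = -1"
proof -
  \<comment> \<open>The determinant of \<open>u\<close> and \<open>v\<close>, nonzero by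
    independence. With y = Im z, numerator and denominator of the sectional curvature become -d^2 /
    y^4 and d^2 / y^4.\<close>
  define d where "d = Re u * Im v - Re v * Im u"
  have d: "d \<noteq> 0"
  proof
    assume d0: "d = 0"
    have v0: "v \<noteq> 0"
      using assms(3) dependent_zero by auto
    then have "Re v \<noteq> 0 \<or> Im v \<noteq> 0" by (auto simp: complex_eq_iff)
    then have "\<exists>k. u = k *\<^sub>R v"
    proof
      assume "Re v \<noteq> 0"
      then have "u = (Re u / Re v) *\<^sub>R v"
        using d0 by (simp add: complex_eq_iff d_def field_simps)
      then show ?thesis by blast
    next
      assume "Im v \<noteq> 0"
      then have "u = (Im u / Im v) *\<^sub>R v"
        using d0 by (simp add: complex_eq_iff d_def field_simps)
      then show ?thesis by blast
    qed
    then have "u \<in> span ({u, v} - {u})"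
      using assms(2) by (auto simp: span_singleton insert_Diff_if)
    then show False
      using assms(3) unfolding dependent_def by blast
  qed
  let ?y = "Im z"
  have c: "christoffel hyp_metric z a b = \<i> * a * b / of_real ?y" for a b
    by (rule christoffel_hyp_metric[OF assms(1)])
  have R: "curvature_tensor hyp_metric z u v v = of_real (d / ?y\<^sup>2) * (\<i> * v)"
    unfolding curvature_tensor_def frechet_derivative_christoffel_hyp_metric[OF assms(1)] c
    using assms(1) by (simp add: complex_eq_iff d_def field_simps power2_eq_square)
  have 1: "hyp_metric z (curvature_tensor hyp_metric z u v v) u = - (d\<^sup>2 / ?y ^ 4)"
    unfolding R using assms(1)
    by (simp add: hyp_metric_def inner_complex_def d_def field_simps power2_eq_square power4_eq_xxxx)
  have 2: "hyp_metric z u u * hyp_metric z v v - (hyp_metric z u v)\<^sup>2 = d\<^sup>2 / ?y ^ 4"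
    using assms(1)
    by (simp add: hyp_metric_def inner_complex_def d_def field_simps power2_eq_square power4_eq_xxxx)
  show ?thesis
    unfolding sectional_curvature_def 1 2 using d assms(1) by simp
qed

section \<open>Inversions and nonexpansive functions\<close>

text \<open>The differential has norm at most 1 for the hyperbolic metric. This infinitesimal form
  of being 1-Lipschitz is what integration along curves uses.\<close>

definition half_plane_nonexpansive :: "(complex \<Rightarrow> real) \<Rightarrow> bool" where
  "half_plane_nonexpansive \<phi> \<longleftrightarrow>
     (\<forall>z. 0 < Im z \<longrightarrow> (\<exists>D. (\<phi> has_derivative D) (at z) \<and> (\<forall>v. \<bar>D v\<bar> \<le> norm v / Im z)))"

lemma has_derivative_ln_Im:
  "0 < Im z \<Longrightarrow> ((\<lambda>z. ln (Im z)) has_derivative (\<lambda>v. Im v / Im z)) (at z)"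
  by (auto intro!: derivative_eq_intros simp: field_simps)

text \<open>Up to sign this is the Busemann function of the half-plane at infinity.\<close>

lemma nonexpansive_ln_Im: "half_plane_nonexpansive (\<lambda>z. ln (Im z))"
  unfolding half_plane_nonexpansive_def
proof (intro allI impI exI conjI)
  fix z :: complex assume "0 < Im z"
  then show "((\<lambda>z. ln (Im z)) has_derivative (\<lambda>v. Im v / Im z)) (at z)"
    by (rule has_derivative_ln_Im)
  show "\<bar>Im v / Im z\<bar> \<le> norm v / Im z" for v
    using \<open>0 < Im z\<close> abs_Im_le_cmod[of v] by (simp add: divide_right_mono)
qed

lemma has_derivative_ln_norm_diff:
  fixes z :: complex
  assumes "z \<noteq> a"
  shows "((\<lambda>z. ln (norm (z - a))) has_derivative (\<lambda>v. ((z - a) \<bullet> v) / (norm (z - a))\<^sup>2)) (at z)"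
proof -
  have "((\<lambda>z. norm (z - a)) has_derivative (\<lambda>v. sgn (z - a) \<bullet> v)) (at z)"
    using has_derivative_compose[OF has_derivative_diff[OF has_derivative_ident has_derivative_const]
        has_derivative_norm[of "z - a"]] assms by (simp add: inner_commute)
  then have "((\<lambda>z. ln (norm (z - a))) has_derivative (\<lambda>v. (sgn (z - a) \<bullet> v) * inverse (norm (z - a)))) (at z)"
    using assms by (auto intro!: derivative_eq_intros)
  moreover have "(\<lambda>v. (sgn (z - a) \<bullet> v) * inverse (norm (z - a))) = (\<lambda>v. ((z - a) \<bullet> v) / (norm (z - a))\<^sup>2)"
    unfolding sgn_div_norm inner_scaleR_left
    using assms by (simp add: fun_eq_iff divide_inverse power2_eq_square mult_ac)
  ultimately show ?thesis by simp
qed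

text \<open>The Euclidean gradient has norm 1 / |z - a|, and |z - a| is at least Im z because
  \<open>a\<close> is real.\<close>

lemma nonexpansive_ln_norm: "half_plane_nonexpansive (\<lambda>z. ln (norm (z - of_real a)))"
  unfolding half_plane_nonexpansive_def
proof (intro allI impI exI conjI)
  fix z :: complex assume z: "0 < Im z"
  let ?w = "z - of_real a"
  have w: "?w \<noteq> 0" "Im z \<le> norm ?w"
    using z abs_Im_le_cmod[of ?w] by (auto simp: complex_eq_iff)
  then show "((\<lambda>z. ln (norm (z - of_real a))) has_derivative (\<lambda>v. (?w \<bullet> v) / (norm ?w)\<^sup>2)) (at z)"
    by (intro has_derivative_ln_norm_diff) auto
  fix v :: complex
  have "\<bar>(?w \<bullet> v) / (norm ?w)\<^sup>2\<bar> \<le> norm ?w * norm v / (norm ?w)\<^sup>2"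
    using Cauchy_Schwarz_ineq2[of ?w v] by (simp add: divide_right_mono)
  also have "\<dots> = norm v / norm ?w" using w by (simp add: power2_eq_square)
  also have "\<dots> \<le> norm v / Im z" using w z by (intro divide_left_mono) auto
  finally show "\<bar>(?w \<bullet> v) / (norm ?w)\<^sup>2\<bar> \<le> norm v / Im z" .
qed

text \<open>The Busemann function of the half-plane at the boundary point 0.\<close>

lemma nonexpansive_ln_horocycle: "half_plane_nonexpansive (\<lambda>z. 2 * ln (norm z) - ln (Im z))"
  unfolding half_plane_nonexpansive_def
proof (intro allI impI exI conjI)
  fix z :: complex assume z: "0 < Im z"
  then have z0: "z \<noteq> 0" by auto
  \<comment> \<open>The Euclidean gradient. In its square the mixed term cancels 4 / |z|^2, which
    leaves the norm exactly 1 / Im z.\<close>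
  define w where "w = (2 / (norm z)\<^sup>2) *\<^sub>R z - (1 / Im z) *\<^sub>R \<i>"
  have "((\<lambda>z. 2 * ln (norm z) - ln (Im z)) has_derivative (\<lambda>v. 2 * ((z \<bullet> v) / (norm z)\<^sup>2) - Im v / Im z)) (at z)"
    using has_derivative_diff[OF has_derivative_mult_right[OF has_derivative_ln_norm_diff[OF z0], of 2]
        has_derivative_ln_Im[OF z]] by simp
  moreover have "(\<lambda>v. 2 * ((z \<bullet> v) / (norm z)\<^sup>2) - Im v / Im z) = (\<lambda>v. w \<bullet> v)"
    by (simp add: fun_eq_iff w_def inner_complex_def add_divide_distrib algebra_simps)
  ultimately show "((\<lambda>z. 2 * ln (norm z) - ln (Im z)) has_derivative (\<lambda>v. w \<bullet> v)) (at z)" by simp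
  have "w \<bullet> w = 1 / (Im z)\<^sup>2"
  proof -
    have "w \<bullet> w = (2 / (norm z)\<^sup>2)\<^sup>2 * (z \<bullet> z) - 2 * (2 / (norm z)\<^sup>2) * (1 / Im z) * (z \<bullet> \<i>) + (1 / Im z)\<^sup>2 * (\<i> \<bullet> \<i>)"
      by (simp add: w_def inner_diff_left inner_diff_right inner_commute algebra_simps power2_eq_square)
    also have "\<dots> = 4 / (norm z)\<^sup>2 - 4 / (norm z)\<^sup>2 + 1 / (Im z)\<^sup>2"
      using z z0 unfolding power2_norm_eq_inner[symmetric]
      by (simp add: inner_complex_def power2_eq_square field_simps)
    finally show ?thesis by simp
  qed
  then have "norm w = 1 / Im z"
    using z by (simp add: norm_eq_sqrt_inner real_sqrt_divide)
  then show "\<bar>w \<bullet> v\<bar> \<le> norm v / Im z" for v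
    using Cauchy_Schwarz_ineq2[of w v] by simp
qed

text \<open>Inversion in the circle of centre \<open>c\<close> and radius \<open>r\<close>. As
  \<open>c\<close> is real, it is the hyperbolic reflection in the geodesic carried by this
  circle.\<close>

definition inversion :: "real \<Rightarrow> real \<Rightarrow> complex \<Rightarrow> complex" where
  "inversion c r z = of_real c + of_real (r\<^sup>2) / (cnj z - of_real c)"

lemma cnj_diff_of_real: "cnj z - of_real c = cnj (z - of_real c)"
  by simp

lemma Im_inversion: "Im (inversion c r z) = r\<^sup>2 * Im z / (norm (z - of_real c))\<^sup>2"
  unfolding inversion_def cnj_diff_of_real
  by (simp add: Im_divide cmod_power2 del: complex_cnj_diff)

lemma norm_inversion: "norm (inversion c r z - of_real c) = r\<^sup>2 / norm (z - of_real c)"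
  unfolding inversion_def cnj_diff_of_real
  by (simp add: norm_divide norm_power del: complex_cnj_diff)

lemma inversion_fixed:
  assumes "norm (z - of_real c) = r" "r > 0"
  shows "inversion c r z = z"
proof -
  have "of_real (r\<^sup>2) = (z - of_real c) * cnj (z - of_real c)"
    using assms(1) by (metis complex_norm_square)
  moreover have "cnj (z - of_real c) \<noteq> 0"
    unfolding complex_cnj_zero_iff using assms by auto
  ultimately show ?thesis
    unfolding inversion_def cnj_diff_of_real by simp
qed

lemma inversion_involution:
  assumes "r \<noteq> 0" "z \<noteq> of_real c"
  shows "inversion c r (inversion c r z) = z"
proof -
  have "cnj (z - of_real c) \<noteq> 0" "z - of_real c \<noteq> 0"
    unfolding complex_cnj_zero_iff using assms(2) by auto
  then show ?thesis using assms(1) by (simp add: inversion_def)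
qed

lemma has_derivative_inversion:
  assumes "z \<noteq> of_real c"
  shows "(inversion c r has_derivative (\<lambda>v. - of_real (r\<^sup>2) * cnj v / (cnj (z - of_real c))\<^sup>2)) (at z)"
proof -
  have ne: "cnj z - of_real c \<noteq> 0" using assms by (metis cnj_diff_of_real complex_cnj_zero_iff right_minus_eq)
  have "((\<lambda>w. of_real c + of_real (r\<^sup>2) / (w - of_real c)) has_field_derivative
      - of_real (r\<^sup>2) / (cnj z - of_real c)\<^sup>2) (at (cnj z))"
    using ne by (auto intro!: derivative_eq_intros simp: power2_eq_square)
  from has_derivative_compose[OF bounded_linear_imp_has_derivative[OF bounded_linear_cnj] this[unfolded has_field_derivative_def]]
  show ?thesis
    by (simp add: inversion_def[abs_def])
qed

text \<open>An inversion multiplies tangent vectors and imaginary parts by the same factor r^2 / |z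
  - c|^2, so it is an isometry.\<close>

lemma nonexpansive_inversion:
  assumes "half_plane_nonexpansive \<phi>" "r \<noteq> 0"
  shows "half_plane_nonexpansive (\<lambda>z. \<phi> (inversion c r z))"
  unfolding half_plane_nonexpansive_def
proof (intro allI impI)
  fix z :: complex assume z: "0 < Im z"
  then have ne: "z \<noteq> of_real c" by auto
  have i: "0 < Im (inversion c r z)"
    using z assms(2) ne by (simp add: Im_inversion)
  then obtain D where D: "(\<phi> has_derivative D) (at (inversion c r z))"
    "\<And>v. \<bar>D v\<bar> \<le> norm v / Im (inversion c r z)"
    using assms(1) unfolding half_plane_nonexpansive_def by blast
  let ?E = "\<lambda>v. - of_real (r\<^sup>2) * cnj v / (cnj (z - of_real c))\<^sup>2"
  have "((\<lambda>z. \<phi> (inversion c r z)) has_derivative (\<lambda>v. D (?E v))) (at z)"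
    by (rule has_derivative_compose[OF has_derivative_inversion[OF ne] D(1)])
  moreover have "\<bar>D (?E v)\<bar> \<le> norm v / Im z" for v
  proof -
    have "norm (?E v) = r\<^sup>2 * norm v / (norm (z - of_real c))\<^sup>2"
      by (simp add: norm_mult norm_divide norm_power del: complex_cnj_diff)
    then have "norm (?E v) / Im (inversion c r z) = norm v / Im z"
      using z ne assms(2) by (simp add: Im_inversion field_simps)
    then show ?thesis using D(2)[of "?E v"] by simp
  qed
  ultimately show "\<exists>D. ((\<lambda>z. \<phi> (inversion c r z)) has_derivative D) (at z) \<and> (\<forall>v. \<bar>D v\<bar> \<le> norm v / Im z)"
    by blast
qed

text \<open>Two antiholomorphic maps compose to a holomorphic one; this is the shape of the
  nontrivial transition maps.\<close>

lemma inversion_comp_derivative: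
  assumes "z \<noteq> of_real c" "inversion c r z \<noteq> of_real c'"
  shows "((\<lambda>z. inversion c' r' (inversion c r z)) has_field_derivative
      of_real (r'\<^sup>2 * r\<^sup>2) / ((z - of_real c)\<^sup>2 * (cnj (inversion c r z - of_real c'))\<^sup>2)) (at z)"
proof -
  have "((\<lambda>z. inversion c' r' (inversion c r z)) has_derivative
      (\<lambda>v. - of_real (r'\<^sup>2) * cnj (- of_real (r\<^sup>2) * cnj v / (cnj (z - of_real c))\<^sup>2)
        / (cnj (inversion c r z - of_real c'))\<^sup>2)) (at z)"
    by (rule has_derivative_compose[OF has_derivative_inversion[OF assms(1)] has_derivative_inversion[OF assms(2)]])
  moreover have "(\<lambda>v. - of_real (r'\<^sup>2) * cnj (- of_real (r\<^sup>2) * cnj v / (cnj (z - of_real c))\<^sup>2)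
        / (cnj (inversion c r z - of_real c'))\<^sup>2)
    = (*) (of_real (r'\<^sup>2 * r\<^sup>2) / ((z - of_real c)\<^sup>2 * (cnj (inversion c r z - of_real c'))\<^sup>2))"
    by (auto simp: fun_eq_iff)
  ultimately show ?thesis by (simp add: has_field_derivative_def)
qed

lemma norm_inversion_comp_derivative:
  assumes "0 < Im z" "r \<noteq> 0"
  shows "norm (of_real (r'\<^sup>2 * r\<^sup>2) / ((z - of_real c)\<^sup>2 * (cnj (inversion c r z - of_real c'))\<^sup>2)) * Im z
    = Im (inversion c' r' (inversion c r z))"
  by (simp add: Im_inversion norm_mult norm_divide norm_power del: complex_cnj_diff)

section \<open>Surfaces with an atlas in the upper half-plane\<close>

locale half_plane_atlas = riemann M for M :: "('a, complex) riemannian" +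
  assumes coord_upper: "\<And>c x. \<lbrakk>c \<in> atlas M; x \<in> chart_dom c\<rbrakk> \<Longrightarrow> 0 < Im (coord c x)"
    and tensor_eq: "\<And>c. c \<in> atlas M \<Longrightarrow> tensor M c = hyp_metric"
begin

lemma constant_curvature: "constant_curvature (-1) M"
  unfolding constant_curvature_def
  using sectional_curvature_hyp_metric coord_upper tensor_eq by fastforce

text \<open>Along the curve the derivative of \<open>\<phi>\<close> in coordinates is at most the
  hyperbolic speed, off a finite set.\<close>

lemma chart_length_lower_bound:
  assumes \<gamma>: "piecewise_C1_curve M \<gamma>" and c: "c \<in> atlas M"
    and ab: "0 \<le> a" "a \<le> b" "b \<le> 1" "\<gamma> ` {a..b} \<subseteq> chart_dom c"
    and \<phi>: "half_plane_nonexpansive \<phi>"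
  shows "ennreal \<bar>\<phi> (coord c (\<gamma> b)) - \<phi> (coord c (\<gamma> a))\<bar> \<le> (\<integral>\<^sup>+t\<in>{a..b}. ennreal (speed M \<gamma> t) \<partial>lborel)"
proof (cases "a < b")
  case True
  have p: "pathin (rtop M) \<gamma>" using \<gamma> by (simp add: piecewise_C1_curve_def)
  have "(coord c \<circ> \<gamma>) piecewise_C1_differentiable_on {a..b}"
    using \<gamma> c ab True by (auto simp: piecewise_C1_curve_def)
  then obtain S \<zeta>' where S: "continuous_on {a..b} (coord c \<circ> \<gamma>)" "finite S"
    "\<And>t. t \<in> {a..b} - S \<Longrightarrow> ((coord c \<circ> \<gamma>) has_vector_derivative \<zeta>' t) (at t)"
    unfolding piecewise_C1_differentiable_on_def C1_differentiable_on_def by blast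
  have up: "0 < Im (coord c (\<gamma> t))" if "t \<in> {a..b}" for t
    using coord_upper[OF c] ab that by blast
  define D where "D z = (SOME D. (\<phi> has_derivative D) (at z) \<and> (\<forall>v. \<bar>D v\<bar> \<le> norm v / Im z))" for z
  have D: "(\<phi> has_derivative D z) (at z)" "\<bar>D z v\<bar> \<le> norm v / Im z" if "0 < Im z" for z v
    using someI_ex[OF \<phi>[unfolded half_plane_nonexpansive_def, rule_format, OF that]] by (auto simp: D_def)
  show ?thesis
  proof (rule abs_diff_le_nn_integral_derivative[OF ab(2) S(2), where f = "\<lambda>t. \<phi> (coord c (\<gamma> t))"
        and f' = "\<lambda>t. D (coord c (\<gamma> t)) (\<zeta>' t)"])
    have "continuous_on {z. 0 < Im z} \<phi>"
      using D(1) has_derivative_continuous by (intro continuous_at_imp_continuous_on) blast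
    then have "continuous_on {a..b} (\<phi> \<circ> (coord c \<circ> \<gamma>))"
      by (intro continuous_on_compose S(1)) (auto elim!: continuous_on_subset intro: up)
    then show "continuous_on {a..b} (\<lambda>t. \<phi> (coord c (\<gamma> t)))" by (simp add: o_def)
    fix t assume t: "t \<in> {a<..<b} - S"
    have tv: "((coord c \<circ> \<gamma>) has_vector_derivative \<zeta>' t) (at t)" by (rule S(3)) (use t in auto)
    have ut: "0 < Im (coord c (\<gamma> t))" by (rule up) (use t in auto)
    have "((\<phi> \<circ> (coord c \<circ> \<gamma>)) has_derivative D (coord c (\<gamma> t)) \<circ> (\<lambda>h. h *\<^sub>R \<zeta>' t)) (at t)"
      by (rule diff_chain_at) (use tv D(1)[OF ut] in \<open>auto simp: has_vector_derivative_def\<close>)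
    moreover have "D (coord c (\<gamma> t)) \<circ> (\<lambda>h. h *\<^sub>R \<zeta>' t) = (\<lambda>h. h *\<^sub>R D (coord c (\<gamma> t)) (\<zeta>' t))"
      using linear_scale[OF has_derivative_linear[OF D(1)[OF ut]]] by auto
    ultimately show "((\<lambda>t. \<phi> (coord c (\<gamma> t))) has_vector_derivative D (coord c (\<gamma> t)) (\<zeta>' t)) (at t)"
      by (simp add: has_vector_derivative_def o_def)
    have tc: "\<gamma> t \<in> chart_dom c" using ab(4) t by auto
    have "speed M \<gamma> t = norm (\<zeta>' t) / Im (coord c (\<gamma> t))"
      using speed_eq[OF p _ _ c tc tv] t ab ut
      by (simp add: tensor_eq[OF c] hyp_metric_def real_sqrt_divide norm_eq_sqrt_inner)
    then show "\<bar>D (coord c (\<gamma> t)) (\<zeta>' t)\<bar> \<le> speed M \<gamma> t"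
      using D(2)[OF ut, of "\<zeta>' t"] by simp
  qed
next
  case False
  then show ?thesis using ab by simp
qed

lemma chart_curve_rdist:
  assumes "c \<in> atlas M" "\<And>t. (\<zeta> has_vector_derivative \<zeta>' t) (at t)" "continuous_on UNIV \<zeta>'"
    and "\<zeta> ` {0..1} \<subseteq> coord c ` chart_dom c"
    and K: "0 \<le> K" "\<And>t. 0 \<le> t \<Longrightarrow> t \<le> 1 \<Longrightarrow> norm (\<zeta>' t) \<le> K * Im (\<zeta> t)"
    and "x \<in> chart_dom c" "coord c x = \<zeta> 0" "y \<in> chart_dom c" "coord c y = \<zeta> 1"
  shows "rdist M x y \<le> K"
proof (rule rdist_leI[OF chart_curve[OF assms(1-5) _ assms(7-10)] K(1)])
  fix t :: real assume t: "0 \<le> t" "t \<le> 1"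
  have "\<zeta> t \<in> coord c ` chart_dom c" using assms(4) t by auto
  then have "0 < Im (\<zeta> t)" using coord_upper[OF assms(1)] by auto
  moreover have "(norm (\<zeta>' t))\<^sup>2 \<le> (K * Im (\<zeta> t))\<^sup>2"
    using K(2)[OF t] by (intro power_mono) auto
  ultimately show "tensor M c (\<zeta> t) (\<zeta>' t) (\<zeta>' t) \<le> K\<^sup>2"
    by (simp add: tensor_eq[OF assms(1)] hyp_metric_def power2_norm_eq_inner[symmetric] divide_le_eq power_mult_distrib)
qed

end

section \<open>Doubling the half-plane along a sequence of geodesics\<close>

text \<open>The bound on \<open>p 0\<close> keeps the gaps away from the imaginary axis. The factor
  4 within a gap puts the tangent point high enough (\<open>tangent_height_ge\<close>), and the
  factor 4 between gaps keeps all earlier arcs below that height.\<close>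

locale gap_sequence =
  fixes p q :: "nat \<Rightarrow> real"
  assumes p0: "1 \<le> p 0" and pq: "4 * p n \<le> q n" and qp: "4 * q n \<le> p (Suc n)"
begin

section \<open>Gaps and the height of the boundary arcs\<close>

definition mid :: "nat \<Rightarrow> real" where "mid n = (p n + q n) / 2"
definition rad :: "nat \<Rightarrow> real" where "rad n = (q n - p n) / 2"

lemma p_gt: "real n < p n" and p_ge_1: "1 \<le> p n"
proof -
  have "real n < p n \<and> 1 \<le> p n"
  proof (induction n)
    case 0
    then show ?case using p0 by simp
  next
    case (Suc n)
    then show ?case using pq[of n] qp[of n] by auto
  qed
  then show "real n < p n" "1 \<le> p n" by auto
qed

lemma p_less_q: "p n < q n" using pq[of n] p_ge_1[of n] by linarith

lemma rad_pos: "0 < rad n" using p_less_q[of n] by (simp add: rad_def)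

lemma q_le_p: "m < n \<Longrightarrow> 4 * q m \<le> p n"
proof (induction n)
  case (Suc n)
  show ?case
  proof (cases "m = n")
    case False
    then have "4 * q m \<le> p n" using Suc by simp
    then show ?thesis using pq[of n] qp[of n] p_ge_1[of n] by linarith
  qed (simp add: qp)
qed simp

lemma gap_unique:
  assumes "p m < x" "x < q m" "p n < x" "x < q n"
  shows "m = n"
proof (rule linorder_cases[of m n])
  assume "m < n"
  then show ?thesis using q_le_p[of m n] assms p_ge_1[of m] by linarith
next
  assume "n < m"
  then show ?thesis using q_le_p[of n m] assms p_ge_1[of n] by linarith
qed

definition arc_height :: "nat \<Rightarrow> real \<Rightarrow> real" where
  "arc_height n x = sqrt (max 0 ((x - p n) * (q n - x)))"

text \<open>At most one summand is nonzero. Because \<open>n < p n\<close>, no gap with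
  \<open>n > x\<close> reaches \<open>x\<close>, so the index bound discards only zeros and makes
  the sum finite.\<close>

definition height :: "real \<Rightarrow> real" where
  "height x = (\<Sum>n | real n \<le> x. arc_height n x)"

lemma arc_height_nonneg: "0 \<le> arc_height n x"
  by (simp add: arc_height_def)

lemma arc_height_eq_0:
  assumes "\<not> (p n < x \<and> x < q n)"
  shows "arc_height n x = 0"
proof -
  have "(x - p n) * (q n - x) \<le> 0"
    using assms p_less_q[of n] by (auto simp: mult_le_0_iff)
  then show ?thesis by (simp add: arc_height_def)
qed

lemma finite_real_le: "finite {n. real n \<le> x}"
  by (rule finite_subset[of _ "{..nat \<lfloor>x\<rfloor>}"]) (auto intro: le_nat_floor)

text \<open>To the left of \<open>N\<close> the index set no longer depends on \<open>x\<close>,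
  which yields continuity of \<open>height\<close>.\<close>

lemma height_eq_sum:
  assumes "x < real N"
  shows "height x = (\<Sum>n<N. arc_height n x)"
  unfolding height_def
proof (rule sum.mono_neutral_left)
  show "\<forall>n\<in>{..<N} - {n. real n \<le> x}. arc_height n x = 0"
  proof
    fix n assume "n \<in> {..<N} - {n. real n \<le> x}"
    then show "arc_height n x = 0" using p_gt[of n] by (intro arc_height_eq_0) auto
  qed
qed (use assms in auto)

lemma height_nonneg: "0 \<le> height x"
  unfolding height_def by (intro sum_nonneg arc_height_nonneg)

lemma height_gap:
  assumes "p n < x" "x < q n"
  shows "height x = arc_height n x"
proof -
  have "height x = sum (\<lambda>n. arc_height n x) {n}"
    unfolding height_def
  proof (rule sum.mono_neutral_right[OF finite_real_le])
    show "{n} \<subseteq> {n. real n \<le> x}" using p_gt[of n] assms by auto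
    show "\<forall>i\<in>{n. real n \<le> x} - {n}. arc_height i x = 0"
      using gap_unique[OF _ _ assms] arc_height_eq_0 by blast
  qed
  then show ?thesis by simp
qed

lemma height_sq:
  assumes "p n < x" "x < q n"
  shows "(height x)\<^sup>2 = (rad n)\<^sup>2 - (x - mid n)\<^sup>2" "0 < height x"
proof -
  have "0 < (x - p n) * (q n - x)" using assms by simp
  moreover have "(x - p n) * (q n - x) = (rad n)\<^sup>2 - (x - mid n)\<^sup>2"
    by (simp add: rad_def mid_def power2_eq_square field_simps)
  ultimately show "(height x)\<^sup>2 = (rad n)\<^sup>2 - (x - mid n)\<^sup>2" "0 < height x"
    by (simp_all add: height_gap[OF assms] arc_height_def)
qed

lemma height_no_gap: "(\<And>n. \<not> (p n < x \<and> x < q n)) \<Longrightarrow> height x = 0"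
  unfolding height_def by (intro sum.neutral ballI arc_height_eq_0)

lemma height_pos_iff: "0 < height x \<longleftrightarrow> (\<exists>n. p n < x \<and> x < q n)"
  using height_no_gap[of x] height_sq(2) by fastforce

lemma continuous_height: "continuous_on S height"
proof -
  have "isCont height x" for x
  proof -
    obtain N :: nat where N: "x < real N" using reals_Archimedean2 by blast
    have "continuous_on {..<real N} (\<lambda>x. \<Sum>n<N. arc_height n x)"
      unfolding arc_height_def by (intro continuous_intros)
    then have "continuous_on {..<real N} height"
      by (rule continuous_on_eq) (simp add: height_eq_sum)
    then show ?thesis
      using N by (simp add: continuous_on_eq_continuous_at)
  qed
  then show ?thesis by (simp add: continuous_at_imp_continuous_on)
qed

text \<open>The two sheets are \<open>Im w \<ge> 0\<close> and \<open>Im w \<le> 0\<close>, glued along the gaps \<open>(p n, q n)\<close> of the real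
  axis; \<open>proj\<close> maps each sheet onto the complement of the open half-discs over the gaps.\<close>

definition proj :: "complex \<Rightarrow> complex" where
  "proj w = Complex (Re w) (\<bar>Im w\<bar> + height (Re w))"

definition double :: "complex set" where
  "double = {w. Im w \<noteq> 0 \<or> 0 < height (Re w)}"

text \<open>The gaps being disjoint, two different sets of this kind share just the two open sheets,
  so no transition between different charts has to be examined on a seam.\<close>

definition slit :: "nat \<Rightarrow> complex set" where
  "slit n = {w. Im w \<noteq> 0 \<or> p n < Re w \<and> Re w < q n}"

text \<open>Unfolds the double across arc \<open>n\<close>: the upper sheet goes outside the circle,
  the reflected lower sheet inside. On the gap itself the first branch applies, and there the
  inversion fixes the arc.\<close>

definition chart_map :: "nat \<Rightarrow> complex \<Rightarrow> complex" where
  "chart_map n w = (if Im w \<le> 0 then inversion (mid n) (rad n) (proj w) else proj w)"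

lemma Re_proj [simp]: "Re (proj w) = Re w" and Im_proj [simp]: "Im (proj w) = \<bar>Im w\<bar> + height (Re w)"
  by (simp_all add: proj_def)

lemma slit_subset: "slit n \<subseteq> double"
  by (auto simp: slit_def double_def height_pos_iff)

lemma Union_slit: "(\<Union>n. slit n) = double"
  by (auto simp: slit_def double_def height_pos_iff)

lemma proj_upper: "w \<in> double \<Longrightarrow> 0 < Im (proj w)"
  using height_nonneg[of "Re w"] by (auto simp: double_def add_nonneg_pos add_pos_nonneg)

lemma norm_proj_sq:
  "(norm (proj w - of_real a))\<^sup>2 = (Re w - a)\<^sup>2 + (\<bar>Im w\<bar> + height (Re w))\<^sup>2"
  by (simp add: cmod_power2)

lemma norm_proj_real:
  assumes "Im w = 0" "p n < Re w" "Re w < q n"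
  shows "norm (proj w - of_real (mid n)) = rad n"
proof -
  have "(norm (proj w - of_real (mid n)))\<^sup>2 = (rad n)\<^sup>2"
    unfolding norm_proj_sq using assms by (simp add: height_sq)
  then show ?thesis using rad_pos[of n] by (simp add: power2_eq_iff_nonneg)
qed

text \<open>Over gap \<open>n\<close> the point is lifted strictly above the arc; elsewhere the
  horizontal distance to \<open>mid n\<close> is already at least \<open>rad n\<close>, and the
  positive height does the rest. With \<open>norm_chart_map_le\<close> this separates the chart
  images of the two sheets.\<close>

lemma norm_proj_gt:
  assumes "Im w \<noteq> 0"
  shows "rad n < norm (proj w - of_real (mid n))"
proof -
  let ?x = "Re w" and ?y = "\<bar>Im w\<bar>"
  have y: "0 < ?y" using assms by simp
  have "(rad n)\<^sup>2 < (?x - mid n)\<^sup>2 + (?y + height ?x)\<^sup>2"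
  proof (cases "p n < ?x \<and> ?x < q n")
    case True
    have "(height ?x)\<^sup>2 < (?y + height ?x)\<^sup>2"
      using y height_nonneg by (intro power_strict_mono) auto
    then show ?thesis using height_sq(1)[of n ?x] True by linarith
  next
    case False
    then have "rad n \<le> \<bar>?x - mid n\<bar>" by (auto simp: rad_def mid_def field_simps abs_if)
    then have "(rad n)\<^sup>2 \<le> (?x - mid n)\<^sup>2"
      using rad_pos[of n] by (metis abs_of_pos abs_le_square_iff)
    moreover have "0 < (?y + height ?x)\<^sup>2"
      using y height_nonneg[of ?x] by (simp add: add_pos_nonneg)
    ultimately show ?thesis by linarith
  qed
  then have "(rad n)\<^sup>2 < (norm (proj w - of_real (mid n)))\<^sup>2"
    by (simp add: norm_proj_sq)
  then show ?thesis by (rule power2_less_imp_less) simp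
qed

lemma norm_proj_ge:
  assumes "w \<in> slit n"
  shows "rad n \<le> norm (proj w - of_real (mid n))"
  using assms norm_proj_gt[of w n] norm_proj_real[of w n] by (cases "Im w = 0") (auto simp: slit_def)

lemma proj_neq_mid:
  assumes "w \<in> slit n"
  shows "proj w \<noteq> of_real (mid n)"
  using norm_proj_ge[OF assms] rad_pos[of n] by auto

lemma chart_map_upper_sheet:
  assumes "w \<in> slit n" "0 \<le> Im w"
  shows "chart_map n w = proj w"
proof (cases "Im w = 0")
  case True
  then show ?thesis
    using inversion_fixed[OF norm_proj_real rad_pos] assms by (simp add: chart_map_def slit_def)
qed (use assms in \<open>simp add: chart_map_def\<close>)

lemma chart_map_upper:
  assumes "w \<in> slit n"
  shows "0 < Im (chart_map n w)"
proof -
  have "0 < Im (proj w)" using assms slit_subset proj_upper by blast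
  then show ?thesis
    using rad_pos[of n] proj_neq_mid[OF assms] by (auto simp: chart_map_def Im_inversion simp del: Im_proj)
qed

lemma proj_inj: "proj v = proj w \<Longrightarrow> Re v = Re w \<and> \<bar>Im v\<bar> = \<bar>Im w\<bar>"
  by (auto simp: complex_eq_iff)

lemma norm_chart_map_le:
  assumes "w \<in> slit n" "Im w \<le> 0"
  shows "norm (chart_map n w - of_real (mid n)) \<le> rad n"
proof -
  have "(rad n)\<^sup>2 \<le> rad n * norm (proj w - of_real (mid n))"
    using norm_proj_ge[OF assms(1)] rad_pos[of n] by (simp add: power2_eq_square)
  then show ?thesis
    using assms proj_neq_mid[OF assms(1)] by (simp add: chart_map_def norm_inversion divide_le_eq)
qed

lemma inj_chart_map: "inj_on (chart_map n) (slit n)"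
proof (rule inj_onI)
  fix v w assume vw: "v \<in> slit n" "w \<in> slit n" "chart_map n v = chart_map n w"
  have *: "False" if "v \<in> slit n" "Im v \<le> 0" "0 < Im w" "chart_map n v = chart_map n w" for v w
    using norm_chart_map_le[OF that(1,2)] norm_proj_gt[of w n] that(3,4) by (simp add: chart_map_def)
  consider "0 < Im v" "0 < Im w" | "Im v \<le> 0" "Im w \<le> 0"
    using *[of v w] *[of w v] vw by force
  then show "v = w"
  proof cases
    case 1
    then have "proj v = proj w" using vw by (simp add: chart_map_def)
    from proj_inj[OF this] 1 show ?thesis by (intro complex_eqI) auto
  next
    case 2
    then have "inversion (mid n) (rad n) (inversion (mid n) (rad n) (proj v)) =
        inversion (mid n) (rad n) (inversion (mid n) (rad n) (proj w))"
      using vw by (simp add: chart_map_def)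
    then have "proj v = proj w"
      using rad_pos[of n] proj_neq_mid vw by (simp add: inversion_involution)
    from proj_inj[OF this] 2 show ?thesis by (intro complex_eqI) auto
  qed
qed

lemma continuous_proj: "continuous_on S proj"
proof -
  have "continuous_on S (\<lambda>w. height (Re w))"
    by (rule continuous_on_compose2[OF continuous_height[of UNIV]]) (auto intro: continuous_intros)
  then have "continuous_on S (\<lambda>w. of_real (Re w) + \<i> * of_real (\<bar>Im w\<bar> + height (Re w)))"
    by (intro continuous_intros)
  then show ?thesis by (simp add: proj_def[abs_def] Complex_eq)
qed

lemma continuous_inversion: "continuous_on {z. z \<noteq> of_real c} (inversion c r)"
  using has_derivative_inversion has_derivative_continuous
  by (intro continuous_at_imp_continuous_on) blast

lemma continuous_chart_map: "continuous_on (slit n) (chart_map n)"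
  unfolding chart_map_def
proof (rule continuous_on_cases_le)
  show "continuous_on {t \<in> slit n. Im t \<le> 0} (\<lambda>w. inversion (mid n) (rad n) (proj w))"
    by (rule continuous_on_compose2[OF continuous_inversion continuous_proj])
      (auto simp: proj_neq_mid)
  show "inversion (mid n) (rad n) (proj t) = proj t" if "t \<in> slit n" "Im t = 0" for t
    using inversion_fixed[OF norm_proj_real rad_pos] that by (simp add: slit_def)
qed (auto intro: continuous_proj continuous_intros)

lemma open_slit: "open (slit n)"
proof -
  have "slit n = {w. 0 < Im w} \<union> {w. Im w < 0} \<union> ({w. p n < Re w} \<inter> {w. Re w < q n})"
    by (auto simp: slit_def)
  then show ?thesis
    by (auto intro!: open_Un open_Int simp: open_halfspace_Im_gt open_halfspace_Im_lt open_halfspace_Re_gt open_halfspace_Re_lt)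
qed

text \<open>In the coordinate \<open>w\<close> the chart maps are not smooth, since
  \<open>height\<close> has vertical tangents at the ends of the gaps. The coordinate
  \<open>w\<close> only labels points, and openness comes from invariance of domain.\<close>

lemma open_chart_map: "open V \<Longrightarrow> V \<subseteq> slit n \<Longrightarrow> open (chart_map n ` V)"
  by (rule invariance_of_domain)
    (auto intro: continuous_on_subset[OF continuous_chart_map] inj_on_subset[OF inj_chart_map])

lemma homeomorphic_chart_map:
  "homeomorphic_map (top_of_set (slit n)) (top_of_set (chart_map n ` slit n)) (chart_map n)"
proof (rule bijective_open_imp_homeomorphic_map)
  show "open_map (top_of_set (slit n)) (top_of_set (chart_map n ` slit n)) (chart_map n)"
    unfolding open_map_def
  proof (intro allI impI)
    fix V assume "openin (top_of_set (slit n)) V"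
    then have "open V" "V \<subseteq> slit n"
      using open_slit openin_open_eq by blast+
    then show "openin (top_of_set (chart_map n ` slit n)) (chart_map n ` V)"
      using open_chart_map by (simp add: openin_open_eq[OF open_chart_map[OF open_slit order_refl]] image_mono)
  qed
qed (use continuous_chart_map inj_chart_map in auto)

text \<open>Star-shaped about the midpoint of the gap: a segment from there to a point off the real
  axis leaves the axis at once.\<close>

lemma connected_slit: "connected (slit n)"
proof (rule starlike_imp_connected, unfold starlike_def, intro bexI ballI subsetI)
  show mid: "of_real (mid n) \<in> slit n"
    using p_less_q[of n] by (simp add: slit_def mid_def)
  fix x y assume x: "x \<in> slit n" and "y \<in> closed_segment (of_real (mid n)) x"
  then obtain u where u: "0 \<le> u" "u \<le> 1" "y = (1 - u) *\<^sub>R of_real (mid n) + u *\<^sub>R x"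
    by (auto simp: closed_segment_def)
  show "y \<in> slit n"
  proof (cases "u = 0 \<or> Im x = 0")
    case True
    show ?thesis
    proof (cases "u = 0")
      case True
      then show ?thesis using u mid by simp
    next
      case False
      then have x': "Im x = 0" "p n < Re x" "Re x < q n" using True x by (auto simp: slit_def)
      have "(1 - u) * mid n + u * Re x \<in> {p n<..<q n}"
        using convexD[OF convex_real_interval(8)[of "p n" "q n"], of "mid n" "Re x" "1 - u" u] u x' p_less_q[of n]
        by (auto simp: mid_def)
      then show ?thesis using u by (auto simp: slit_def)
    qed
  next
    case False
    then show ?thesis using u by (simp add: slit_def)
  qed
qed

lemma connected_double: "connected double"
  unfolding Union_slit[symmetric]
proof (rule connected_Union)
  have "\<i> \<in> \<Inter> (range slit)" by (auto simp: slit_def)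
  then show "\<Inter> (range slit) \<noteq> {}" by blast
qed (auto simp: connected_slit)

end

section \<open>The doubled surface as a Riemannian manifold\<close>

context gap_sequence
begin

text \<open>Points are singletons \<open>{w}\<close>, since the point type in the theorem is
  \<open>complex set\<close>; \<open>the_elem\<close> identifies them with points of the
  \<open>w\<close>-plane.\<close>

definition chart :: "nat \<Rightarrow> (complex set, complex) chart" where
  "chart n = ((\<lambda>w. {w}) ` slit n, chart_map n \<circ> the_elem)"

definition surface :: "(complex set, complex) riemannian" where
  "surface = \<lparr>rtop = pullback_topology ((\<lambda>w. {w}) ` double) the_elem euclidean,
     atlas = range chart, tensor = (\<lambda>_. hyp_metric)\<rparr>"

lemma points_surface: "points surface = (\<lambda>w. {w}) ` double"
  by (auto simp: surface_def topspace_pullback_topology)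

lemma atlas_surface: "atlas surface = range chart"
  and tensor_surface: "tensor surface c = hyp_metric"
  by (simp_all add: surface_def)

lemma chart_dom_chart: "chart_dom (chart n) = (\<lambda>w. {w}) ` slit n"
  and coord_chart: "coord (chart n) {w} = chart_map n w"
  and coord_image_chart: "coord (chart n) ` (\<lambda>w. {w}) ` V = chart_map n ` V"
  by (auto simp: chart_def image_image)

lemma continuous_singleton: "continuous_map (top_of_set double) (rtop surface) (\<lambda>w. {w})"
proof -
  have "continuous_map (top_of_set double) euclidean (the_elem \<circ> (\<lambda>w. {w}))"
    by (simp add: o_def)
  then show ?thesis
    unfolding surface_def riemannian.simps by (rule continuous_map_pullback') auto
qed

lemma homeomorphic_the_elem: "homeomorphic_map (rtop surface) (top_of_set double) the_elem"
proof -
  have "homeomorphic_maps (rtop surface) (top_of_set double) the_elem (\<lambda>w. {w})"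
    unfolding homeomorphic_maps_def
  proof (intro conjI continuous_singleton)
    have "continuous_map (rtop surface) euclidean (id \<circ> the_elem)"
      unfolding surface_def riemannian.simps by (rule continuous_map_pullback) simp
    then show "continuous_map (rtop surface) (top_of_set double) the_elem"
      by (auto simp: continuous_map_in_subtopology points_surface)
  qed (auto simp: points_surface)
  then show ?thesis using homeomorphic_map_maps by blast
qed

lemma homeomorphic_space_double: "rtop surface homeomorphic_space top_of_set double"
  using homeomorphic_the_elem homeomorphic_map_imp_homeomorphic_space by blast

lemma openin_surface:
  assumes "open V" "V \<subseteq> double"
  shows "openin (rtop surface) ((\<lambda>w. {w}) ` V)"
  unfolding surface_def riemannian.simps openin_pullback_topology
  using assms by (intro exI[of _ V]) auto

lemma homeomorphic_chart:
  "homeomorphic_map (subtopology (rtop surface) (chart_dom (chart n)))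
     (top_of_set (coord (chart n) ` chart_dom (chart n))) (coord (chart n))"
proof -
  have "homeomorphic_map (subtopology (rtop surface) (chart_dom (chart n)))
      (subtopology (top_of_set double) (slit n)) the_elem"
    by (rule homeomorphic_map_subtopologies[OF homeomorphic_the_elem])
      (use slit_subset[of n] in \<open>force simp: points_surface chart_dom_chart image_iff\<close>)
  moreover have "subtopology (top_of_set double) (slit n) = top_of_set (slit n)"
    using slit_subset[of n] by (simp add: subtopology_subtopology Int_absorb1)
  ultimately show ?thesis
    using homeomorphic_map_compose[OF _ homeomorphic_chart_map[of n]]
    by (simp add: chart_dom_chart coord_image_chart) (simp add: chart_def)
qed

lemma chart_overlap: "chart_dom (chart m) \<inter> chart_dom (chart n) = (\<lambda>w. {w}) ` (slit m \<inter> slit n)"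
  by (auto simp: chart_dom_chart)

lemma transition_chart:
  assumes "w \<in> slit m"
  shows "transition (chart m) (chart n) (chart_map m w) = chart_map n w"
proof -
  have "inj_on (coord (chart m)) (chart_dom (chart m))"
    using inj_chart_map[of m] by (auto simp: inj_on_def chart_dom_chart coord_chart)
  then have "inv_into (chart_dom (chart m)) (coord (chart m)) (coord (chart m) {w}) = {w}"
    by (rule inv_into_f_f) (use assms in \<open>auto simp: chart_dom_chart\<close>)
  then show ?thesis
    by (simp add: transition_def coord_chart)
qed

text \<open>A complex derivative \<open>k\<close> with |k| Im z equal to the new imaginary part is
  an isometry of hyperbolic tangent planes. On the upper sheet all charts coincide with
  \<open>proj\<close>; on the lower one the transition composes the inversions in arcs
  \<open>m\<close> and \<open>n\<close>.\<close>

lemma transition_isometry: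
  assumes "z \<in> chart_map m ` (slit m \<inter> slit n)"
  obtains k where "(transition (chart m) (chart n) has_field_derivative k) (at z)"
    "norm k * Im z = Im (transition (chart m) (chart n) z)"
proof -
  let ?T = "transition (chart m) (chart n)"
  obtain w where w: "w \<in> slit m" "w \<in> slit n" "z = chart_map m w" using assms by blast
  have z: "0 < Im z" using w chart_map_upper by blast
  note isometryI = that
  have id: ?thesis if V: "open V" "V \<subseteq> slit m" "w \<in> V" "\<And>v. v \<in> V \<Longrightarrow> chart_map n v = chart_map m v" for V
  proof (rule isometryI)
    show "(?T has_field_derivative 1) (at z)"
    proof (rule has_field_derivative_transform_within_open[where S = "chart_map m ` V"])
      show "((\<lambda>z. z) has_field_derivative 1) (at z)" by (rule DERIV_ident)
      show "v = ?T v" if v: "v \<in> chart_map m ` V" for v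
      proof -
        obtain u where "u \<in> V" "v = chart_map m u" using v by blast
        then show ?thesis using transition_chart[of u m n] V(2) V(4)[of u] by auto
      qed
    qed (use V open_chart_map w in auto)
    show "norm (1 :: complex) * Im z = Im (?T z)"
      using transition_chart[OF w(1), of n] V w by simp
  qed
  \<comment> \<open>A real \<open>w\<close> in both slits lies in both gaps, so
    \<open>gap_unique\<close> forces \<open>m = n\<close>.\<close>
  consider "m = n" | "m \<noteq> n" "0 < Im w" | "m \<noteq> n" "Im w < 0"
    using w gap_unique[of m "Re w" n] by (force simp: slit_def)
  then show ?thesis
  proof cases
    case 1
    then show ?thesis using id[of "slit m"] open_slit w by simp
  next
    case 2
    show ?thesis
      by (rule id[of "{w. 0 < Im w}"])
        (use 2 in \<open>auto simp: open_halfspace_Im_gt slit_def chart_map_def\<close>)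
  next
    case 3
    let ?I = "\<lambda>z. inversion (mid n) (rad n) (inversion (mid m) (rad m) z)"
    let ?V = "{w. Im w < 0}"
    have V: "?V \<subseteq> slit m" by (auto simp: slit_def)
    have T: "?T v = ?I v" if v: "v \<in> chart_map m ` ?V" for v
    proof -
      obtain u where u: "Im u < 0" "v = chart_map m u" using v by blast
      have "u \<in> slit m" using u by (auto simp: slit_def)
      then show ?thesis
        using u transition_chart[of u m n] rad_pos[of m] proj_neq_mid[of u m]
        by (simp add: chart_map_def inversion_involution)
    qed
    have zm: "z \<noteq> of_real (mid m)" using z by auto
    have zi: "0 < Im (inversion (mid m) (rad m) z)"
      using z rad_pos[of m] zm by (simp add: Im_inversion)
    then have zn: "inversion (mid m) (rad m) z \<noteq> of_real (mid n)" by auto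
    let ?k = "of_real ((rad n)\<^sup>2 * (rad m)\<^sup>2) / ((z - of_real (mid m))\<^sup>2 *
      (cnj (inversion (mid m) (rad m) z - of_real (mid n)))\<^sup>2)"
    have "(?T has_field_derivative ?k) (at z)"
    proof (rule has_field_derivative_transform_within_open[OF inversion_comp_derivative[OF zm zn]])
      show "open (chart_map m ` ?V)" by (rule open_chart_map[OF open_halfspace_Im_lt V])
      show "z \<in> chart_map m ` ?V" using w 3 by blast
    qed (simp add: T)
    moreover have "norm ?k * Im z = Im (?T z)"
      using norm_inversion_comp_derivative[OF z, of "rad m" "rad n" "mid m" "mid n"] rad_pos[of m] T[of z] w 3
      by simp
    ultimately show ?thesis by (rule isometryI)
  qed
qed

lemma smooth_manifold_surface: "smooth_manifold surface"
  unfolding smooth_manifold_def atlas_surface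
proof (intro conjI ballI)
  show "Hausdorff_space (rtop surface)"
    using homeomorphic_Hausdorff_space[OF homeomorphic_space_double] by (simp add: Hausdorff_space_subtopology)
  have "second_countable (euclidean :: complex topology)"
  proof -
    obtain B :: "complex set set" where "countable B" "topological_basis B"
      using ex_countable_basis by blast
    then show ?thesis
      unfolding second_countable_def
      by (metis open_openin topological_basisE topological_basis_open)
  qed
  then show "second_countable (rtop surface)"
    using homeomorphic_space_second_countability[OF homeomorphic_space_double] second_countable_subtopology by blast
  show "(\<Union>c\<in>range chart. chart_dom c) = points surface"
    unfolding points_surface Union_slit[symmetric] by (auto simp: chart_dom_chart)
  fix c assume "c \<in> range chart"
  then obtain m where c: "c = chart m" by blast
  show "openin (rtop surface) (chart_dom c)"
    unfolding c chart_dom_chart by (rule openin_surface[OF open_slit slit_subset])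
  show "open (coord c ` chart_dom c)"
    unfolding c chart_dom_chart coord_image_chart by (rule open_chart_map[OF open_slit order_refl])
  show "homeomorphic_map (subtopology (rtop surface) (chart_dom c))
      (top_of_set (coord c ` chart_dom c)) (coord c)"
    unfolding c by (rule homeomorphic_chart)
  fix c' assume "c' \<in> range chart"
  then obtain n where c': "c' = chart n" by blast
  have op: "open (chart_map m ` (slit m \<inter> slit n))"
    by (rule open_chart_map) (auto intro: open_slit)
  show "Cinfinity_on (transition c c') (coord c ` (chart_dom c \<inter> chart_dom c'))"
    unfolding c c' chart_overlap coord_image_chart
  proof (rule holomorphic_Cinfinity_on[OF _ op])
    show "transition (chart m) (chart n) holomorphic_on chart_map m ` (slit m \<inter> slit n)"
      unfolding holomorphic_on_open[OF op] using transition_isometry by metis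
  qed
qed

lemma riemannian_metric_surface: "riemannian_metric surface"
  unfolding riemannian_metric_def atlas_surface tensor_surface
proof (intro conjI ballI allI impI)
  fix c assume "c \<in> range chart"
  then obtain m where c: "c = chart m" by blast
  have im: "coord c ` chart_dom c = chart_map m ` slit m"
    unfolding c chart_dom_chart coord_image_chart ..
  show "Cinfinity_on (\<lambda>x. hyp_metric x u v) (coord c ` chart_dom c)" for u v
    unfolding hyp_metric_def im
    by (rule Cinfinity_on_Im_power[OF open_chart_map[OF open_slit order_refl]])
      (use chart_map_upper in force)
  fix x assume "x \<in> coord c ` chart_dom c"
  then have x: "0 < Im x" unfolding im using chart_map_upper by blast
  show "bilinear (hyp_metric x)" by (rule bilinear_hyp_metric)
  show "hyp_metric x u v = hyp_metric x v u" for u v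
    by (simp add: hyp_metric_def inner_commute)
  show "0 < hyp_metric x u u" if "u \<noteq> 0" for u
    using that x by (simp add: hyp_metric_def)
next
  fix c c' z u v assume "c \<in> range chart" "c' \<in> range chart" and z: "z \<in> coord c ` (chart_dom c \<inter> chart_dom c')"
  then obtain m n where c: "c = chart m" "c' = chart n" by blast
  have z': "z \<in> chart_map m ` (slit m \<inter> slit n)"
    using z unfolding c chart_overlap coord_image_chart .
  obtain k where k: "(transition c c' has_field_derivative k) (at z)"
    "norm k * Im z = Im (transition c c' z)"
    unfolding c by (rule transition_isometry[OF z'])
  have z0: "0 < Im z" using z' chart_map_upper by blast
  have "0 < Im (transition c c' z)"
    using z' transition_chart chart_map_upper unfolding c by auto
  then have k0: "k \<noteq> 0" using k(2) by auto
  have "frechet_derivative (transition c c') (at z) = (*) k"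
    using frechet_derivative_at[OF k(1)[unfolded has_field_derivative_def]] by simp
  moreover have "(k * u) \<bullet> (k * v) = (norm k)\<^sup>2 * (u \<bullet> v)"
    unfolding cmod_power2 by (simp add: inner_complex_def power2_eq_square algebra_simps)
  ultimately show "hyp_metric z u v = hyp_metric (transition c c' z)
      (frechet_derivative (transition c c') (at z) u) (frechet_derivative (transition c c') (at z) v)"
    using k0 z0 by (simp add: hyp_metric_def k(2)[symmetric] power_mult_distrib)
qed

lemma riemannian_manifold_surface: "riemannian_manifold surface"
  unfolding riemannian_manifold_def
proof (intro conjI smooth_manifold_surface riemannian_metric_surface)
  have "connected_space (top_of_set double)"
    using connected_double connectedin_def[of euclidean double] by simp
  then show "connected_space (rtop surface)"
    using homeomorphic_connected_space[OF homeomorphic_space_double] by blast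
qed

sublocale half_plane_atlas surface
  by unfold_locales
    (auto simp: riemannian_manifold_surface atlas_surface tensor_surface chart_dom_chart coord_chart chart_map_upper)

end

section \<open>Distances in the doubled surface\<close>

context gap_sequence
begin

lemma continuous_the_elem: "continuous_map (rtop surface) euclidean the_elem"
  using homeomorphic_imp_continuous_map[OF homeomorphic_the_elem] continuous_map_into_fulltopology by blast

lemma curve_in_double:
  assumes "piecewise_C1_curve surface \<gamma>"
  shows "continuous_on {0..1} (\<lambda>t. the_elem (\<gamma> t))"
    and "\<And>t. t \<in> {0..1} \<Longrightarrow> \<gamma> t = {the_elem (\<gamma> t)} \<and> the_elem (\<gamma> t) \<in> double"
proof -
  have p: "continuous_map (top_of_set {0..1}) (rtop surface) \<gamma>"
    using assms by (simp add: piecewise_C1_curve_def pathin_def)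
  show "continuous_on {0..1} (\<lambda>t. the_elem (\<gamma> t))"
    using continuous_map_compose[OF p continuous_the_elem] by (simp add: o_def)
  show "\<gamma> t = {the_elem (\<gamma> t)} \<and> the_elem (\<gamma> t) \<in> double" if "t \<in> {0..1}" for t
  proof -
    have "\<gamma> t \<in> points surface"
      using funcset_mem[OF continuous_map_funspace[OF p], of t] that by simp
    then obtain w where "w \<in> double" "\<gamma> t = {w}" unfolding points_surface by blast
    then show ?thesis by simp
  qed
qed

lemma curve_crosses:
  assumes "piecewise_C1_curve surface \<gamma>" "0 \<le> a" "a \<le> b" "b \<le> 1"
    and "Im (the_elem (\<gamma> a)) * Im (the_elem (\<gamma> b)) \<le> 0"
  obtains s where "a \<le> s" "s \<le> b" "Im (the_elem (\<gamma> s)) = 0"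
proof -
  have c: "continuous_on {a..b} (\<lambda>t. Im (the_elem (\<gamma> t)))"
    by (intro continuous_intros continuous_on_subset[OF curve_in_double(1)[OF assms(1)]])
      (use assms in auto)
  consider "Im (the_elem (\<gamma> a)) \<le> 0" "0 \<le> Im (the_elem (\<gamma> b))"
    | "Im (the_elem (\<gamma> b)) \<le> 0" "0 \<le> Im (the_elem (\<gamma> a))"
    using assms(5) by (auto simp: mult_le_0_iff)
  then show ?thesis
    using IVT'[of "\<lambda>t. Im (the_elem (\<gamma> t))" a 0 b] IVT2'[of "\<lambda>t. Im (the_elem (\<gamma> t))" b 0 a]
      c assms(3) that by cases blast+
qed

text \<open>Folding by \<open>proj\<close> does not increase lengths, as far as nonexpansive
  functions can tell. On the upper sheet a chart is \<open>proj\<close> itself; on the lower sheet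
  it is \<open>proj\<close> followed by an inversion, which is undone by testing with
  \<open>\<phi>\<close> composed with that inversion.\<close>

lemma length_lower_bound:
  assumes \<gamma>: "piecewise_C1_curve surface \<gamma>" and lh: "0 \<le> l" "l \<le> h" "h \<le> 1"
    and \<phi>: "half_plane_nonexpansive \<phi>"
  shows "ennreal \<bar>\<phi> (proj (the_elem (\<gamma> h))) - \<phi> (proj (the_elem (\<gamma> l)))\<bar>
    \<le> (\<integral>\<^sup>+t\<in>{l..h}. ennreal (speed surface \<gamma> t) \<partial>lborel)"
proof -
  let ?g = "\<lambda>t. the_elem (\<gamma> t)"
  let ?P = "\<lambda>a b. ennreal \<bar>\<phi> (proj (?g b)) - \<phi> (proj (?g a))\<bar>
    \<le> (\<integral>\<^sup>+t\<in>{a..b}. ennreal (speed surface \<gamma> t) \<partial>lborel)"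
  have p: "pathin (rtop surface) \<gamma>" using \<gamma> by (simp add: piecewise_C1_curve_def)
  have trans: "?P a c" if "0 \<le> a" "a \<le> b" "b \<le> c" "c \<le> 1" "?P a b" "?P b c" for a b c
  proof -
    have "ennreal \<bar>\<phi> (proj (?g c)) - \<phi> (proj (?g a))\<bar>
        \<le> ennreal (\<bar>\<phi> (proj (?g b)) - \<phi> (proj (?g a))\<bar> + \<bar>\<phi> (proj (?g c)) - \<phi> (proj (?g b))\<bar>)"
      by (rule ennreal_leI) linarith
    also have "\<dots> = ennreal \<bar>\<phi> (proj (?g b)) - \<phi> (proj (?g a))\<bar> + ennreal \<bar>\<phi> (proj (?g c)) - \<phi> (proj (?g b))\<bar>"
      by (simp add: ennreal_plus)
    also have "\<dots> \<le> (\<integral>\<^sup>+t\<in>{a..b}. ennreal (speed surface \<gamma> t) \<partial>lborel)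
        + (\<integral>\<^sup>+t\<in>{b..c}. ennreal (speed surface \<gamma> t) \<partial>lborel)"
      using that(5,6) by (rule add_mono)
    finally show ?thesis using speed_integral_split[OF \<gamma> that(1-4)] by simp
  qed
  \<comment> \<open>Only the sheets of the two ends matter: the chart estimate compares end values,
    so the curve may visit the other sheet in between.\<close>
  have same_sheet: "?P a b"
    if I: "0 \<le> a" "a \<le> b" "b \<le> 1" "\<gamma> ` {a..b} \<subseteq> chart_dom (chart n)"
      and sgn: "0 \<le> Im (?g a) \<and> 0 \<le> Im (?g b) \<or> Im (?g a) \<le> 0 \<and> Im (?g b) \<le> 0" for a b n
  proof -
    have c: "chart n \<in> atlas surface" by (simp add: atlas_surface)
    have s: "?g t \<in> slit n" "\<gamma> t = {?g t}" if "t \<in> {a..b}" for t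
    proof -
      have "\<gamma> t \<in> (\<lambda>w. {w}) ` slit n" using I that unfolding chart_dom_chart by blast
      then obtain w where "w \<in> slit n" "\<gamma> t = {w}" by blast
      then show "?g t \<in> slit n" "\<gamma> t = {?g t}" by simp_all
    qed
    have k: "coord (chart n) (\<gamma> t) = chart_map n (?g t)" if "t \<in> {a..b}" for t
      by (subst s(2)[OF that]) (rule coord_chart)
    have ab: "a \<in> {a..b}" "b \<in> {a..b}" using I by auto
    from sgn show ?thesis
    proof
      assume "0 \<le> Im (?g a) \<and> 0 \<le> Im (?g b)"
      then show ?thesis
        using chart_length_lower_bound[OF \<gamma> c I \<phi>] ab
        by (simp add: k chart_map_upper_sheet s(1))
    next
      assume "Im (?g a) \<le> 0 \<and> Im (?g b) \<le> 0"
      then show ?thesis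
        using chart_length_lower_bound[OF \<gamma> c I nonexpansive_inversion[OF \<phi>, of "rad n" "mid n"]]
          ab rad_pos[of n]
        by (simp add: k chart_map_def inversion_involution proj_neq_mid s(1))
    qed
  qed
  show ?thesis
  proof (rule chart_interval_induct[OF p lh, where P = ?P])
    fix a b c assume c: "c \<in> atlas surface" and I: "0 \<le> a" "a \<le> b" "b \<le> 1" "\<gamma> ` {a..b} \<subseteq> chart_dom c"
    obtain n where n: "c = chart n" using c by (auto simp: atlas_surface)
    show "?P a b"
    proof (cases "0 \<le> Im (?g a) * Im (?g b)")
      case True
      then show ?thesis
        by (intro same_sheet[OF I(1-3), of n]) (use I(4) n in \<open>auto simp: zero_le_mult_iff\<close>)
    next
      \<comment> \<open>The ends lie on opposite sheets: cut at a seam point, which counts for both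
        sheets.\<close>
      case False
      then obtain s where s: "a \<le> s" "s \<le> b" "Im (?g s) = 0"
        using curve_crosses[OF \<gamma> I(1-3)] by auto
      have "\<gamma> ` {a..s} \<subseteq> chart_dom (chart n)" "\<gamma> ` {s..b} \<subseteq> chart_dom (chart n)"
        using I(4) s n by auto
      then show ?thesis
        using trans[OF I(1) s(1,2) I(3)] same_sheet[of a s n] same_sheet[of s b n] I s
          linear[of 0 "Im (?g a)"] linear[of 0 "Im (?g b)"] by auto
    qed
  qed (fact trans)
qed

text \<open>The crossing point \<open>w\<close> depends on the curve alone, so the tests before and
  after it can be chosen independently.\<close>

lemma length_crossing:
  assumes "piecewise_C1_curve surface \<gamma>" "\<gamma> 0 = {u}" "\<gamma> 1 = {v}" "Im u * Im v \<le> 0"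
  obtains w where "Im w = 0" "w \<in> double"
    "\<And>\<phi> \<psi>. \<lbrakk>half_plane_nonexpansive \<phi>; half_plane_nonexpansive \<psi>\<rbrakk> \<Longrightarrow>
      ennreal (\<bar>\<phi> (proj w) - \<phi> (proj u)\<bar> + \<bar>\<psi> (proj v) - \<psi> (proj w)\<bar>) \<le> curve_length surface \<gamma>"
proof -
  obtain s where s: "0 \<le> s" "s \<le> 1" "Im (the_elem (\<gamma> s)) = 0"
    using curve_crosses[OF assms(1), of 0 1] assms(2-4) by auto
  show ?thesis
  proof (rule that[of "the_elem (\<gamma> s)"])
    show "the_elem (\<gamma> s) \<in> double" using curve_in_double(2)[OF assms(1), of s] s by auto
    fix \<phi> \<psi> assume \<phi>: "half_plane_nonexpansive \<phi>" and \<psi>: "half_plane_nonexpansive \<psi>"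
    have "ennreal (\<bar>\<phi> (proj (the_elem (\<gamma> s))) - \<phi> (proj u)\<bar> + \<bar>\<psi> (proj v) - \<psi> (proj (the_elem (\<gamma> s)))\<bar>)
        = ennreal \<bar>\<phi> (proj (the_elem (\<gamma> s))) - \<phi> (proj u)\<bar> + ennreal \<bar>\<psi> (proj v) - \<psi> (proj (the_elem (\<gamma> s)))\<bar>"
      by (simp add: ennreal_plus)
    also have "\<dots> \<le> (\<integral>\<^sup>+t\<in>{0..s}. ennreal (speed surface \<gamma> t) \<partial>lborel)
        + (\<integral>\<^sup>+t\<in>{s..1}. ennreal (speed surface \<gamma> t) \<partial>lborel)"
      using length_lower_bound[OF assms(1) order_refl s(1,2) \<phi>]
        length_lower_bound[OF assms(1) s(1,2) order_refl \<psi>] assms(2,3)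
      by (intro add_mono) simp_all
    also have "\<dots> = curve_length surface \<gamma>"
      unfolding curve_length_def by (rule speed_integral_split[OF assms(1)]) (use s in auto)
    finally show "ennreal (\<bar>\<phi> (proj (the_elem (\<gamma> s))) - \<phi> (proj u)\<bar> + \<bar>\<psi> (proj v) - \<psi> (proj (the_elem (\<gamma> s)))\<bar>)
        \<le> curve_length surface \<gamma>" .
  qed (fact s)
qed

lemma point_surface: "{w} \<in> points surface \<longleftrightarrow> w \<in> double"
  by (auto simp: points_surface)

lemma rdist_lower_bound:
  assumes "u \<in> double" "v \<in> double" "half_plane_nonexpansive \<phi>"
  shows "\<bar>\<phi> (proj v) - \<phi> (proj u)\<bar> \<le> rdist surface {u} {v}"
proof (rule rdist_geI)
  fix \<gamma> assume "piecewise_C1_curve surface \<gamma>" "\<gamma> 0 = {u}" "\<gamma> 1 = {v}"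
  then show "ennreal \<bar>\<phi> (proj v) - \<phi> (proj u)\<bar> \<le> curve_length surface \<gamma>"
    using length_lower_bound[of \<gamma> 0 1 \<phi>] assms(3) by (simp add: curve_length_def)
qed (use assms in \<open>auto simp: point_surface\<close>)

lemma rdist_crossing_lower_bound:
  assumes "u \<in> double" "v \<in> double" "Im u * Im v \<le> 0"
    and "half_plane_nonexpansive \<phi>" "half_plane_nonexpansive \<psi>"
    and "\<And>w. \<lbrakk>Im w = 0; w \<in> double\<rbrakk> \<Longrightarrow> L \<le> \<bar>\<phi> (proj w) - \<phi> (proj u)\<bar> + \<bar>\<psi> (proj v) - \<psi> (proj w)\<bar>"
  shows "L \<le> rdist surface {u} {v}"
proof (rule rdist_geI)
  fix \<gamma> assume \<gamma>: "piecewise_C1_curve surface \<gamma>" "\<gamma> 0 = {u}" "\<gamma> 1 = {v}"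
  obtain w where "Im w = 0" "w \<in> double"
    "ennreal (\<bar>\<phi> (proj w) - \<phi> (proj u)\<bar> + \<bar>\<psi> (proj v) - \<psi> (proj w)\<bar>) \<le> curve_length surface \<gamma>"
    using length_crossing[OF \<gamma> assms(3)] assms(4,5) by metis
  then show "ennreal L \<le> curve_length surface \<gamma>"
    using assms(6)[of w] by (meson ennreal_leI order_trans)
qed (use assms in \<open>auto simp: point_surface\<close>)

lemma Re_eq_norms: "Re z = ((norm z)\<^sup>2 - (norm (z - 1))\<^sup>2 + 1) / 2"
  unfolding cmod_power2 by (simp add: power2_eq_square algebra_simps)

text \<open>Testing with ln Im z, ln |z| and ln |z - 1| gives \<open>proj u = proj v\<close>. It
  remains to exclude mirror images off the seam: arbitrarily short curves between them would cross
  at real points \<open>w k\<close> whose projections converge to that of \<open>u\<close>, which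
  would put \<open>u\<close> on the seam.\<close>

lemma rdist_eq_0:
  assumes "u \<in> double" "v \<in> double" "rdist surface {u} {v} = 0"
  shows "u = v"
proof (rule ccontr)
  assume "u \<noteq> v"
  have up: "0 < Im (proj u)" "0 < Im (proj v)" using assms proj_upper by auto
  have n0: "0 < norm (proj w)" "0 < norm (proj w - 1)" if "w \<in> double" for w
    using proj_upper[OF that] by (auto simp: complex_eq_iff)
  note nx = nonexpansive_ln_Im nonexpansive_ln_norm[of 0, simplified] nonexpansive_ln_norm[of 1, simplified]
  have "ln (Im (proj v)) = ln (Im (proj u))" "ln (norm (proj v)) = ln (norm (proj u))"
    "ln (norm (proj v - 1)) = ln (norm (proj u - 1))"
    using rdist_lower_bound[OF assms(1,2) nx(1)] rdist_lower_bound[OF assms(1,2) nx(2)]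
      rdist_lower_bound[OF assms(1,2) nx(3)] assms(3) by simp_all
  then have "Im (proj v) = Im (proj u)" "norm (proj v) = norm (proj u)" "norm (proj v - 1) = norm (proj u - 1)"
    using up n0[OF assms(1)] n0[OF assms(2)] by (auto simp del: Im_proj)
  moreover from this have "Re (proj v) = Re (proj u)"
    by (simp add: Re_eq_norms del: Re_proj)
  ultimately have R: "Re v = Re u" "\<bar>Im v\<bar> = \<bar>Im u\<bar>" "proj v = proj u"
    by (auto simp: complex_eq_iff)
  have uv: "Im u \<noteq> 0" "Im u * Im v \<le> 0"
    using R(1,2) \<open>u \<noteq> v\<close> by (auto simp: complex_eq_iff abs_if mult_le_0_iff split: if_splits)
  have "\<exists>w. Im w = 0 \<and> w \<in> double \<and> (\<forall>\<phi>. half_plane_nonexpansive \<phi> \<longrightarrow>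
      \<bar>\<phi> (proj w) - \<phi> (proj u)\<bar> \<le> inverse (real (Suc k)))" for k
  proof -
    obtain \<gamma> where \<gamma>: "piecewise_C1_curve surface \<gamma>" "\<gamma> 0 = {u}" "\<gamma> 1 = {v}"
      "curve_length surface \<gamma> < ennreal (inverse (real (Suc k)))"
      by (rule short_curve[of "{u}" "{v}" "inverse (real (Suc k))"]) (use assms in \<open>auto simp: point_surface\<close>)
    obtain w where w: "Im w = 0" "w \<in> double"
      "\<And>\<phi> \<psi>. \<lbrakk>half_plane_nonexpansive \<phi>; half_plane_nonexpansive \<psi>\<rbrakk> \<Longrightarrow>
        ennreal (\<bar>\<phi> (proj w) - \<phi> (proj u)\<bar> + \<bar>\<psi> (proj v) - \<psi> (proj w)\<bar>) \<le> curve_length surface \<gamma>"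
      using length_crossing[OF \<gamma>(1-3) uv(2)] by metis
    have "\<bar>\<phi> (proj w) - \<phi> (proj u)\<bar> \<le> inverse (real (Suc k))" if "half_plane_nonexpansive \<phi>" for \<phi>
    proof -
      have "ennreal (\<bar>\<phi> (proj w) - \<phi> (proj u)\<bar> + \<bar>\<phi> (proj v) - \<phi> (proj w)\<bar>) < ennreal (inverse (real (Suc k)))"
        using w(3)[OF that that] \<gamma>(4) by (rule le_less_trans)
      then have "\<bar>\<phi> (proj w) - \<phi> (proj u)\<bar> + \<bar>\<phi> (proj v) - \<phi> (proj w)\<bar> < inverse (real (Suc k))"
        by (subst (asm) ennreal_less_iff) auto
      then show ?thesis by linarith
    qed
    then show ?thesis using w by blast
  qed
  then obtain w where w: "\<And>k. Im (w k) = 0" "\<And>k. w k \<in> double"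
    "\<And>k \<phi>. half_plane_nonexpansive \<phi> \<Longrightarrow> \<bar>\<phi> (proj (w k)) - \<phi> (proj u)\<bar> \<le> inverse (real (Suc k))"
    by metis
  have lim: "(\<lambda>k. \<phi> (proj (w k))) \<longlonglongrightarrow> \<phi> (proj u)" if "half_plane_nonexpansive \<phi>" for \<phi>
  proof (rule Lim_null[THEN iffD2], rule Lim_null_comparison)
    show "\<forall>\<^sub>F k in sequentially. norm (\<phi> (proj (w k)) - \<phi> (proj u)) \<le> inverse (real (Suc k))"
      using w(3)[OF that] by simp
  qed (rule LIMSEQ_inverse_real_of_nat)
  have "(\<lambda>k. exp (ln (Im (proj (w k))))) \<longlonglongrightarrow> exp (ln (Im (proj u)))"
    by (intro tendsto_intros lim[OF nx(1)])
  then have 1: "(\<lambda>k. Im (proj (w k))) \<longlonglongrightarrow> Im (proj u)"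
    using up proj_upper[OF w(2)] by (simp del: Im_proj)
  have "(\<lambda>k. exp (ln (norm (proj (w k))))) \<longlonglongrightarrow> exp (ln (norm (proj u)))"
    by (intro tendsto_intros lim[OF nx(2)])
  then have 2: "(\<lambda>k. norm (proj (w k))) \<longlonglongrightarrow> norm (proj u)"
    using n0 w(2) assms(1) by simp
  have "(\<lambda>k. exp (ln (norm (proj (w k) - 1)))) \<longlonglongrightarrow> exp (ln (norm (proj u - 1)))"
    by (intro tendsto_intros lim[OF nx(3)])
  then have 3: "(\<lambda>k. norm (proj (w k) - 1)) \<longlonglongrightarrow> norm (proj u - 1)"
    using n0 w(2) assms(1) by simp
  have "(\<lambda>k. Re (proj (w k))) \<longlonglongrightarrow> Re (proj u)"
    unfolding Re_eq_norms[of "proj _"] by (intro tendsto_intros 2 3) simp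
  then have "(\<lambda>k. Re (w k)) \<longlonglongrightarrow> Re u" by simp
  then have "(\<lambda>k. height (Re (w k))) \<longlonglongrightarrow> height (Re u)"
    by (rule continuous_on_tendsto_compose[OF continuous_height[of UNIV]]) auto
  moreover have "(\<lambda>k. height (Re (w k))) \<longlonglongrightarrow> Im (proj u)"
    using 1 w(1) by simp
  \<comment> \<open>But \<open>Im (proj u)\<close> exceeds \<open>height (Re u)\<close> by the
    absolute value of \<open>Im u\<close>.\<close>
  ultimately have "height (Re u) = Im (proj u)"
    using LIMSEQ_unique by blast
  then show False using uv(1) by simp
qed

section \<open>Completeness\<close>

lemma Metric_space_surface: "Metric_space (points surface) (rdist surface)"
proof
  show "rdist surface x y = 0 \<longleftrightarrow> x = y" if "x \<in> points surface" "y \<in> points surface" for x y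
    using that rdist_eq_0 rdist_self by (auto simp: points_surface)
qed (auto simp: rdist_nonneg rdist_commute intro: rdist_triangle)

lemma rdist_tendsto_0:
  assumes "w \<longlonglongrightarrow> v" "v \<in> double"
  shows "(\<lambda>k. rdist surface {w k} {v}) \<longlonglongrightarrow> 0"
proof (rule LIMSEQ_I)
  fix e :: real assume "0 < e"
  then obtain N where N: "openin (rtop surface) N" "{v} \<in> N" "\<And>y. y \<in> N \<Longrightarrow> rdist surface {v} y \<le> e / 2"
    using rdist_near[of "{v}" "e / 2"] assms(2) by (auto simp: point_surface)
  obtain V where V: "open V" "N = the_elem -` V \<inter> (\<lambda>w. {w}) ` double"
    using N(1) unfolding surface_def riemannian.simps openin_pullback_topology by auto
  obtain n where n: "v \<in> slit n" using assms(2) Union_slit by blast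
  have "\<forall>\<^sub>F k in sequentially. w k \<in> V \<inter> slit n"
    by (rule topological_tendstoD[OF assms(1)]) (use V N(2) n open_slit in auto)
  then have "\<forall>\<^sub>F k in sequentially. rdist surface {w k} {v} < e"
  proof eventually_elim
    case (elim k)
    then have "{w k} \<in> N" using V slit_subset by auto
    then show ?case using N(3) \<open>0 < e\<close> by (force simp: rdist_commute[of "{w k}"])
  qed
  then show "\<exists>k0. \<forall>k\<ge>k0. norm (rdist surface {w k} {v} - 0) < e"
    by (simp add: eventually_sequentially rdist_nonneg)
qed

text \<open>\<open>double\<close> is not closed in the plane, so the danger is convergence to a real
  point outside the gaps. Testing with ln Im z keeps \<open>Im (proj (w k))\<close> away from 0 on a
  tail, and ln |z| bounds the tail; a subsequential limit therefore belongs to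
  \<open>double\<close>.\<close>

lemma complete_surface: "complete_riemannian surface"
  unfolding complete_riemannian_def
proof (intro conjI riemannian_manifold_surface)
  interpret S: Metric_space "points surface" "rdist surface" by (rule Metric_space_surface)
  show "S.mcomplete"
    unfolding S.mcomplete_def
  proof (intro allI impI)
    fix \<sigma> assume C: "S.MCauchy \<sigma>"
    have "range \<sigma> \<subseteq> points surface" using C by (simp add: S.MCauchy_def)
    then have "\<forall>k. \<exists>w. \<sigma> k = {w} \<and> w \<in> double"
      unfolding points_surface by blast
    then obtain w where w: "\<And>k. \<sigma> k = {w k}" "\<And>k. w k \<in> double" by metis
    obtain N where N: "\<And>k. N \<le> k \<Longrightarrow> rdist surface (\<sigma> N) (\<sigma> k) < 1"
      using C unfolding S.MCauchy_def by (meson order_refl zero_less_one)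
    have near: "\<bar>\<phi> (proj (w k)) - \<phi> (proj (w N))\<bar> \<le> 1" if "N \<le> k" "half_plane_nonexpansive \<phi>" for k \<phi>
      using rdist_lower_bound[OF w(2) w(2) that(2), of k N] N[OF that(1)] w(1) by simp
    let ?m = "exp (ln (Im (proj (w N))) - 1)" and ?R = "exp (ln (norm (proj (w N))) + 1)"
    have up: "0 < Im (proj (w k))" for k using proj_upper w(2) by blast
    have m: "?m \<le> Im (proj (w k))" if "N \<le> k" for k
    proof -
      have "ln (Im (proj (w N))) - 1 \<le> ln (Im (proj (w k)))"
        using near[OF that nonexpansive_ln_Im] by linarith
      then show ?thesis using ln_ge_iff[OF up] by blast
    qed
    have R: "norm (proj (w k)) \<le> ?R" if "N \<le> k" for k
    proof -
      have "0 < norm (proj (w k))" using up[of k] by (auto simp del: Im_proj)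
      moreover have "exp (ln (norm (proj (w k)))) \<le> ?R"
        using near[OF that nonexpansive_ln_norm[of 0, simplified]] by simp
      ultimately show ?thesis by simp
    qed
    have "norm (w (N + k)) \<le> 2 * ?R" for k
    proof -
      have "\<bar>Re (w (N + k))\<bar> \<le> ?R" "\<bar>Im (w (N + k))\<bar> \<le> ?R"
        using R[of "N + k"] abs_Re_le_cmod[of "proj (w (N + k))"] abs_Im_le_cmod[of "proj (w (N + k))"]
          height_nonneg[of "Re (w (N + k))"] by auto
      then show ?thesis using cmod_le[of "w (N + k)"] by linarith
    qed
    then have "w (N + k) \<in> cball 0 (2 * ?R)" for k by simp
    from compact_cball[of "0 :: complex" "2 * ?R", unfolded compact_def, rule_format,
        of "\<lambda>k. w (N + k)", OF this]
    obtain v r where v: "strict_mono (r :: nat \<Rightarrow> nat)" "((\<lambda>k. w (N + k)) \<circ> r) \<longlonglongrightarrow> v"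
      by metis
    have "(\<lambda>k. Im (proj (w (N + r k)))) \<longlonglongrightarrow> Im (proj v)"
      by (intro tendsto_intros continuous_on_tendsto_compose[OF continuous_proj[of UNIV]])
        (use v(2) in \<open>auto simp: o_def\<close>)
    then have "?m \<le> Im (proj v)"
      by (rule LIMSEQ_le_const) (use m in \<open>auto simp del: Im_proj\<close>)
    moreover have "0 < ?m" by simp
    ultimately have "0 < Im (proj v)" by linarith
    then have vd: "v \<in> double" by (auto simp: double_def)
    have mono: "strict_mono (\<lambda>k. N + r k)"
      using v(1) by (simp add: strict_mono_def)
    have "limitin S.mtopology (\<sigma> \<circ> (\<lambda>k. N + r k)) {v} sequentially"
      unfolding S.limitin_metric_dist_null
      using rdist_tendsto_0[OF v(2) vd] vd w by (simp add: point_surface o_def)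
    then show "\<exists>x. limitin S.mtopology \<sigma> x sequentially"
      using S.MCauchy_convergent_subsequence[OF C mono] by blast
  qed
qed

lemma hyperbolic_surface: "hyperbolic_surface surface"
  by (simp add: hyperbolic_surface_def complete_surface constant_curvature)

end

section \<open>Two vertical rays\<close>

context gap_sequence
begin

text \<open>The curve \<open>\<zeta>\<close> is drawn in the half-plane and lifted to the upper
  sheet. Its mirror image under \<open>cnj\<close> lies on the lower sheet, where chart
  \<open>n\<close> sees \<open>\<zeta>\<close> inverted in arc \<open>n\<close>; inversion being an
  isometry, both lifts obey the same bound.\<close>

lemma sheet_curve:
  assumes \<zeta>: "\<And>t. (\<zeta> has_vector_derivative \<zeta>' t) (at t)" "continuous_on UNIV \<zeta>'" "\<And>t. 0 < Im (\<zeta> t)"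
    and K: "0 \<le> K" "\<And>t. 0 \<le> t \<Longrightarrow> t \<le> 1 \<Longrightarrow> norm (\<zeta>' t) \<le> K * Im (\<zeta> t)"
    and sheet: "\<And>t. 0 \<le> t \<Longrightarrow> t \<le> 1 \<Longrightarrow> \<exists>w\<in>slit n. 0 \<le> Im w \<and> proj w = \<zeta> t"
    and u: "u \<in> slit n" "0 \<le> Im u" "proj u = \<zeta> 0"
    and v: "v \<in> slit n" "0 \<le> Im v" "proj v = \<zeta> 1"
  shows "rdist surface {u} {v} \<le> K" "rdist surface {cnj u} {cnj v} \<le> K"
proof -
  have c: "chart n \<in> atlas surface" by (simp add: atlas_surface)
  have im: "coord (chart n) ` chart_dom (chart n) = chart_map n ` slit n"
    unfolding chart_dom_chart coord_image_chart ..
  have \<zeta>c: "continuous_on UNIV \<zeta>"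
    by (meson \<zeta>(1) continuous_at_imp_continuous_on has_vector_derivative_continuous)
  show "rdist surface {u} {v} \<le> K"
  proof (rule chart_curve_rdist[OF c \<zeta>(1,2) _ K])
    show "\<zeta> ` {0..1} \<subseteq> coord (chart n) ` chart_dom (chart n)"
      unfolding im
    proof
      fix z assume "z \<in> \<zeta> ` {0..1}"
      then obtain w where "w \<in> slit n" "0 \<le> Im w" "proj w = z" using sheet by force
      then show "z \<in> chart_map n ` slit n" using chart_map_upper_sheet by (metis image_eqI)
    qed
  qed (use u v in \<open>auto simp: chart_dom_chart coord_chart chart_map_upper_sheet\<close>)
  let ?I = "inversion (mid n) (rad n)"
  have cnj_slit: "cnj w \<in> slit n" if "w \<in> slit n" for w using that by (simp add: slit_def)
  have cnj_chart: "chart_map n (cnj w) = ?I (proj w)" if "0 \<le> Im w" for w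
    using that by (simp add: chart_map_def proj_def)
  define \<eta> where "\<eta> t = - of_real ((rad n)\<^sup>2) * cnj (\<zeta>' t) / (cnj (\<zeta> t - of_real (mid n)))\<^sup>2" for t
  have ne: "\<zeta> t \<noteq> of_real (mid n)" for t using \<zeta>(3)[of t] by auto
  have ne': "cnj (\<zeta> t - of_real (mid n)) \<noteq> 0" for t
    unfolding complex_cnj_zero_iff using ne[of t] by simp
  show "rdist surface {cnj u} {cnj v} \<le> K"
  proof (rule chart_curve_rdist[OF c, where \<zeta> = "?I \<circ> \<zeta>" and \<zeta>' = \<eta>])
    show "((?I \<circ> \<zeta>) has_vector_derivative \<eta> t) (at t)" for t
    proof -
      have "((?I \<circ> \<zeta>) has_derivative (\<lambda>v. - of_real ((rad n)\<^sup>2) * cnj v / (cnj (\<zeta> t - of_real (mid n)))\<^sup>2)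
          \<circ> (\<lambda>h. h *\<^sub>R \<zeta>' t)) (at t)"
        by (rule diff_chain_at) (use \<zeta>(1) has_derivative_inversion[OF ne] in \<open>auto simp: has_vector_derivative_def\<close>)
      moreover have "(\<lambda>v. - of_real ((rad n)\<^sup>2) * cnj v / (cnj (\<zeta> t - of_real (mid n)))\<^sup>2)
          \<circ> (\<lambda>h. h *\<^sub>R \<zeta>' t) = (\<lambda>h. h *\<^sub>R \<eta> t)"
        by (auto simp: \<eta>_def scaleR_conv_of_real)
      ultimately show ?thesis by (simp add: has_vector_derivative_def)
    qed
    show "continuous_on UNIV \<eta>"
      unfolding \<eta>_def using ne'
      by (intro continuous_intros \<zeta>(2) \<zeta>c) (auto simp del: complex_cnj_diff)
    show "(?I \<circ> \<zeta>) ` {0..1} \<subseteq> coord (chart n) ` chart_dom (chart n)"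
      unfolding im
    proof
      fix z assume "z \<in> (?I \<circ> \<zeta>) ` {0..1}"
      then obtain t where t: "0 \<le> t" "t \<le> 1" "z = ?I (\<zeta> t)" by auto
      obtain w where "w \<in> slit n" "0 \<le> Im w" "proj w = \<zeta> t" using sheet[OF t(1,2)] by blast
      then have "cnj w \<in> slit n" "chart_map n (cnj w) = z" using cnj_slit cnj_chart t by auto
      then show "z \<in> chart_map n ` slit n" by blast
    qed
    show "norm (\<eta> t) \<le> K * Im ((?I \<circ> \<zeta>) t)" if "0 \<le> t" "t \<le> 1" for t
    proof -
      have "norm (\<eta> t) = (rad n)\<^sup>2 * norm (\<zeta>' t) / (norm (\<zeta> t - of_real (mid n)))\<^sup>2"
        by (simp add: \<eta>_def norm_mult norm_divide norm_power del: complex_cnj_diff)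
      also have "\<dots> \<le> (rad n)\<^sup>2 * (K * Im (\<zeta> t)) / (norm (\<zeta> t - of_real (mid n)))\<^sup>2"
        using K(2)[OF that] by (intro divide_right_mono mult_left_mono) auto
      also have "\<dots> = K * Im ((?I \<circ> \<zeta>) t)"
        by (simp add: Im_inversion)
      finally show ?thesis .
    qed
  qed (use u v K cnj_slit in \<open>auto simp: chart_dom_chart coord_chart cnj_chart\<close>)
qed

section \<open>The two rays over the imaginary axis\<close>

definition up :: "real \<Rightarrow> complex set" where "up t = {\<i> * of_real (exp t)}"
definition down :: "real \<Rightarrow> complex set" where "down t = {- (\<i> * of_real (exp t))}"

lemma height_0: "height 0 = 0"
proof (rule height_no_gap)
  show "\<not> (p n < 0 \<and> 0 < q n)" for n using p_ge_1[of n] by linarith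
qed

lemma vertical_slit: "\<i> * of_real (exp t) \<in> slit n" "- (\<i> * of_real (exp t)) \<in> slit n"
  by (auto simp: slit_def)

lemma vertical_double: "\<i> * of_real (exp t) \<in> double" "- (\<i> * of_real (exp t)) \<in> double"
  by (auto simp: double_def)

lemma proj_vertical:
  "proj (\<i> * of_real (exp t)) = \<i> * of_real (exp t)" "proj (- (\<i> * of_real (exp t))) = \<i> * of_real (exp t)"
  by (auto simp: complex_eq_iff height_0)

lemma up_in_points: "up t \<in> points surface" and down_in_points: "down t \<in> points surface"
  by (auto simp: up_def down_def point_surface vertical_double)

lemma coord_up: "coord (chart n) (up t) = \<i> * of_real (exp t)"
  by (simp add: up_def coord_chart chart_map_def proj_vertical)

lemma coord_down: "coord (chart n) (down t) = inversion (mid n) (rad n) (\<i> * of_real (exp t))"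
  by (simp add: down_def coord_chart chart_map_def proj_vertical)

lemma rdist_vertical:
  "rdist surface (up t) (up s) = \<bar>t - s\<bar>" "rdist surface (down t) (down s) = \<bar>t - s\<bar>"
proof -
  \<comment> \<open>Interpolating the logarithm linearly gives constant hyperbolic speed |t - s|;
    the matching lower bound is the variation of ln Im z.\<close>
  let ?\<zeta> = "\<lambda>\<tau>. \<i> * of_real (exp (t + \<tau> * (s - t)))"
  let ?\<zeta>' = "\<lambda>\<tau>. (s - t) *\<^sub>R (\<i> * of_real (exp (t + \<tau> * (s - t))))"
  have 1: "(?\<zeta> has_vector_derivative ?\<zeta>' \<tau>) (at \<tau>)" for \<tau>
    unfolding has_real_derivative_iff_has_vector_derivative[symmetric]
    by (auto intro!: derivative_eq_intros simp: scaleR_conv_of_real algebra_simps)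
  have "rdist surface {\<i> * of_real (exp t)} {\<i> * of_real (exp s)} \<le> \<bar>t - s\<bar>"
    "rdist surface {cnj (\<i> * of_real (exp t))} {cnj (\<i> * of_real (exp s))} \<le> \<bar>t - s\<bar>"
    by (rule sheet_curve[OF 1, where n = 0];
        (intro continuous_intros)?;
        (auto simp: vertical_slit proj_vertical norm_mult intro!: bexI[OF _ vertical_slit(1)])?)+
  moreover have "\<bar>s - t\<bar> \<le> rdist surface (up t) (up s)" "\<bar>s - t\<bar> \<le> rdist surface (down t) (down s)"
    using rdist_lower_bound[OF vertical_double(1) vertical_double(1) nonexpansive_ln_Im, of s t]
      rdist_lower_bound[OF vertical_double(2) vertical_double(2) nonexpansive_ln_Im, of s t]
    unfolding up_def down_def proj_vertical by simp_all
  ultimately show "rdist surface (up t) (up s) = \<bar>t - s\<bar>" "rdist surface (down t) (down s) = \<bar>t - s\<bar>"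
    by (simp_all add: up_def down_def)
qed

lemma continuous_up: "continuous_map (top_of_set {0..}) (rtop surface) up"
  and continuous_down: "continuous_map (top_of_set {0..}) (rtop surface) down"
proof -
  have c: "continuous_map (top_of_set {0..}) (top_of_set double) (\<lambda>t. \<i> * of_real (exp t))"
    "continuous_map (top_of_set {0..}) (top_of_set double) (\<lambda>t. - (\<i> * of_real (exp t)))"
    using vertical_double by (auto intro!: continuous_intros)
  show "continuous_map (top_of_set {0..}) (rtop surface) up"
    "continuous_map (top_of_set {0..}) (rtop surface) down"
    using c[THEN continuous_map_compose[OF _ continuous_singleton]]
    by (simp_all add: up_def[abs_def] down_def[abs_def] o_def)
qed

lemma geodesic_up: "geodesic_on surface {0..} up"
  unfolding geodesic_on_def
proof (intro conjI ballI continuous_up)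
  fix c assume "c \<in> atlas surface"
  then obtain n where n: "c = chart n" by (auto simp: atlas_surface)
  have co: "coord c \<circ> up = (\<lambda>t. \<i> * of_real (exp t))"
    by (auto simp: n coord_up)
  have d: "((\<lambda>t. \<i> * of_real (exp t)) has_vector_derivative \<i> * of_real (exp t)) (at t within {0..})" for t :: real
    by (auto intro!: derivative_eq_intros)
  show "\<exists>v. \<forall>t\<in>{0..}. up t \<in> chart_dom c \<longrightarrow>
      (coord c \<circ> up has_vector_derivative v t) (at t within {0..}) \<and>
      (v has_vector_derivative - christoffel (tensor surface c) (coord c (up t)) (v t) (v t)) (at t within {0..})"
  proof (intro exI[of _ "\<lambda>t. \<i> * of_real (exp t)"] ballI impI conjI)
    fix t :: real
    show "(coord c \<circ> up has_vector_derivative \<i> * of_real (exp t)) (at t within {0..})"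
      unfolding co by (rule d)
    have "- christoffel (tensor surface c) (coord c (up t)) (\<i> * of_real (exp t)) (\<i> * of_real (exp t)) = \<i> * of_real (exp t)"
      by (simp add: tensor_surface n coord_up christoffel_hyp_metric)
    then show "((\<lambda>t. \<i> * of_real (exp t)) has_vector_derivative
        - christoffel (tensor surface c) (coord c (up t)) (\<i> * of_real (exp t)) (\<i> * of_real (exp t))) (at t within {0..})"
      using d by simp
  qed
qed

text \<open>Every chart shows this ray inverted in its own arc, so the geodesic equation is checked
  along a circle instead of a line.\<close>

lemma geodesic_down: "geodesic_on surface {0..} down"
  unfolding geodesic_on_def
proof (intro conjI ballI continuous_down)
  fix c assume "c \<in> atlas surface"
  then obtain n where n: "c = chart n" by (auto simp: atlas_surface)
  let ?m = "complex_of_real (mid n)" and ?r = "complex_of_real (rad n)"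
  \<comment> \<open>The conjugate of the point on the axis, as it enters \<open>inversion\<close>.
    Since z' = z, the coordinate curve and its velocity are rational functions of z with easy
    derivatives.\<close>
  define z where "z t = - (\<i> * complex_of_real (exp t))" for t
  have zd: "(z has_vector_derivative z t) (at t within {0..})" for t
    unfolding z_def by (auto intro!: derivative_eq_intros)
  have m: "0 < mid n" using p_ge_1[of n] p_less_q[of n] by (simp add: mid_def)
  have ne: "z t - ?m \<noteq> 0" "z t + ?m \<noteq> 0" "z t \<noteq> 0" for t
    using m by (auto simp: z_def complex_eq_iff)
  have co: "coord c \<circ> down = (\<lambda>t. ?m + ?r\<^sup>2 / (z t - ?m))"
    by (auto simp: n coord_down inversion_def z_def)
  define v where "v t = - ?r\<^sup>2 * z t / (z t - ?m)\<^sup>2" for t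
  have d1: "((\<lambda>t. ?m + ?r\<^sup>2 / (z t - ?m)) has_vector_derivative v t) (at t within {0..})" for t
  proof -
    have "((\<lambda>z. ?m + ?r\<^sup>2 / (z - ?m)) has_field_derivative - ?r\<^sup>2 / (z t - ?m)\<^sup>2) (at (z t) within z ` {0..})"
      using ne(1)[of t] by (auto intro!: derivative_eq_intros simp: power2_eq_square)
    from field_vector_diff_chain_within[OF zd this] show ?thesis
      by (simp add: o_def v_def mult.commute)
  qed
  have d2: "(v has_vector_derivative ?r\<^sup>2 * z t * (z t + ?m) / (z t - ?m) ^ 3) (at t within {0..})" for t
  proof -
    define w where "w = z t - ?m"
    have w: "w \<noteq> 0" using ne(1) by (simp add: w_def)
    have "((\<lambda>z. - ?r\<^sup>2 * z / (z - ?m)\<^sup>2) has_field_derivative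
        - ((?r\<^sup>2 * w\<^sup>2 - ?r\<^sup>2 * z t * (2 * w)) / (w\<^sup>2 * w\<^sup>2))) (at (z t) within z ` {0..})"
      using w unfolding w_def by (auto intro!: derivative_eq_intros)
    also have "?r\<^sup>2 * w\<^sup>2 - ?r\<^sup>2 * z t * (2 * w) = - (w * (?r\<^sup>2 * (z t + ?m)))"
      by (simp add: w_def power2_eq_square algebra_simps)
    also have "- (- (w * (?r\<^sup>2 * (z t + ?m))) / (w\<^sup>2 * w\<^sup>2)) = ?r\<^sup>2 * (z t + ?m) / (z t - ?m) ^ 3"
      using w by (simp add: w_def[symmetric] power2_eq_square power3_eq_cube mult.assoc)
    finally have "((\<lambda>z. - ?r\<^sup>2 * z / (z - ?m)\<^sup>2) has_field_derivative ?r\<^sup>2 * (z t + ?m) / (z t - ?m) ^ 3) (at (z t) within z ` {0..})" .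
    from field_vector_diff_chain_within[OF zd this] show ?thesis
      by (simp add: o_def v_def[abs_def] mult_ac)
  qed
  have alg: "- (\<i> * (- R * Z / W\<^sup>2) * (- R * Z / W\<^sup>2) / (R * (\<i> * Z) / (- W * U))) = R * Z * U / W ^ 3"
    if "R \<noteq> 0" "Z \<noteq> 0" "W \<noteq> 0" "U \<noteq> 0" for R Z W U :: complex
    using that by (simp add: field_simps power2_eq_square power3_eq_cube)
  have ch: "- christoffel (tensor surface c) (coord c (down t)) (v t) (v t) = ?r\<^sup>2 * z t * (z t + ?m) / (z t - ?m) ^ 3" for t
  proof -
    let ?s = "inversion (mid n) (rad n) (\<i> * of_real (exp t))"
    have Ims: "Im ?s = (rad n)\<^sup>2 * exp t / ((exp t)\<^sup>2 + (mid n)\<^sup>2)"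
      unfolding Im_inversion cmod_power2 by (simp add: add.commute)
    have pos: "0 < Im ?s"
      unfolding Ims using rad_pos[of n] by (intro divide_pos_pos add_pos_nonneg mult_pos_pos) auto
    have E: "complex_of_real (exp t) = \<i> * z t" by (simp add: z_def)
    \<comment> \<open>From z^2 = - exp (2 t), the denominator exp (2 t) + m^2 factors as - (z - m)
      (z + m).\<close>
    have Imc: "complex_of_real (Im ?s) = ?r\<^sup>2 * (\<i> * z t) / (- (z t - ?m) * (z t + ?m))"
    proof -
      have "complex_of_real (Im ?s) = ?r\<^sup>2 * (\<i> * z t) / ((\<i> * z t)\<^sup>2 + ?m\<^sup>2)"
        unfolding Ims by (simp flip: E)
      also have "(\<i> * z t)\<^sup>2 + ?m\<^sup>2 = - (z t - ?m) * (z t + ?m)"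
        by (simp add: power2_eq_square algebra_simps)
      finally show ?thesis .
    qed
    have "- christoffel (tensor surface c) (coord c (down t)) (v t) (v t) = - (\<i> * v t * v t / complex_of_real (Im ?s))"
      using pos by (simp add: tensor_surface n coord_down christoffel_hyp_metric)
    also have "\<dots> = ?r\<^sup>2 * z t * (z t + ?m) / (z t - ?m) ^ 3"
      unfolding Imc v_def by (rule alg) (use ne[of t] rad_pos[of n] in simp_all)
    finally show ?thesis .
  qed
  show "\<exists>v. \<forall>t\<in>{0..}. down t \<in> chart_dom c \<longrightarrow>
      (coord c \<circ> down has_vector_derivative v t) (at t within {0..}) \<and>
      (v has_vector_derivative - christoffel (tensor surface c) (coord c (down t)) (v t) (v t)) (at t within {0..})"
    unfolding co using d1 d2 by (intro exI[of _ v] ballI impI conjI) (simp_all add: ch)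
qed

lemma ray_up: "ray surface up" and ray_down: "ray surface down"
  by (auto simp: ray_def geodesic_up geodesic_down rdist_vertical)

section \<open>Boundary arcs and their tangent points\<close>

lemma arc_point:
  assumes "Im w = 0" "w \<in> double"
  obtains m where "p m < Re w" "Re w < q m"
    "(norm (proj w))\<^sup>2 = (p m + q m) * Re w - p m * q m"
    "(Im (proj w))\<^sup>2 = (Re w - p m) * (q m - Re w)"
proof -
  obtain m where m: "p m < Re w" "Re w < q m"
    using assms by (auto simp: double_def height_pos_iff)
  have "(Im (proj w))\<^sup>2 = (Re w - p m) * (q m - Re w)"
    using height_sq(1)[OF m] assms by (simp add: rad_def mid_def power2_eq_square field_simps)
  moreover have "(norm (proj w))\<^sup>2 = (p m + q m) * Re w - p m * q m"
    unfolding cmod_power2 calculation by (simp add: power2_eq_square algebra_simps)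
  ultimately show ?thesis using m that by blast
qed

text \<open>On arc \<open>m\<close> the squared modulus is affine in the real part, with values p^2
  and q^2 at the ends of the gap.\<close>

lemma norm_arc_point:
  assumes "Im w = 0" "w \<in> double"
  obtains m where "p m \<le> norm (proj w)" "norm (proj w) \<le> q m"
proof -
  obtain m where m: "p m < Re w" "Re w < q m"
    "(norm (proj w))\<^sup>2 = (p m + q m) * Re w - p m * q m"
    by (rule arc_point[OF assms]) blast
  have pos: "0 < p m" "0 < q m" using p_ge_1[of m] p_less_q[of m] by auto
  have "0 \<le> (p m + q m) * (Re w - p m)" "0 \<le> (p m + q m) * (q m - Re w)"
    using m pos by (intro mult_nonneg_nonneg; simp)+
  then have "(p m)\<^sup>2 \<le> (norm (proj w))\<^sup>2" "(norm (proj w))\<^sup>2 \<le> (q m)\<^sup>2"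
    unfolding m(3) by (simp_all add: power2_eq_square algebra_simps)
  then have "p m \<le> norm (proj w)" "norm (proj w) \<le> q m"
    using pos by (auto intro: power2_le_imp_le)
  then show ?thesis by (rule that)
qed

text \<open>The arc over the gap \<open>(p n, q n)\<close> is tangent to the half-line from 0 through the point of
  modulus \<open>sqrt (p n * q n)\<close>; \<open>tangent_height n\<close> is the height of this point.\<close>

definition tangent_height :: "nat \<Rightarrow> real" where
  "tangent_height n = sqrt (p n * q n) * (q n - p n) / (p n + q n)"

text \<open>From q >= 4 p follow sqrt (p q) >= 2 p and (q - p) / (p + q) >= 3/5, hence the constant
  6/5.\<close>

lemma tangent_height_ge: "6 / 5 * p n \<le> tangent_height n"
proof -
  have pos: "0 < p n" "0 < q n" "p n < q n" using p_ge_1[of n] p_less_q[of n] by auto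
  have "(2 * p n)\<^sup>2 \<le> p n * q n"
    using pq[of n] pos by (simp add: power2_eq_square)
  then have 1: "2 * p n \<le> sqrt (p n * q n)" by (rule real_le_rsqrt)
  have 2: "3 / 5 \<le> (q n - p n) / (p n + q n)"
    using pq[of n] pos by (simp add: field_simps)
  have "2 * p n * (3 / 5) \<le> sqrt (p n * q n) * ((q n - p n) / (p n + q n))"
    by (rule mult_mono[OF 1 2]) (use pos in auto)
  then show ?thesis by (simp add: tangent_height_def)
qed

lemma tangent_height_pos: "0 < tangent_height n"
  using tangent_height_ge[of n] p_ge_1[of n] by linarith

text \<open>Go from the axis to the tangent point at constant height, a horocyclic segment of length
  x / Y, cross there and return on the other sheet. The segment must not dip below any arc on its
  way.\<close>

lemma rdist_up_down_tangent:
  "rdist surface (up (ln (tangent_height n))) (down (ln (tangent_height n)))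
    \<le> 4 * sqrt (p n * q n) / (q n - p n)"
proof -
  let ?p = "p n" and ?q = "q n" and ?Y = "tangent_height n"
  \<comment> \<open>The real part of the tangent point, whose modulus is sqrt (p q).\<close>
  define x where "x = 2 * ?p * ?q / (?p + ?q)"
  have pos: "0 < ?p" "0 < ?q" "?p < ?q" using p_ge_1[of n] p_less_q[of n] by auto
  have Y: "0 < ?Y" by (rule tangent_height_pos)
  have x: "?p < x" "x < ?q" "x \<le> mid n"
  proof -
    have "?p * (?p + ?q) < 2 * ?p * ?q" using pos by (simp add: algebra_simps)
    then show "?p < x" using pos by (simp add: x_def pos_less_divide_eq)
    have "2 * ?p * ?q < ?q * (?p + ?q)" using pos by (simp add: algebra_simps)
    then show "x < ?q" using pos by (simp add: x_def pos_divide_less_eq)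
    have "0 \<le> (?p - ?q)\<^sup>2" by simp
    then have "2 * (2 * ?p * ?q) \<le> (?p + ?q) * (?p + ?q)" by (simp add: power2_eq_square algebra_simps)
    then have "2 * ?p * ?q \<le> (?p + ?q) / 2 * (?p + ?q)" by simp
    then show "x \<le> mid n" using pos by (simp add: x_def mid_def pos_divide_le_eq)
  qed
  have xY: "(x - ?p) * (?q - x) = ?Y\<^sup>2"
  proof -
    have "x - ?p = ?p * (?q - ?p) / (?p + ?q)" "?q - x = ?q * (?q - ?p) / (?p + ?q)"
      using pos by (simp_all add: x_def field_simps)
    then show ?thesis
      using pos by (simp add: tangent_height_def power_divide power_mult_distrib power2_eq_square)
  qed
  have hx: "height x = ?Y"
    unfolding height_gap[OF x(1,2)] arc_height_def xY using Y by (simp add: max_def)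
  have low: "height y < ?Y \<or> height y \<le> ?Y \<and> ?p < y \<and> y < ?q" if "0 \<le> y" "y \<le> x" for y
  proof (cases "\<exists>m. p m < y \<and> y < q m")
    case True
    then obtain m where m: "p m < y" "y < q m" by blast
    show ?thesis
    proof (cases "m = n")
      case True
      have "0 \<le> (x - y) * (?p + ?q - x - y)"
        using that x(3) by (intro mult_nonneg_nonneg) (auto simp: mid_def)
      then have "(y - ?p) * (?q - y) \<le> (x - ?p) * (?q - x)"
        by (simp add: algebra_simps)
      then have "arc_height n y \<le> sqrt (?Y\<^sup>2)"
        unfolding arc_height_def xY[symmetric] using x by (intro real_sqrt_le_mono) auto
      then show ?thesis using True m Y height_gap[OF m] by simp
    next
      case False
      have "\<not> n < m" using q_le_p[of n m] m(1) that(2) x(2) pos by auto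
      then have mn: "4 * q m \<le> ?p" using False by (intro q_le_p) simp
      have "(height y)\<^sup>2 \<le> (rad m)\<^sup>2" using height_sq(1)[OF m] by simp
      then have "height y \<le> rad m"
        by (rule power2_le_imp_le) (rule less_imp_le[OF rad_pos])
      then show ?thesis
        using mn p_ge_1[of m] tangent_height_ge[of n] pos by (simp add: rad_def)
    qed
  next
    case False
    then show ?thesis using height_no_gap[of y] Y by auto
  qed
  let ?w = "of_real x :: complex"
  let ?i = "\<i> * of_real (exp (ln ?Y))"
  let ?K = "x / ?Y"
  let ?\<zeta> = "\<lambda>t. complex_of_real (t * x) + \<i> * of_real ?Y"
  have "\<exists>w\<in>slit n. 0 \<le> Im w \<and> proj w = ?\<zeta> t" if t: "0 \<le> t" "t \<le> 1" for t
  proof (rule bexI[of _ "Complex (t * x) (?Y - height (t * x))"])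
    have tx: "0 \<le> t * x" "t * x \<le> x"
      using t x(1) pos by (auto simp: mult_left_le_one_le)
    show "0 \<le> Im (Complex (t * x) (?Y - height (t * x))) \<and>
        proj (Complex (t * x) (?Y - height (t * x))) = ?\<zeta> t"
      using low[OF tx] by (auto simp: complex_eq_iff)
    show "Complex (t * x) (?Y - height (t * x)) \<in> slit n"
      using low[OF tx] by (auto simp: slit_def)
  qed
  moreover have "(?\<zeta> has_vector_derivative of_real x) (at t)" for t
    by (auto intro!: derivative_eq_intros)
  moreover have "0 < Im (?\<zeta> t)" "0 \<le> ?K" "norm (complex_of_real x) \<le> ?K * Im (?\<zeta> t)" for t
    using Y x pos by auto
  moreover have "?i \<in> slit n" by (rule vertical_slit(1))
  moreover have "0 \<le> Im ?i" "proj ?i = ?\<zeta> 0"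
    unfolding proj_vertical using Y by auto
  moreover have "?w \<in> slit n" "0 \<le> Im ?w" "proj ?w = ?\<zeta> 1"
    using x hx by (auto simp: slit_def complex_eq_iff)
  moreover have "continuous_on UNIV (\<lambda>t :: real. complex_of_real x)" by simp
  ultimately have sh: "rdist surface {?i} {?w} \<le> ?K" "rdist surface {cnj ?i} {cnj ?w} \<le> ?K"
    using sheet_curve[of ?\<zeta> "\<lambda>t. of_real x" ?K n ?i ?w] by blast+
  have "rdist surface {?i} {cnj ?i} \<le> rdist surface {?i} {?w} + rdist surface {?w} {cnj ?i}"
    by (rule rdist_triangle) (use vertical_double x hx Y in \<open>auto simp: point_surface double_def\<close>)
  also have "\<dots> \<le> 2 * ?K" using sh by (simp add: rdist_commute[of "{?w}"])
  also have "?K = 2 * sqrt (?p * ?q) / (?q - ?p)"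
  proof -
    have "sqrt (?p * ?q) * sqrt (?p * ?q) = ?p * ?q" using pos by simp
    then show ?thesis
      using pos by (simp add: x_def tangent_height_def divide_simps)
  qed
  finally show ?thesis by (simp add: up_def down_def)
qed

end

section \<open>Busemann functions\<close>

lemma tendsto_at_top_antimono_bounded:
  fixes f :: "real \<Rightarrow> real"
  assumes "\<And>s t. a \<le> s \<Longrightarrow> s \<le> t \<Longrightarrow> f t \<le> f s" "\<And>t. a \<le> t \<Longrightarrow> B \<le> f t"
  obtains l where "(f \<longlongrightarrow> l) at_top"
proof
  have bdd: "bdd_below (f ` {a..})" using assms(2) by (intro bdd_belowI2) auto
  show "(f \<longlongrightarrow> (INF t\<in>{a..}. f t)) at_top"
  proof (rule order_tendstoI)
    fix y assume y: "y < (INF t\<in>{a..}. f t)"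
    show "\<forall>\<^sub>F t in at_top. y < f t"
      using eventually_ge_at_top[of a]
    proof eventually_elim
      case (elim t)
      then show ?case using cINF_lower[OF bdd, of t] y by simp
    qed
  next
    fix y assume "(INF t\<in>{a..}. f t) < y"
    then obtain s where s: "a \<le> s" "f s < y"
      using cINF_less_iff[OF _ bdd] by auto
    show "\<forall>\<^sub>F t in at_top. f t < y"
      using eventually_ge_at_top[of s]
    proof eventually_elim
      case (elim t)
      then show ?case using assms(1)[OF s(1), of t] s(2) by simp
    qed
  qed
qed

context riemann
begin

lemma ray_in_points: "ray M \<alpha> \<Longrightarrow> 0 \<le> t \<Longrightarrow> \<alpha> t \<in> points M"
  unfolding ray_def geodesic_on_def by (auto simp: continuous_map_def)

text \<open>The triangle inequality makes the function nonincreasing in \<open>t\<close> and bounds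
  it below by minus the distance from \<open>x\<close> to the origin of the ray. So the limit in
  \<open>busemann\<close> exists, as a difference of two such limits.\<close>

lemma ray_horofunction:
  assumes "ray M \<alpha>" "x \<in> points M"
  obtains b where "((\<lambda>t. rdist M x (\<alpha> t) - t) \<longlongrightarrow> b) at_top"
proof (rule tendsto_at_top_antimono_bounded[of 0 "\<lambda>t. rdist M x (\<alpha> t) - t" "- rdist M x (\<alpha> 0)"])
  fix s t :: real assume st: "0 \<le> s" "s \<le> t"
  have "rdist M x (\<alpha> t) \<le> rdist M x (\<alpha> s) + rdist M (\<alpha> s) (\<alpha> t)"
    by (rule rdist_triangle) (use st assms ray_in_points in auto)
  also have "rdist M (\<alpha> s) (\<alpha> t) = t - s"
    using assms(1) st by (simp add: ray_def)
  finally show "rdist M x (\<alpha> t) - t \<le> rdist M x (\<alpha> s) - s" by simp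
next
  fix t :: real assume t: "0 \<le> t"
  have "rdist M (\<alpha> 0) (\<alpha> t) \<le> rdist M (\<alpha> 0) x + rdist M x (\<alpha> t)"
    by (rule rdist_triangle) (use t assms ray_in_points in auto)
  moreover have "rdist M (\<alpha> 0) (\<alpha> t) = t"
    using assms(1) t by (simp add: ray_def)
  ultimately show "- rdist M x (\<alpha> 0) \<le> rdist M x (\<alpha> t) - t"
    by (simp add: rdist_commute[of x "\<alpha> 0"])
qed (use that in blast)

lemma busemann_eq_diff:
  assumes "((\<lambda>t. rdist M x (\<alpha> t) - t) \<longlongrightarrow> a) at_top" "((\<lambda>t. rdist M y (\<alpha> t) - t) \<longlongrightarrow> b) at_top"
    and "x \<in> points M" "y \<in> points M"
  shows "busemann M \<alpha> (x, y) = a - b"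
proof -
  have "((\<lambda>t. (rdist M x (\<alpha> t) - t) - (rdist M y (\<alpha> t) - t)) \<longlongrightarrow> a - b) at_top"
    by (intro tendsto_diff assms)
  then have "((\<lambda>t. rdist M x (\<alpha> t) - rdist M (\<alpha> t) y) \<longlongrightarrow> a - b) at_top"
    by (simp add: rdist_commute[of y])
  then have "Lim at_top (\<lambda>t. rdist M x (\<alpha> t) - rdist M (\<alpha> t) y) = a - b"
    by (intro tendsto_Lim) simp_all
  then show ?thesis using assms(3,4) by (simp add: busemann_def)
qed

text \<open>Since the limits exist, they can be evaluated along one sequence of parameters at which
  the rays approach each other.\<close>

lemma busemann_eqI:
  assumes \<alpha>: "ray M \<alpha>" and \<beta>: "ray M \<beta>" and \<tau>: "filterlim \<tau> at_top sequentially" "\<And>n. 0 \<le> \<tau> n"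
    and lim: "(\<lambda>n. rdist M (\<alpha> (\<tau> n)) (\<beta> (\<tau> n))) \<longlonglongrightarrow> 0"
  shows "busemann M \<alpha> = busemann M \<beta>"
proof -
  have eq: "a = b" if x: "x \<in> points M" and a: "((\<lambda>t. rdist M x (\<alpha> t) - t) \<longlongrightarrow> a) at_top"
    and b: "((\<lambda>t. rdist M x (\<beta> t) - t) \<longlongrightarrow> b) at_top" for x a b
  proof -
    have pts: "\<alpha> (\<tau> n) \<in> points M" "\<beta> (\<tau> n) \<in> points M" for n
      using ray_in_points \<alpha> \<beta> \<tau>(2) by auto
    have "(\<lambda>n. (rdist M x (\<alpha> (\<tau> n)) - \<tau> n) - (rdist M x (\<beta> (\<tau> n)) - \<tau> n)) \<longlonglongrightarrow> a - b"
      by (intro tendsto_diff filterlim_compose[OF a \<tau>(1)] filterlim_compose[OF b \<tau>(1)])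
    moreover have "(\<lambda>n. (rdist M x (\<alpha> (\<tau> n)) - \<tau> n) - (rdist M x (\<beta> (\<tau> n)) - \<tau> n)) \<longlonglongrightarrow> 0"
    proof (rule Lim_null_comparison[OF _ lim], rule always_eventually, rule allI)
      fix n
      show "norm ((rdist M x (\<alpha> (\<tau> n)) - \<tau> n) - (rdist M x (\<beta> (\<tau> n)) - \<tau> n)) \<le> rdist M (\<alpha> (\<tau> n)) (\<beta> (\<tau> n))"
        using rdist_triangle[OF x pts(1)[of n] pts(2)[of n]] rdist_triangle[OF x pts(2)[of n] pts(1)[of n]]
        by (simp add: rdist_commute[of "\<beta> (\<tau> n)"])
    qed
    ultimately show ?thesis using LIMSEQ_unique by fastforce
  qed
  show ?thesis
  proof (rule ext, rule prod.induct)
    fix x y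
    show "busemann M \<alpha> (x, y) = busemann M \<beta> (x, y)"
    proof (cases "x \<in> points M \<and> y \<in> points M")
      case True
      obtain a where a: "((\<lambda>t. rdist M x (\<alpha> t) - t) \<longlongrightarrow> a) at_top" using ray_horofunction[OF \<alpha>] True by blast
      obtain b where b: "((\<lambda>t. rdist M y (\<alpha> t) - t) \<longlongrightarrow> b) at_top" using ray_horofunction[OF \<alpha>] True by blast
      obtain a' where a': "((\<lambda>t. rdist M x (\<beta> t) - t) \<longlongrightarrow> a') at_top" using ray_horofunction[OF \<beta>] True by blast
      obtain b' where b': "((\<lambda>t. rdist M y (\<beta> t) - t) \<longlongrightarrow> b') at_top" using ray_horofunction[OF \<beta>] True by blast
      show ?thesis
        using busemann_eq_diff[OF a b] busemann_eq_diff[OF a' b'] eq[OF _ a a'] eq[OF _ b b'] True by simp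
    qed (auto simp: busemann_def)
  qed
qed

lemma dist_infinity_finite:
  assumes "\<And>t. 0 \<le> t \<Longrightarrow> rdist M (\<alpha> t) (\<beta> t) \<le> C"
  shows "dist_infinity M \<alpha> \<beta> < \<infinity>"
proof -
  have "dist_infinity M \<alpha> \<beta> \<le> ereal C"
    unfolding dist_infinity_def using assms by (intro SUP_least) auto
  then show ?thesis by auto
qed

lemma dist_infinity_infinite:
  assumes "\<And>n :: nat. \<exists>t\<ge>0. real n \<le> rdist M (\<alpha> t) (\<beta> t)"
  shows "dist_infinity M \<alpha> \<beta> = \<infinity>"
  unfolding dist_infinity_def using assms by (intro SUP_PInfty) force

end

section \<open>The two examples\<close>

context gap_sequence
begin

lemma ln_tangent_height_nonneg: "0 \<le> ln (tangent_height n)"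
  using tangent_height_ge[of n] p_ge_1[of n] by simp

lemma filterlim_ln_tangent_height: "filterlim (\<lambda>n. ln (tangent_height n)) at_top sequentially"
proof (rule filterlim_compose[OF ln_at_top])
  show "filterlim tangent_height at_top sequentially"
  proof (rule filterlim_at_top_mono[OF filterlim_real_sequentially], rule always_eventually, rule allI)
    show "real n \<le> tangent_height n" for n
      using tangent_height_ge[of n] p_gt[of n] p_ge_1[of n] by linarith
  qed
qed

text \<open>Write z for the projection of the crossing point. Before it, the Busemann function at 0
  varies by |2 ln |z| - ln Im z|, being 0 at the start; after it, ln Im varies by |t - ln Im z|. The
  sum is at least t + 2 ln (|z| / Im z), and \<open>c\<close> bounds the quotient from
  below.\<close>

lemma opposite_sheets_far:
  assumes slope: "\<And>w. Im w = 0 \<Longrightarrow> w \<in> double \<Longrightarrow> c * Im (proj w) \<le> norm (proj w)" and "0 < c" "0 \<le> t"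
  shows "t + 2 * ln c \<le> rdist surface (down 0) (up t)" "t + 2 * ln c \<le> rdist surface (up 0) (down t)"
proof -
  let ?\<phi> = "\<lambda>z. 2 * ln (norm z) - ln (Im z)" and ?\<psi> = "\<lambda>z. ln (Im z)"
  let ?i = "\<lambda>t. \<i> * complex_of_real (exp t)"
  have *: "t + 2 * ln c \<le> \<bar>?\<phi> (proj w) - ?\<phi> (?i 0)\<bar> + \<bar>?\<psi> (?i t) - ?\<psi> (proj w)\<bar>"
    if w: "Im w = 0" "w \<in> double" for w
  proof -
    have Im: "0 < Im (proj w)" by (rule proj_upper[OF w(2)])
    then have "ln (c * Im (proj w)) \<le> ln (norm (proj w))"
      using slope[OF w] assms(2) by (intro ln_mono) (auto simp del: Im_proj intro: mult_pos_pos)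
    then have "ln c + ln (Im (proj w)) \<le> ln (norm (proj w))"
      using ln_mult[of c "Im (proj w)"] assms(2) Im by simp
    moreover have "?\<phi> (?i 0) = 0" "?\<psi> (?i t) = t" by simp_all
    ultimately show ?thesis by (simp only:)
  qed
  note far = rdist_crossing_lower_bound[OF _ _ _ nonexpansive_ln_horocycle nonexpansive_ln_Im]
  have "t + 2 * ln c \<le> rdist surface {- ?i 0} {?i t}"
  proof (rule far[OF vertical_double(2,1)])
    fix w assume "Im w = 0" "w \<in> double"
    then show "t + 2 * ln c \<le> \<bar>?\<phi> (proj w) - ?\<phi> (proj (- ?i 0))\<bar> + \<bar>?\<psi> (proj (?i t)) - ?\<psi> (proj w)\<bar>"
      unfolding proj_vertical by (rule *)
  qed simp
  then show "t + 2 * ln c \<le> rdist surface (down 0) (up t)" by (simp only: up_def down_def)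
  have "t + 2 * ln c \<le> rdist surface {?i 0} {- ?i t}"
  proof (rule far[OF vertical_double(1,2)])
    fix w assume "Im w = 0" "w \<in> double"
    then show "t + 2 * ln c \<le> \<bar>?\<phi> (proj w) - ?\<phi> (proj (?i 0))\<bar> + \<bar>?\<psi> (proj (- ?i t)) - ?\<psi> (proj w)\<bar>"
      unfolding proj_vertical by (rule *)
  qed simp
  then show "t + 2 * ln c \<le> rdist surface (up 0) (down t)" by (simp only: up_def down_def)
qed

end

section \<open>First example: self-similar gaps\<close>

interpretation S1: gap_sequence "\<lambda>n. 16 ^ n" "\<lambda>n. 4 * 16 ^ n"
  by unfold_locales auto

text \<open>The constant 5/3 is (p + q) / (q - p) for q = 4 p, the value of |z| / Im z at the
  tangent point.\<close>

lemma S1_slope: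
  assumes "Im w = 0" "w \<in> S1.double"
  shows "5 / 3 * Im (S1.proj w) \<le> norm (S1.proj w)"
proof -
  obtain m where m: "(norm (S1.proj w))\<^sup>2 = (16 ^ m + 4 * 16 ^ m) * Re w - 16 ^ m * (4 * 16 ^ m)"
    "(Im (S1.proj w))\<^sup>2 = (Re w - 16 ^ m) * (4 * 16 ^ m - Re w)"
    by (rule S1.arc_point[OF assms]) blast
  define P :: real where "P = 16 ^ m"
  \<comment> \<open>This square is 9 |z|^2 - 25 (Im z)^2 for z on the arc; it vanishes at the real
    part 8 P / 5 of the tangent point.\<close>
  have "0 \<le> (5 * Re w - 8 * P)\<^sup>2" by simp
  then have "25 * ((Re w - P) * (4 * P - Re w)) \<le> 9 * ((P + 4 * P) * Re w - P * (4 * P))"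
    by (simp add: power2_eq_square algebra_simps)
  then have "(5 / 3 * Im (S1.proj w))\<^sup>2 \<le> (norm (S1.proj w))\<^sup>2"
    unfolding power_mult_distrib m P_def[symmetric] by (simp add: power2_eq_square field_simps)
  then show ?thesis by (rule power2_le_imp_le) simp
qed

text \<open>Evaluated at the pair of origins, the two functions have opposite signs: the point of a
  ray at parameter \<open>t\<close> has distance \<open>t\<close> from its own origin, but at least
  t + 2 ln (5/3) from the origin of the other ray.\<close>

lemma S1_busemann: "busemann S1.surface S1.up \<noteq> busemann S1.surface S1.down"
proof -
  let ?x = "S1.down 0" and ?y = "S1.up 0" and ?d = "2 * ln (5 / 3 :: real)"
  have pts: "?x \<in> points S1.surface" "?y \<in> points S1.surface"
    by (rule S1.down_in_points S1.up_in_points)+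
  have d: "0 < ?d" by simp
  obtain a where a: "((\<lambda>t. rdist S1.surface ?x (S1.up t) - t) \<longlongrightarrow> a) at_top"
    by (rule S1.ray_horofunction[OF S1.ray_up pts(1)])
  obtain b where b: "((\<lambda>t. rdist S1.surface ?y (S1.down t) - t) \<longlongrightarrow> b) at_top"
    by (rule S1.ray_horofunction[OF S1.ray_down pts(2)])
  have zero: "((\<lambda>t. rdist S1.surface ?y (S1.up t) - t) \<longlongrightarrow> 0) at_top"
    "((\<lambda>t. rdist S1.surface ?x (S1.down t) - t) \<longlongrightarrow> 0) at_top"
    by (rule tendsto_eventually, use eventually_ge_at_top[of 0] in eventually_elim, simp add: S1.rdist_vertical)+
  have "?d \<le> a"
    by (rule tendsto_lowerbound[OF a], use eventually_ge_at_top[of 0] in eventually_elim)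
      (use S1.opposite_sheets_far(1)[OF S1_slope] in force, simp)
  moreover have "?d \<le> b"
    by (rule tendsto_lowerbound[OF b], use eventually_ge_at_top[of 0] in eventually_elim)
      (use S1.opposite_sheets_far(2)[OF S1_slope] in force, simp)
  moreover have "busemann S1.surface S1.up (?x, ?y) = a - 0"
    by (rule S1.busemann_eq_diff[OF a zero(1) pts])
  moreover have "busemann S1.surface S1.down (?x, ?y) = 0 - b"
    by (rule S1.busemann_eq_diff[OF zero(2) b pts])
  ultimately have "busemann S1.surface S1.up (?x, ?y) \<noteq> busemann S1.surface S1.down (?x, ?y)"
    using d by linarith
  then show ?thesis by metis
qed

text \<open>The tangent heights are 6/5 * 16^n, so every parameter is within a fixed bound
  \<open>?C\<close> of one at which the rays are at most 8/3 apart; moving there along both rays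
  costs at most twice that bound.\<close>

lemma S1_dist_infinity: "dist_infinity S1.surface S1.up S1.down < \<infinity>"
proof (rule S1.dist_infinity_finite)
  fix t :: real assume t: "0 \<le> t"
  define n where "n = nat \<lfloor>t / ln 16\<rfloor>"
  let ?C = "ln 16 + ln (6 / 5 :: real)" and ?\<tau> = "ln (S1.tangent_height n)"
  have l16: "0 < ln (16 :: real)" "0 < ln (6 / 5 :: real)" by simp_all
  have "real n \<le> t / ln 16" "t / ln 16 < real n + 1"
    unfolding n_def using t l16 by (auto simp: floor_less_iff)
  then have n: "real n * ln 16 \<le> t" "t < (real n + 1) * ln 16"
    using l16 by (auto simp: field_simps)
  have "sqrt (16 ^ n * (4 * 16 ^ n)) = (2 * 16 ^ n :: real)"
    by (rule real_sqrt_unique) (auto simp: power2_eq_square)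
  then have th: "S1.tangent_height n = 6 / 5 * 16 ^ n"
    and l: "4 * sqrt (16 ^ n * (4 * 16 ^ n)) / (4 * 16 ^ n - 16 ^ n) = (8 / 3 :: real)"
    by (simp_all add: S1.tangent_height_def field_simps)
  have \<tau>_eq: "?\<tau> = ln (6 / 5) + real n * ln 16"
    unfolding th by (subst ln_mult) (auto simp: ln_realpow)
  have \<tau>: "\<bar>t - ?\<tau>\<bar> \<le> ?C"
    using n l16 unfolding \<tau>_eq abs_le_iff distrib_right by linarith
  have "rdist S1.surface (S1.up t) (S1.down t) \<le> rdist S1.surface (S1.up t) (S1.up ?\<tau>) + rdist S1.surface (S1.up ?\<tau>) (S1.down t)"
    by (intro S1.rdist_triangle S1.up_in_points S1.down_in_points)
  moreover have "rdist S1.surface (S1.up ?\<tau>) (S1.down t) \<le> rdist S1.surface (S1.up ?\<tau>) (S1.down ?\<tau>) + rdist S1.surface (S1.down ?\<tau>) (S1.down t)"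
    by (intro S1.rdist_triangle S1.up_in_points S1.down_in_points)
  moreover have "rdist S1.surface (S1.up ?\<tau>) (S1.down ?\<tau>) \<le> 8 / 3"
    using S1.rdist_up_down_tangent[of n] unfolding l .
  ultimately show "rdist S1.surface (S1.up t) (S1.down t) \<le> 2 * ?C + 8 / 3"
    using \<tau> abs_minus_commute[of t ?\<tau>] unfolding S1.rdist_vertical distrib_left by linarith
qed

section \<open>Second example: gaps whose ratios grow\<close>

definition sparse_left :: "nat \<Rightarrow> real" where "sparse_left n = 4 ^ ((2 * n)\<^sup>2)"
definition sparse_right :: "nat \<Rightarrow> real" where "sparse_right n = 4 ^ ((2 * n + 1)\<^sup>2)"

text \<open>The exponents of 4 run through consecutive squares, so the ratio is 4^(4n+1) across gap
  \<open>n\<close> and 4^(4n+3) from gap \<open>n\<close> to the next: both are unbounded.\<close>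

interpretation S2: gap_sequence sparse_left sparse_right
proof
  show "4 * sparse_left n \<le> sparse_right n" for n
  proof -
    have "(4 :: real) ^ Suc ((2 * n)\<^sup>2) \<le> 4 ^ (2 * n + 1)\<^sup>2"
      by (intro power_increasing) (auto simp: power2_eq_square)
    then show ?thesis by (simp add: sparse_left_def sparse_right_def)
  qed
  show "4 * sparse_right n \<le> sparse_left (Suc n)" for n
  proof -
    have "(4 :: real) ^ Suc ((2 * n + 1)\<^sup>2) \<le> 4 ^ (2 * Suc n)\<^sup>2"
      by (intro power_increasing) (auto simp: power2_eq_square)
    then show ?thesis by (simp add: sparse_left_def sparse_right_def)
  qed
qed (simp add: sparse_left_def)

lemma S2_busemann: "busemann S2.surface S2.up = busemann S2.surface S2.down"
proof (rule S2.busemann_eqI[OF S2.ray_up S2.ray_down S2.filterlim_ln_tangent_height S2.ln_tangent_height_nonneg])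
  have bound: "4 * sqrt (sparse_left n * sparse_right n) / (sparse_right n - sparse_left n)
      \<le> 8 * (1 / 2 :: real) ^ n" for n :: nat
  proof -
    define P where "P = sparse_left n"
    \<comment> \<open>The square root of the ratio across gap \<open>n\<close>. The bound at the
      tangent point becomes 4 K / (K^2 - 1), at most 8 / K because K >= 2.\<close>
    define K :: real where "K = 2 ^ (4 * n + 1)"
    have P: "0 < P" by (simp add: P_def sparse_left_def)
    have "(2 * n + 1)\<^sup>2 = (2 * n)\<^sup>2 + (4 * n + 1)" by (simp add: power2_eq_square)
    then have Q: "sparse_right n = P * K\<^sup>2"
      by (simp add: P_def K_def sparse_left_def sparse_right_def power_add power_mult[symmetric] mult.commute[of _ 2])
        (simp add: power_mult power_add)
    have "2 ^ n \<le> K" unfolding K_def by (intro power_increasing) auto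
    moreover have "2 \<le> K" unfolding K_def using power_increasing[of 1 "4 * n + 1" "2 :: real"] by simp
    moreover have "sqrt (P * (P * K\<^sup>2)) = P * K"
      using P \<open>2 \<le> K\<close> by (intro real_sqrt_unique) (auto simp: power2_eq_square)
    moreover have "4 * (P * K) / (P * K\<^sup>2 - P) \<le> 8 * (1 / 2) ^ n"
    proof -
      have "K\<^sup>2 / 2 \<le> K\<^sup>2 - 1" using mult_mono[OF \<open>2 \<le> K\<close> \<open>2 \<le> K\<close>] \<open>2 \<le> K\<close> by (simp add: power2_eq_square)
      then have "4 * (P * K) / (P * K\<^sup>2 - P) \<le> 4 * (P * K) / (P * (K\<^sup>2 / 2))"
        using P \<open>2 \<le> K\<close> by (intro divide_left_mono) (auto simp: right_diff_distrib[symmetric] intro!: mult_pos_pos)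
      also have "\<dots> = 8 / K" using P \<open>2 \<le> K\<close> by (simp add: power2_eq_square)
      also have "\<dots> \<le> 8 / 2 ^ n" using \<open>2 ^ n \<le> K\<close> \<open>2 \<le> K\<close> by (intro divide_left_mono) auto
      finally show ?thesis by (simp add: power_one_over)
    qed
    ultimately show ?thesis unfolding Q P_def[symmetric] by simp
  qed
  show "(\<lambda>n. rdist S2.surface (S2.up (ln (S2.tangent_height n))) (S2.down (ln (S2.tangent_height n)))) \<longlonglongrightarrow> 0"
  proof (rule Lim_null_comparison)
    show "(\<lambda>n. 8 * (1 / 2 :: real) ^ n) \<longlonglongrightarrow> 0"
      by (intro tendsto_mult_right_zero LIMSEQ_power_zero) simp
    show "\<forall>\<^sub>F n in sequentially. norm (rdist S2.surface (S2.up (ln (S2.tangent_height n))) (S2.down (ln (S2.tangent_height n))))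
        \<le> 8 * (1 / 2 :: real) ^ n"
      using order_trans[OF S2.rdist_up_down_tangent bound] by (simp add: S2.rdist_nonneg)
  qed
qed

text \<open>A curve between the two points at parameter \<open>t\<close> must reach some arc and
  come back. Both points have the same projection, so ln |z| bounds the two legs alike.\<close>

lemma S2_dist_infinity: "dist_infinity S2.surface S2.up S2.down = \<infinity>"
proof (rule S2.dist_infinity_infinite)
  fix n :: nat
  let ?i = "\<lambda>t. \<i> * complex_of_real (exp t)"
  \<comment> \<open>The power 4^A is the geometric mean of the right end of gap \<open>n\<close> and
    the left end of the next gap. Their exponents differ from \<open>A\<close> by (4 n + 3) / 2,
    which exceeds \<open>n\<close>.\<close>
  define A where "A = ((2 * real n + 1)\<^sup>2 + (2 * real n + 2)\<^sup>2) / 2"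
  define t where "t = A * ln 4"
  have l4: "1 \<le> ln (4 :: real)"
    using exp_le by (subst ln_ge_iff) auto
  have far: "real n / 2 \<le> \<bar>ln (norm (S2.proj w)) - t\<bar>" if w: "Im w = 0" "w \<in> S2.double" for w
  proof -
    obtain m where m: "4 ^ ((2 * m)\<^sup>2) \<le> norm (S2.proj w)" "norm (S2.proj w) \<le> 4 ^ ((2 * m + 1)\<^sup>2)"
      by (rule S2.norm_arc_point[OF w]) (simp only: sparse_left_def sparse_right_def)
    have "(0 :: real) < 4 ^ ((2 * m)\<^sup>2)" by simp
    then have pos: "0 < norm (S2.proj w)" using m(1) by linarith
    have ge: "real ((2 * m)\<^sup>2) * ln 4 \<le> ln (norm (S2.proj w))"
      using ln_mono[OF m(1)] pos by (simp add: ln_realpow)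
    have le: "ln (norm (S2.proj w)) \<le> real ((2 * m + 1)\<^sup>2) * ln 4"
      using ln_mono[OF m(2)] pos by (simp add: ln_realpow)
    show ?thesis
    proof (cases "m \<le> n")
      case True
      have "(2 * real m + 1)\<^sup>2 \<le> (2 * real n + 1)\<^sup>2" using True by (intro power_mono) auto
      then have "real ((2 * m + 1)\<^sup>2) + real n \<le> A"
        by (simp add: A_def power2_eq_square algebra_simps)
      then have "(real ((2 * m + 1)\<^sup>2) + real n) * ln 4 \<le> t"
        unfolding t_def using l4 by (intro mult_right_mono) auto
      moreover have "real n * 1 \<le> real n * ln 4" using l4 by (intro mult_left_mono) auto
      ultimately show ?thesis using le unfolding distrib_right by linarith
    next
      case False
      have "(2 * real n + 2)\<^sup>2 \<le> (2 * real m)\<^sup>2" using False by (intro power_mono) auto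
      then have "A + real n \<le> real ((2 * m)\<^sup>2)"
        by (simp add: A_def power2_eq_square algebra_simps add_divide_distrib)
      then have "(A + real n) * ln 4 \<le> real ((2 * m)\<^sup>2) * ln 4"
        using l4 by (intro mult_right_mono) auto
      moreover have "real n * 1 \<le> real n * ln 4" using l4 by (intro mult_left_mono) auto
      ultimately show ?thesis using ge unfolding t_def distrib_right by linarith
    qed
  qed
  have "real n \<le> rdist S2.surface (S2.up t) (S2.down t)"
    unfolding S2.up_def S2.down_def
  proof (rule S2.rdist_crossing_lower_bound[OF S2.vertical_double _ nonexpansive_ln_norm[of 0] nonexpansive_ln_norm[of 0]])
    fix w assume "Im w = 0" "w \<in> S2.double"
    from far[OF this]
    show "real n \<le> \<bar>ln (norm (S2.proj w - of_real 0)) - ln (norm (S2.proj (?i t) - of_real 0))\<bar>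
        + \<bar>ln (norm (S2.proj (- ?i t) - of_real 0)) - ln (norm (S2.proj w - of_real 0))\<bar>"
      unfolding S2.proj_vertical by (simp add: norm_mult abs_minus_commute)
  qed simp
  moreover have "0 \<le> t" unfolding t_def A_def using l4 by simp
  ultimately show "\<exists>t\<ge>0. real n \<le> rdist S2.surface (S2.up t) (S2.down t)" by blast
qed

theorem theorem1:
  shows "\<exists>(S\<^sub>1 :: (complex set, complex) riemannian) (S\<^sub>2 :: (complex set, complex) riemannian)
      \<alpha>\<^sub>1 \<alpha>\<^sub>1' \<alpha>\<^sub>2 \<alpha>\<^sub>2'.
    hyperbolic_surface S\<^sub>1 \<and> hyperbolic_surface S\<^sub>2 \<and>
    ray S\<^sub>1 \<alpha>\<^sub>1 \<and> ray S\<^sub>1 \<alpha>\<^sub>1' \<and> ray S\<^sub>2 \<alpha>\<^sub>2 \<and> ray S\<^sub>2 \<alpha>\<^sub>2' \<and>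
    (dist_infinity S\<^sub>1 \<alpha>\<^sub>1 \<alpha>\<^sub>1' < \<infinity> \<and> busemann S\<^sub>1 \<alpha>\<^sub>1 \<noteq> busemann S\<^sub>1 \<alpha>\<^sub>1') \<and>
    (busemann S\<^sub>2 \<alpha>\<^sub>2 = busemann S\<^sub>2 \<alpha>\<^sub>2' \<and> dist_infinity S\<^sub>2 \<alpha>\<^sub>2 \<alpha>\<^sub>2' = \<infinity>)"
  using S1.hyperbolic_surface S2.hyperbolic_surface S1.ray_up S1.ray_down S2.ray_up S2.ray_down
    S1_dist_infinity S1_busemann S2_busemann S2_dist_infinity
  by blast

end
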